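(* Let $X$ be a finite ordered list of nonzero vectors spanning the $s$-dimensional real vector space $V$, with $0$ not in the convex hull of $X$. There are uniquely determined polynomials $p_{\underline b,X}$ on $V$, one for each no broken basis $\underline b\in\mathcal{NB}$ extracted from $X$, each homogeneous of degree $|X|-s$ and lying in $D(X)$, such that for every big cell $\mathfrak c$ and every point $x$ in the closure of $\mathfrak c$ $$T_X(x)=\sum_{\underline b\in\mathcal{NB},\ \mathfrak c\subset C(\underline b)}|\det(\underline b)|^{-1}\,p_{\underline b,X}(-x).$$
   Context: $V$ is an $s$-dimensional real vector space with a Lebesgue measure $dx$, $U=V^*$. $X=(a_1,\dots,a_N)$ is an ordered list of nonzero vectors (repetitions allowed) spanning $V$, $0$ not in its convex hull. For a list $A$ of vectors, $C(A):=\{\sum_{a\in A}t_aa\mid t_a\ge0\}$. The multivariate spline $T_X$ is the function on $V$, supported in $C(X)$, characterized by $$\int_V f(x)T_X(x)\,dx=\int_{\mathbb R_+^N}f\Big(\sum_{i=1}^Nt_ia_i\Big)dt$$ for continuous $f$ with compact support; the representative which is continuous on $C(X)$ is used. $|\det(\underline b)|$ is the volume of the parallelepiped with edges $\underline b$. A sublist $Y\subset X$ is a cocircuit if $X-Y$ does not span $V$; $D(X)$ is the space of polynomials $p$ on $V$ with $\big(\prod_{x\in Y}D_x\big)p=0$ for every cocircuit $Y$, where $D_x$ is the directional derivative. A basis extracted from $X$ is a sublist $\underline b=(a_{i_1},\dots,a_{i_s})$, $i_1<\dots<i_s$, which is a basis of $V$. An element $a_i$ of $X$ breaks $\underline b$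 if there is $1\le e\le s$ with $i\le i_e$ and $a_i$ in the span of $a_{i_e},\dots,a_{i_s}$; $\underline b$ is no broken if exactly $s$ elements of $X$ (counted by index), namely those of $\underline b$ itself, break it. $\mathcal{NB}$ is the set of no broken bases extracted from $X$. The singular points of $C(X)$ are the points in the union of the cones $C(A)$, $A\subset X$ not spanning $V$; the other points of $C(X)$ are regular. The set of regular points is a disjoint union of open convex cones (its connected components), called big cells. *)

theory Defs
  imports "HOL-Analysis.Analysis"
begin

text \<open>
  \<open>V\<close> is the whole type \<open>'a :: euclidean_space\<close>, so \<open>s = DIM('a)\<close>; the inner product plays no role
  beyond the topology and the normalisation of \<open>lborel\<close>.  A list of vectors \<open>X\<close> is indexed by
  \<open>{..<length X}\<close>, and sublists of \<open>X\<close> are given by index sets \<open>I\<close>, the actual list being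
  \<open>nths X I\<close>; this keeps repeated vectors apart.
\<close>

definition cone_of :: "'a::euclidean_space list \<Rightarrow> 'a set" where
  "cone_of A = {\<Sum>i<length A. t i *\<^sub>R A ! i | t. \<forall>i. 0 \<le> t i}"

definition parallelepiped :: "'a::euclidean_space list \<Rightarrow> 'a set" where
  "parallelepiped b = {\<Sum>i<length b. t i *\<^sub>R b ! i | t. \<forall>i. 0 \<le> t i \<and> t i \<le> 1}"

text \<open>\<open>M\<close> is the chosen Lebesgue measure on the ambient space.\<close>

definition abs_det :: "'a::euclidean_space measure \<Rightarrow> 'a list \<Rightarrow> real" where
  "abs_det M b = measure M (parallelepiped b)"

definition is_multivariate_spline ::
    "'a::euclidean_space measure \<Rightarrow> 'a list \<Rightarrow> ('a \<Rightarrow> real) \<Rightarrow> bool" where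
  "is_multivariate_spline M X T \<longleftrightarrow>
     continuous_on (cone_of X) T \<and>
     (\<forall>x. x \<notin> cone_of X \<longrightarrow> T x = 0) \<and>
     (\<forall>f :: 'a \<Rightarrow> real. continuous_on UNIV f \<and> compact (closure {x. f x \<noteq> 0}) \<longrightarrow>
        (\<integral>x. f x * T x \<partial>M) =
        (LINT t : ({..<length X} \<rightarrow>\<^sub>E {0..}) | Pi\<^sub>M {..<length X} (\<lambda>_. lborel).
           f (\<Sum>i<length X. t i *\<^sub>R X ! i)))"

text \<open>
  When \<open>X\<close> spans, \<open>cone_of X\<close> is the closure of its interior, so the continuity requirement
  pins down the density everywhere and not only almost everywhere.
\<close>

definition multivariate_spline ::
    "'a::euclidean_space measure \<Rightarrow> 'a list \<Rightarrow> 'a \<Rightarrow> real" where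
  "multivariate_spline M X = (THE T. is_multivariate_spline M X T)"

definition dir_deriv :: "'a::euclidean_space \<Rightarrow> ('a \<Rightarrow> real) \<Rightarrow> 'a \<Rightarrow> real" where
  "dir_deriv v f x = deriv (\<lambda>t. f (x + t *\<^sub>R v)) 0"

text \<open>Minimality is not required of a cocircuit.\<close>

definition cocircuit :: "'a::euclidean_space list \<Rightarrow> nat set \<Rightarrow> bool" where
  "cocircuit X J \<longleftrightarrow> J \<subseteq> {..<length X} \<and> span (set (nths X ({..<length X} - J))) \<noteq> UNIV"

text \<open>Polynomials are identified with the functions they induce, the scalars being \<open>\<real>\<close>.\<close>

definition D_space :: "'a::euclidean_space list \<Rightarrow> ('a \<Rightarrow> real) set" where
  "D_space X = {p. real_polynomial_function p \<and>
     (\<forall>J. cocircuit X J \<longrightarrow> foldr dir_deriv (nths X J) p = (\<lambda>x. 0))}"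

text \<open>The zero polynomial is homogeneous of every degree.\<close>

definition homogeneous_poly :: "nat \<Rightarrow> ('a::euclidean_space \<Rightarrow> real) \<Rightarrow> bool" where
  "homogeneous_poly d p \<longleftrightarrow>
     real_polynomial_function p \<and> (\<forall>t x. p (t *\<^sub>R x) = t ^ d * p x)"

definition extracted_basis :: "'a::euclidean_space list \<Rightarrow> nat set \<Rightarrow> bool" where
  "extracted_basis X I \<longleftrightarrow>
     I \<subseteq> {..<length X} \<and> inj_on ((!) X) I \<and>
     independent ((!) X ` I) \<and> span ((!) X ` I) = UNIV"

text \<open>The index \<open>k\<close> ranges over \<open>i\<^sub>1 < \<dots> < i\<^sub>s\<close>, and \<open>{j \<in> I. k \<le> j}\<close> is \<open>{i\<^sub>e, \<dots>, i\<^sub>s}\<close> for \<open>k = i\<^sub>e\<close>.\<close>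

definition breaks :: "'a::euclidean_space list \<Rightarrow> nat set \<Rightarrow> nat \<Rightarrow> bool" where
  "breaks X I i \<longleftrightarrow>
     i < length X \<and> (\<exists>k\<in>I. i \<le> k \<and> X ! i \<in> span ((!) X ` {j \<in> I. k \<le> j}))"

definition no_broken_bases :: "'a::euclidean_space list \<Rightarrow> nat set set" where
  "no_broken_bases X = {I. extracted_basis X I \<and> {i. breaks X I i} = I}"

definition singular_points :: "'a::euclidean_space list \<Rightarrow> 'a set" where
  "singular_points X =
     (\<Union>J\<in>{J. J \<subseteq> {..<length X} \<and> span (set (nths X J)) \<noteq> UNIV}. cone_of (nths X J))"

definition regular_points :: "'a::euclidean_space list \<Rightarrow> 'a set" where
  "regular_points X = cone_of X - singular_points X"

definition big_cells :: "'a::euclidean_space list \<Rightarrow> 'a set set" where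
  "big_cells X = components (regular_points X)"

end

theory Submission
  imports Defs
begin

text \<open>
  Adding a vector \<open>a\<close> to a spanning list replaces \<open>T\<close> by its integral over the rays \<open>x - t a\<close>, \<open>t \<ge> 0\<close>,
  starting from a constant on the cone of a basis.  Intersecting the ray with simplicial cones shows that,
  off finitely many hyperplanes, \<open>T\<close> is a combination of indicators of cones \<open>C(b)\<close>, \<open>b\<close> a basis, with
  polynomial coefficients.  The same ray, in the direction of the first vector of the list, together with
  induction on the dimension rewrites each indicator through no broken bases.

  Conversely the indicators of the no broken cones are linearly independent.  This gives uniqueness,
  and it transfers every linear property of the local pieces of \<open>T\<close> to the single coefficients: homogeneity,
  and annihilation by the derivatives along cocircuits.
\<close>

section \<open>Cones and no broken bases\<close>

text \<open>Simplicial cones are closed and overlap along walls, where identities between their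
  indicators fail. They are therefore stated at \<open>generic\<close> points, off the proper spans
  of subfamilies. The spline is continuous on the cone of the list, and generic points are dense in
  every cell, which gives the closures back. Independence of the cones concerns real coefficients,
  whereas the pieces are polynomials. Near a generic point the spline equals one polynomial; a
  polynomial identity valid near that point holds on all of V, so it can be evaluated at an
  arbitrary fixed \<open>y\<close>, and the values at \<open>y\<close> are real coefficients to
  which independence applies. The spline is built as a density tested against all nonnegative Borel
  functions, so that integrals may be exchanged freely. Families \<open>a\<close> over ordered index
  sets replace lists: deleting a vector and restricting to a hyperplane keep the order and the
  repetitions. No determinant is computed: volumes are only shown to be positive, and the factor
  |det| / c is put into the polynomials.\<close>

definition gcone :: "(nat \<Rightarrow> 'a::real_vector) \<Rightarrow> nat set \<Rightarrow> 'a set" where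
  "gcone a I = {\<Sum>i\<in>I. t i *\<^sub>R a i | t. \<forall>i\<in>I. 0 \<le> t i}"

text \<open>Independence of an indexed family rather than of its image: two indices carrying the
  same vector are dependent. \<open>lin_indep_iff\<close> translates to
  \<open>independent\<close>.\<close>

definition lin_indep :: "(nat \<Rightarrow> 'a::real_vector) \<Rightarrow> nat set \<Rightarrow> bool" where
  "lin_indep a b \<longleftrightarrow> finite b \<and> (\<forall>u. (\<Sum>i\<in>b. u i *\<^sub>R a i) = 0 \<longrightarrow> (\<forall>i\<in>b. u i = 0))"

definition coord :: "(nat \<Rightarrow> 'a::real_vector) \<Rightarrow> nat set \<Rightarrow> 'a \<Rightarrow> nat \<Rightarrow> real" where
  "coord a b x = (SOME u. x = (\<Sum>i\<in>b. u i *\<^sub>R a i))"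

text \<open>Relative to the span of the vectors indexed by \<open>I\<close>, which may be a proper
  subspace, because the inductions descend into hyperplanes. The same holds for
  \<open>bases\<close>.\<close>

definition generic :: "(nat \<Rightarrow> 'a::real_vector) \<Rightarrow> nat set \<Rightarrow> 'a \<Rightarrow> bool" where
  "generic a I x \<longleftrightarrow>
     x \<in> span (a ` I) \<and> (\<forall>J\<subseteq>I. span (a ` J) \<noteq> span (a ` I) \<longrightarrow> x \<notin> span (a ` J))"

definition bases :: "(nat \<Rightarrow> 'a::real_vector) \<Rightarrow> nat set \<Rightarrow> nat set set" where
  "bases a I = {b. b \<subseteq> I \<and> lin_indep a b \<and> span (a ` b) = span (a ` I)}"

definition nb_bases :: "(nat \<Rightarrow> 'a::real_vector) \<Rightarrow> nat set \<Rightarrow> nat set set" where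
  "nb_bases a I =
     {b \<in> bases a I. {i \<in> I. \<exists>k\<in>b. i \<le> k \<and> a i \<in> span (a ` {j \<in> b. k \<le> j})} = b}"

section \<open>Coordinates and simplicial cones\<close>

lemma in_span_image_iff:
  assumes "finite I"
  shows "x \<in> span (a ` I) \<longleftrightarrow> (\<exists>u. x = (\<Sum>i\<in>I. u i *\<^sub>R a i))"
  using assms
proof (induction I arbitrary: x)
  case empty
  then show ?case by simp
next
  case (insert k I)
  show ?case
  proof
    assume "x \<in> span (a ` insert k I)"
    then obtain r where "x - r *\<^sub>R a k \<in> span (a ` I)"
      by (auto simp: span_insert)
    then obtain u where "x - r *\<^sub>R a k = (\<Sum>i\<in>I. u i *\<^sub>R a i)"
      using insert.IH by blast
    then have "x = (\<Sum>i\<in>insert k I. (u(k := r)) i *\<^sub>R a i)"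
      using insert.hyps by (auto simp: algebra_simps intro!: sum.cong)
    then show "\<exists>u. x = (\<Sum>i\<in>insert k I. u i *\<^sub>R a i)" by blast
  next
    assume "\<exists>u. x = (\<Sum>i\<in>insert k I. u i *\<^sub>R a i)"
    then obtain u where "x = (\<Sum>i\<in>insert k I. u i *\<^sub>R a i)" by blast
    then show "x \<in> span (a ` insert k I)"
      by (simp only:) (intro span_sum span_scale span_base imageI)
  qed
qed

lemma coord_sum:
  assumes "finite b" "x \<in> span (a ` b)"
  shows "(\<Sum>i\<in>b. coord a b x i *\<^sub>R a i) = x"
proof -
  have "x = (\<Sum>i\<in>b. coord a b x i *\<^sub>R a i)"
    unfolding coord_def using assms in_span_image_iff[of b x a] by (intro someI_ex[of "\<lambda>u. x = (\<Sum>i\<in>b. u i *\<^sub>R a i)"]) simp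
  then show ?thesis by simp
qed

lemma lin_indep_cong:
  assumes "lin_indep a b" "(\<Sum>i\<in>b. u i *\<^sub>R a i) = (\<Sum>i\<in>b. v i *\<^sub>R a i)" "i \<in> b"
  shows "u i = v i"
proof -
  have "(\<Sum>i\<in>b. (u i - v i) *\<^sub>R a i) = 0"
    using assms(2) by (simp add: scaleR_left_diff_distrib sum_subtractf)
  then show ?thesis using assms unfolding lin_indep_def by (metis eq_iff_diff_eq_0)
qed

lemma coord_unique:
  assumes "lin_indep a b" "i \<in> b"
  shows "coord a b (\<Sum>i\<in>b. u i *\<^sub>R a i) i = u i"
proof -
  have "finite b" using assms by (simp add: lin_indep_def)
  then have "(\<Sum>i\<in>b. u i *\<^sub>R a i) \<in> span (a ` b)" by (auto simp: in_span_image_iff)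
  then show ?thesis
    using lin_indep_cong[OF assms(1) coord_sum[OF \<open>finite b\<close>] assms(2)] by simp
qed

lemma coord_add:
  assumes "lin_indep a b" "i \<in> b" "x \<in> span (a ` b)" "y \<in> span (a ` b)"
  shows "coord a b (x + y) i = coord a b x i + coord a b y i"
proof -
  have fin: "finite b" using assms by (simp add: lin_indep_def)
  have "x + y = (\<Sum>i\<in>b. (coord a b x i + coord a b y i) *\<^sub>R a i)"
    using coord_sum[OF fin assms(3)] coord_sum[OF fin assms(4)]
    by (simp add: scaleR_left_distrib sum.distrib)
  then show ?thesis using coord_unique[OF assms(1,2)] by metis
qed

lemma coord_scale:
  assumes "lin_indep a b" "i \<in> b" "x \<in> span (a ` b)"
  shows "coord a b (r *\<^sub>R x) i = r * coord a b x i"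
proof -
  have fin: "finite b" using assms by (simp add: lin_indep_def)
  have "r *\<^sub>R x = r *\<^sub>R (\<Sum>i\<in>b. coord a b x i *\<^sub>R a i)"
    using coord_sum[OF fin assms(3)] by simp
  then have "r *\<^sub>R x = (\<Sum>i\<in>b. (r * coord a b x i) *\<^sub>R a i)"
    by (simp add: scaleR_sum_right)
  then show ?thesis using coord_unique[OF assms(1,2)] by metis
qed

lemma coord_vec:
  assumes "lin_indep a b" "i \<in> b" "k \<in> b"
  shows "coord a b (a k) i = (if i = k then 1 else 0)"
proof -
  have fin: "finite b" using assms by (simp add: lin_indep_def)
  have "(\<Sum>i\<in>b. (if i = k then 1 else 0) *\<^sub>R a i) = (\<Sum>i\<in>b. if i = k then a i else 0)"
    by (intro sum.cong) auto
  also have "\<dots> = a k" using assms fin by simp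
  finally show ?thesis using coord_unique[OF assms(1,2), of "\<lambda>i. if i = k then 1 else 0"] by simp
qed

lemma linear_coord:
  assumes "lin_indep a b" "i \<in> b" "span (a ` b) = UNIV"
  shows "linear (\<lambda>x. coord a b x i)"
  by (rule linearI) (simp_all add: coord_add[OF assms(1,2)] coord_scale[OF assms(1,2)] assms(3))

lemma lin_indep_insert:
  assumes "k \<notin> c"
  shows "lin_indep a (insert k c) \<longleftrightarrow> lin_indep a c \<and> a k \<notin> span (a ` c)"
proof (cases "finite c")
  case True
  show ?thesis
  proof
    assume L: "lin_indep a (insert k c)"
    have "lin_indep a c"
      unfolding lin_indep_def
    proof (intro conjI allI impI True)
      fix u :: "nat \<Rightarrow> real" assume u: "(\<Sum>i\<in>c. u i *\<^sub>R a i) = 0"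
      have "(\<Sum>i\<in>insert k c. (u(k := 0)) i *\<^sub>R a i) = (\<Sum>i\<in>c. u i *\<^sub>R a i)"
        using True assms by (auto intro!: sum.cong)
      then have "\<forall>i\<in>insert k c. (u(k := 0)) i = 0" using L u unfolding lin_indep_def by metis
      then show "\<forall>i\<in>c. u i = 0" using assms by (metis fun_upd_apply insertCI)
    qed
    moreover have "a k \<notin> span (a ` c)"
    proof
      assume "a k \<in> span (a ` c)"
      then obtain u where "a k = (\<Sum>i\<in>c. u i *\<^sub>R a i)" using in_span_image_iff[OF True] by blast
      moreover have "(\<Sum>i\<in>c. (u(k := -1)) i *\<^sub>R a i) = (\<Sum>i\<in>c. u i *\<^sub>R a i)"
        using assms by (intro sum.cong) auto
      ultimately have "(\<Sum>i\<in>insert k c. (u(k := -1)) i *\<^sub>R a i) = 0" using True assms by simp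
      then have "(u(k := -1)) k = 0" using L unfolding lin_indep_def by blast
      then show False by simp
    qed
    ultimately show "lin_indep a c \<and> a k \<notin> span (a ` c)" by simp
  next
    assume R: "lin_indep a c \<and> a k \<notin> span (a ` c)"
    show "lin_indep a (insert k c)"
      unfolding lin_indep_def
    proof (intro conjI allI impI)
      show "finite (insert k c)" using True by simp
      fix u :: "nat \<Rightarrow> real" assume "(\<Sum>i\<in>insert k c. u i *\<^sub>R a i) = 0"
      then have u: "u k *\<^sub>R a k + (\<Sum>i\<in>c. u i *\<^sub>R a i) = 0" using True assms by simp
      have "u k = 0"
      proof (rule ccontr)
        assume nz: "u k \<noteq> 0"
        have "u k *\<^sub>R a k = - (\<Sum>i\<in>c. u i *\<^sub>R a i)" using u by (simp add: eq_neg_iff_add_eq_0)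
        then have "u k *\<^sub>R a k \<in> span (a ` c)"
          using True by (metis in_span_image_iff span_neg)
        then have "inverse (u k) *\<^sub>R (u k *\<^sub>R a k) \<in> span (a ` c)" by (rule span_scale)
        then show False using nz R by simp
      qed
      then have "(\<Sum>i\<in>c. u i *\<^sub>R a i) = 0" using u by simp
      then show "\<forall>i\<in>insert k c. u i = 0" using R \<open>u k = 0\<close> unfolding lin_indep_def by blast
    qed
  qed
next
  case False
  then show ?thesis by (simp add: lin_indep_def)
qed

lemma lin_indep_remove:
  assumes "lin_indep a b" "j \<in> b"
  shows "lin_indep a (b - {j})" "a j \<notin> span (a ` (b - {j}))"
  using lin_indep_insert[of j "b - {j}" a] assms by (auto simp: insert_absorb)

lemma coord_eq_0_iff:
  assumes "lin_indep a b" "j \<in> b" "x \<in> span (a ` b)"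
  shows "coord a b x j = 0 \<longleftrightarrow> x \<in> span (a ` (b - {j}))"
proof -
  have fin: "finite b" using assms by (simp add: lin_indep_def)
  have eq: "x = coord a b x j *\<^sub>R a j + (\<Sum>i\<in>b-{j}. coord a b x i *\<^sub>R a i)"
    using coord_sum[OF fin assms(3)] sum.remove[OF fin assms(2), of "\<lambda>i. coord a b x i *\<^sub>R a i"]
    by simp
  have S: "(\<Sum>i\<in>b-{j}. coord a b x i *\<^sub>R a i) \<in> span (a ` (b - {j}))"
    using in_span_image_iff[of "b-{j}" _ a] fin by blast
  show ?thesis
  proof
    assume "coord a b x j = 0" then show "x \<in> span (a ` (b - {j}))" using eq S by simp
  next
    assume x: "x \<in> span (a ` (b - {j}))"
    have "coord a b x j *\<^sub>R a j = x - (\<Sum>i\<in>b-{j}. coord a b x i *\<^sub>R a i)" using eq by (simp add: algebra_simps)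
    then have "coord a b x j *\<^sub>R a j \<in> span (a ` (b - {j}))" using x S by (simp add: span_diff)
    then show "coord a b x j = 0"
      using lin_indep_remove(2)[OF assms(1,2)] by (metis span_scale scaleR_scaleR left_inverse scaleR_one)
  qed
qed

text \<open>Steinitz exchange, with the condition in the form produced by a ray: the direction
  \<open>a k\<close> crosses the wall opposite to \<open>a j\<close> exactly if its
  \<open>j\<close>-th coordinate does not vanish.\<close>

lemma exchange:
  assumes "lin_indep a b" "j \<in> b" "a k \<in> span (a ` b)" "coord a b (a k) j \<noteq> 0"
  shows "k \<notin> b - {j}" "a k \<notin> span (a ` (b - {j}))" "lin_indep a (insert k (b - {j}))"
    "span (a ` insert k (b - {j})) = span (a ` b)"
proof -
  show k: "k \<notin> b - {j}" using assms coord_vec[OF assms(1,2), of k] by (auto split: if_splits)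
  show nk: "a k \<notin> span (a ` (b - {j}))" using coord_eq_0_iff[OF assms(1-3)] assms(4) by simp
  show "lin_indep a (insert k (b - {j}))"
    using lin_indep_insert[OF k, of a] nk lin_indep_remove(1)[OF assms(1,2)] by simp
  have b: "insert (a j) (a ` (b - {j})) = a ` b" using assms(2) by auto
  show "span (a ` insert k (b - {j})) = span (a ` b)"
  proof (rule antisym)
    show "span (a ` insert k (b - {j})) \<subseteq> span (a ` b)"
      using assms(3) by (intro span_minimal) (auto intro: span_base)
    have "a j \<in> span (insert (a k) (a ` (b - {j})))"
      by (rule in_span_insert) (use assms(3) nk b in auto)
    then show "span (a ` b) \<subseteq> span (a ` insert k (b - {j}))"
      by (intro span_minimal) (auto, metis DiffI imageI insertCI singletonD span_base)
  qed
qed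

lemma gcone_subset_span: "finite I \<Longrightarrow> gcone a I \<subseteq> span (a ` I)"
  by (auto simp: gcone_def in_span_image_iff)

lemma in_gcone_iff:
  assumes "lin_indep a b" "x \<in> span (a ` b)"
  shows "x \<in> gcone a b \<longleftrightarrow> (\<forall>i\<in>b. 0 \<le> coord a b x i)"
proof
  assume "x \<in> gcone a b"
  then obtain t where t: "x = (\<Sum>i\<in>b. t i *\<^sub>R a i)" "\<forall>i\<in>b. 0 \<le> t i" by (auto simp: gcone_def)
  then show "\<forall>i\<in>b. 0 \<le> coord a b x i" using coord_unique[OF assms(1), of _ t] by simp
next
  assume *: "\<forall>i\<in>b. 0 \<le> coord a b x i"
  have "x = (\<Sum>i\<in>b. coord a b x i *\<^sub>R a i)"
    using coord_sum[of b x a] assms by (simp add: lin_indep_def)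
  then show "x \<in> gcone a b" using * unfolding gcone_def by blast
qed

lemma gcone_insert:
  assumes "finite c" "k \<notin> c"
  shows "gcone a (insert k c) = {h + t *\<^sub>R a k | h t. h \<in> gcone a c \<and> 0 \<le> t}"
proof (intro set_eqI iffI)
  fix x assume "x \<in> gcone a (insert k c)"
  then obtain t where t: "x = (\<Sum>i\<in>insert k c. t i *\<^sub>R a i)" "\<forall>i\<in>insert k c. 0 \<le> t i"
    by (auto simp: gcone_def)
  then have "x = (\<Sum>i\<in>c. t i *\<^sub>R a i) + t k *\<^sub>R a k" using assms by simp
  moreover have "(\<Sum>i\<in>c. t i *\<^sub>R a i) \<in> gcone a c" using t by (auto simp: gcone_def)
  ultimately show "x \<in> {h + t *\<^sub>R a k | h t. h \<in> gcone a c \<and> 0 \<le> t}" using t by blast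
next
  fix x assume "x \<in> {h + t *\<^sub>R a k | h t. h \<in> gcone a c \<and> 0 \<le> t}"
  then obtain u t where u: "x = (\<Sum>i\<in>c. u i *\<^sub>R a i) + t *\<^sub>R a k" "\<forall>i\<in>c. 0 \<le> u i" "0 \<le> t"
    by (auto simp: gcone_def)
  have "(\<Sum>i\<in>c. u i *\<^sub>R a i) = (\<Sum>i\<in>c. (u(k := t)) i *\<^sub>R a i)"
    using assms by (intro sum.cong) auto
  then have "x = (\<Sum>i\<in>insert k c. (u(k := t)) i *\<^sub>R a i)" using u assms by simp
  moreover have "\<forall>i\<in>insert k c. 0 \<le> (u(k := t)) i" using u by simp
  ultimately show "x \<in> gcone a (insert k c)" unfolding gcone_def by blast
qed

lemma span_decomp_unique:
  assumes "h + t *\<^sub>R v = h' + t' *\<^sub>R v" "h \<in> span S" "h' \<in> span S" "v \<notin> span S"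
  shows "t = t'" "h = h'"
proof -
  have "(t - t') *\<^sub>R v = h' - h" using assms(1) by (simp add: algebra_simps)
  then have "(t - t') *\<^sub>R v \<in> span S" using assms by (simp add: span_diff)
  then show "t = t'" using assms(4)
    by (metis eq_iff_diff_eq_0 left_inverse scaleR_one scaleR_scaleR span_scale)
  then show "h = h'" using assms(1) by simp
qed

text \<open>Since \<open>a k\<close> lies off the span of \<open>c\<close>, base point and height
  are unique, and the cone is the product of a cone in that span and a half-line.\<close>

lemma gcone_insert_iff:
  assumes "finite c" "h \<in> span (a ` c)" "a k \<notin> span (a ` c)"
  shows "h + t *\<^sub>R a k \<in> gcone a (insert k c) \<longleftrightarrow> h \<in> gcone a c \<and> 0 \<le> t"
proof -
  have "k \<notin> c" using assms(3) by (auto intro: span_base)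
  show ?thesis
  proof
    assume "h + t *\<^sub>R a k \<in> gcone a (insert k c)"
    then obtain h' t' where h': "h + t *\<^sub>R a k = h' + t' *\<^sub>R a k" "h' \<in> gcone a c" "0 \<le> t'"
      using gcone_insert[OF assms(1) \<open>k \<notin> c\<close>, of a] by auto
    then have "h' \<in> span (a ` c)" using gcone_subset_span[OF assms(1)] by blast
    then show "h \<in> gcone a c \<and> 0 \<le> t"
      using span_decomp_unique[OF h'(1) assms(2) _ assms(3)] h' by simp
  next
    assume "h \<in> gcone a c \<and> 0 \<le> t"
    then show "h + t *\<^sub>R a k \<in> gcone a (insert k c)"
      using gcone_insert[OF assms(1) \<open>k \<notin> c\<close>, of a] by auto
  qed
qed

text \<open>Gives access to the facts on convex cone hulls of finite sets: they are convex, closed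
  and polyhedral.\<close>

lemma gcone_eq_hull:
  assumes "finite I"
  shows "gcone a I = convex_cone hull (a ` I)"
  using assms
proof (induction I)
  case empty
  then show ?case by (simp add: gcone_def)
next
  case (insert k I)
  have "convex_cone hull {a k} = {t *\<^sub>R a k | t. 0 \<le> t}"
    by (auto simp: convex_cone_hull_convex_hull intro: exI[of _ 0])
  moreover have "a ` insert k I = a ` I \<union> {a k}" by auto
  ultimately show ?case
    by (simp only: convex_cone_hull_Un gcone_insert[OF insert.hyps] insert.IH) blast
qed

section \<open>No broken bases and the smallest index; times at which a ray crosses walls\<close>

lemma nb_bases_empty: "nb_bases a {} = {{}}"
  by (auto simp: nb_bases_def bases_def lin_indep_def)

text \<open>A tail of \<open>insert m b\<close> either starts at \<open>m\<close>, and then can be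
  broken only by an index at most \<open>m\<close>, that is by \<open>m\<close> itself; or it is a
  tail of \<open>b\<close>, whose span lies in \<open>H\<close>, so that the breaking indices
  already belong to the family of \<open>H\<close>.\<close>

lemma nb_bases_insert:
  assumes "b \<in> nb_bases a {i \<in> I. a i \<in> H}" "H = span (a ` {i \<in> I. a i \<in> H})"
    and "m \<in> I" "\<And>i. i \<in> I \<Longrightarrow> m \<le> i" "a m \<notin> H" "span (insert (a m) H) = span (a ` I)"
  shows "insert m b \<in> nb_bases a I"
proof -
  have b: "b \<subseteq> {i \<in> I. a i \<in> H}" "lin_indep a b" "span (a ` b) = H"
    and br: "{i \<in> {i \<in> I. a i \<in> H}. \<exists>k\<in>b. i \<le> k \<and> a i \<in> span (a ` {j \<in> b. k \<le> j})} = b"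
    using assms(1,2) by (auto simp: nb_bases_def bases_def)
  have mb: "m \<notin> b" using b assms(5) by auto
  have "span (a ` insert m b) = span (a ` I)"
  proof -
    have "span (insert (a m) (a ` b)) = span (insert (a m) H)"
      unfolding span_insert b(3) span_span
      using b(3) span_span by metis
    then show ?thesis using assms(6) by simp
  qed
  then have "insert m b \<in> bases a I"
    using b mb assms lin_indep_insert[OF mb, of a] by (auto simp: bases_def)
  moreover have "{i \<in> I. \<exists>k\<in>insert m b. i \<le> k \<and> a i \<in> span (a ` {j \<in> insert m b. k \<le> j})} = insert m b"
  proof (intro set_eqI iffI)
    fix i assume "i \<in> {i \<in> I. \<exists>k\<in>insert m b. i \<le> k \<and> a i \<in> span (a ` {j \<in> insert m b. k \<le> j})}"
    then obtain k where k: "i \<in> I" "k \<in> insert m b" "i \<le> k" "a i \<in> span (a ` {j \<in> insert m b. k \<le> j})"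
      by blast
    show "i \<in> insert m b"
    proof (cases "k = m")
      case True
      then show ?thesis using k assms(4) by (metis antisym insertI1)
    next
      case False
      then have kb: "k \<in> b" "m < k" using k b assms(4) by (auto simp: le_less)
      then have "{j \<in> insert m b. k \<le> j} = {j \<in> b. k \<le> j}" by auto
      then have ai: "a i \<in> span (a ` {j \<in> b. k \<le> j})" using k by simp
      moreover have "span (a ` {j \<in> b. k \<le> j}) \<subseteq> span (a ` b)" by (intro span_mono) auto
      ultimately have "a i \<in> H" using b(3) by auto
      moreover have "\<exists>k\<in>b. i \<le> k \<and> a i \<in> span (a ` {j \<in> b. k \<le> j})"
        using ai k kb by (intro bexI[of _ k]) auto
      ultimately have "i \<in> {i \<in> {i \<in> I. a i \<in> H}. \<exists>k\<in>b. i \<le> k \<and> a i \<in> span (a ` {j \<in> b. k \<le> j})}"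
        using k(1) by simp
      then show ?thesis unfolding br by simp
    qed
  next
    fix i assume i: "i \<in> insert m b"
    then have "a i \<in> span (a ` {j \<in> insert m b. i \<le> j})" by (auto intro: span_base)
    then show "i \<in> {i \<in> I. \<exists>k\<in>insert m b. i \<le> k \<and> a i \<in> span (a ` {j \<in> insert m b. k \<le> j})}"
      using i b assms(3) by blast
  qed
  ultimately show ?thesis by (simp add: nb_bases_def)
qed

text \<open>The tail starting at the least index of \<open>b\<close> is all of \<open>b\<close>, so
  it spans and is broken by \<open>m\<close>; hence \<open>m\<close> belongs to \<open>b\<close>. As
  \<open>a m\<close> is not 0, \<open>b\<close> is not empty. Together with
  \<open>nb_bases_insert\<close> this matches the no broken bases of \<open>I\<close> lying over
  \<open>H\<close> with those of \<open>H\<close>.\<close>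

lemma nb_bases_remove:
  assumes "finite I" "b \<in> nb_bases a I" "m \<in> I" "\<And>i. i \<in> I \<Longrightarrow> m \<le> i" "a m \<noteq> 0"
    and "H = span (a ` (b - {m}))"
  shows "m \<in> b" "b - {m} \<in> nb_bases a {i \<in> I. a i \<in> H}" "H = span (a ` {i \<in> I. a i \<in> H})"
    "a m \<notin> H" "span (insert (a m) H) = span (a ` I)"
proof -
  have b: "b \<subseteq> I" "lin_indep a b" "span (a ` b) = span (a ` I)"
    and br: "{i \<in> I. \<exists>k\<in>b. i \<le> k \<and> a i \<in> span (a ` {j \<in> b. k \<le> j})} = b"
    using assms(2) by (auto simp: nb_bases_def bases_def)
  have am: "a m \<in> span (a ` b)" using b assms(3) by (auto intro: span_base)
  then have "b \<noteq> {}" using assms(5) by auto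
  have "finite b" using b assms(1) finite_subset by auto
  define k where "k = Min b"
  have k: "k \<in> b" "\<And>j. j \<in> b \<Longrightarrow> k \<le> j" unfolding k_def using \<open>finite b\<close> \<open>b \<noteq> {}\<close> by auto
  then have "{j \<in> b. k \<le> j} = b" by auto
  then have "\<exists>k\<in>b. m \<le> k \<and> a m \<in> span (a ` {j \<in> b. k \<le> j})"
    using am k(1) assms(4) b by (intro bexI[of _ k]) auto
  then have "m \<in> {i \<in> I. \<exists>k\<in>b. i \<le> k \<and> a i \<in> span (a ` {j \<in> b. k \<le> j})}"
    using assms(3) by simp
  then show mb: "m \<in> b" unfolding br .
  show nm: "a m \<notin> H" using lin_indep_remove(2)[OF b(2) mb] assms(6) by simp
  show Hs: "H = span (a ` {i \<in> I. a i \<in> H})"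
  proof (rule antisym)
    have "b - {m} \<subseteq> {i \<in> I. a i \<in> H}" using b assms(6) by (auto intro: span_base)
    then have "a ` (b - {m}) \<subseteq> a ` {i \<in> I. a i \<in> H}" by (rule image_mono)
    then show "H \<subseteq> span (a ` {i \<in> I. a i \<in> H})" unfolding assms(6) by (rule span_mono)
    show "span (a ` {i \<in> I. a i \<in> H}) \<subseteq> H" unfolding assms(6) by (intro span_minimal) auto
  qed
  have "span (insert (a m) H) = span (insert (a m) (a ` (b - {m})))"
    unfolding span_insert assms(6) span_span by simp
  moreover have "insert (a m) (a ` (b - {m})) = a ` b" using mb by auto
  ultimately show "span (insert (a m) H) = span (a ` I)" using b by simp
  have "b - {m} \<in> bases a {i \<in> I. a i \<in> H}"
    unfolding bases_def
  proof (intro CollectI conjI)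
    show "b - {m} \<subseteq> {i \<in> I. a i \<in> H}" using b assms(6) by (auto intro: span_base)
    show "lin_indep a (b - {m})" by (rule lin_indep_remove(1)[OF b(2) mb])
    show "span (a ` (b - {m})) = span (a ` {i \<in> I. a i \<in> H})" using Hs assms(6) by simp
  qed
  moreover have "{i \<in> {i \<in> I. a i \<in> H}. \<exists>k\<in>b - {m}. i \<le> k \<and> a i \<in> span (a ` {j \<in> b - {m}. k \<le> j})} = b - {m}"
  proof (intro set_eqI iffI)
    fix i assume "i \<in> {i \<in> {i \<in> I. a i \<in> H}. \<exists>k\<in>b - {m}. i \<le> k \<and> a i \<in> span (a ` {j \<in> b - {m}. k \<le> j})}"
    then obtain k where k: "i \<in> I" "a i \<in> H" "k \<in> b - {m}" "i \<le> k" "a i \<in> span (a ` {j \<in> b - {m}. k \<le> j})"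
      by blast
    then have "a i \<in> span (a ` {j \<in> b. k \<le> j})" using span_mono[of "a ` {j \<in> b - {m}. k \<le> j}" "a ` {j \<in> b. k \<le> j}"] by auto
    moreover have "\<exists>k\<in>b. i \<le> k \<and> a i \<in> span (a ` {j \<in> b. k \<le> j})"
      using calculation k by (intro bexI[of _ k]) auto
    ultimately have "i \<in> {i \<in> I. \<exists>k\<in>b. i \<le> k \<and> a i \<in> span (a ` {j \<in> b. k \<le> j})}"
      using k(1) by simp
    then show "i \<in> b - {m}" unfolding br using k nm by auto
  next
    fix i assume i: "i \<in> b - {m}"
    then have "a i \<in> span (a ` {j \<in> b - {m}. i \<le> j})" by (auto intro: span_base)
    moreover have "a i \<in> H" using i assms(6) by (auto intro: span_base)
    ultimately show "i \<in> {i \<in> {i \<in> I. a i \<in> H}. \<exists>k\<in>b - {m}. i \<le> k \<and> a i \<in> span (a ` {j \<in> b - {m}. k \<le> j})}"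
      using i b by blast
  qed
  ultimately show "b - {m} \<in> nb_bases a {i \<in> I. a i \<in> H}" by (simp add: nb_bases_def)
qed

text \<open>Here \<open>c\<close> and \<open>l\<close> stand for the coordinates of a point and of a
  direction, so that \<open>S\<close> is the set of times at which the ray is in the cone and
  \<open>E\<close> the set of walls it meets while in the cone. As no two walls are met at once, the
  ray misses the cone, or starts inside and leaves through one wall, or enters through one wall and
  leaves through another. A positive \<open>l i\<close> makes the set of times bounded.\<close>

lemma crossing:
  fixes c l :: "nat \<Rightarrow> real"
  assumes "finite b" "\<exists>i\<in>b. 0 < l i" "\<And>i. i \<in> b \<Longrightarrow> c i \<noteq> 0"
    and ne: "\<And>i j. i \<in> b \<Longrightarrow> j \<in> b \<Longrightarrow> l i \<noteq> 0 \<Longrightarrow> l j \<noteq> 0 \<Longrightarrow> c i / l i = c j / l j \<Longrightarrow> i = j"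
  defines "S \<equiv> {t. 0 \<le> t \<and> (\<forall>i\<in>b. 0 \<le> c i - t * l i)}"
  defines "E \<equiv> {j\<in>b. l j \<noteq> 0 \<and> c j / l j \<in> S}"
  shows "(S = {} \<and> E = {}) \<or> (\<exists>j. E = {j} \<and> 0 < l j \<and> 0 < c j / l j \<and> S = {0..c j / l j}) \<or>
    (\<exists>j k. E = {j, k} \<and> j \<noteq> k \<and> 0 < l j \<and> l k < 0 \<and> 0 < c k / l k \<and> c k / l k < c j / l j \<and> S = {c k / l k..c j / l j})"
proof (cases "S = {}")
  case True
  then show ?thesis by (simp add: E_def)
next
  case False
  then obtain t where t: "t \<in> S" by blast
  \<comment> \<open>Coordinates with positive \<open>l\<close> decrease along the ray; the first of
    them to vanish, at time \<open>u\<close>, determines the exit.\<close>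
  define P where "P = {i\<in>b. 0 < l i}"
  have P: "finite P" "P \<noteq> {}" using assms by (auto simp: P_def)
  obtain p where p: "p \<in> P" "\<And>i. i \<in> P \<Longrightarrow> c p / l p \<le> c i / l i"
    using arg_min_if_finite[OF P, of "\<lambda>i. c i / l i"] by (auto simp: not_less)
  have pb: "p \<in> b" "0 < l p" using p by (auto simp: P_def)
  have ub: "s \<le> c p / l p" if "s \<in> S" for s
    using that pb by (auto simp: S_def field_simps)
  define u where "u = c p / l p"
  have up: "s * l i \<le> c i" if "i \<in> b" "0 < l i" "s \<le> u" for i s
  proof -
    have "s \<le> c i / l i" using that p(2)[of i] by (auto simp: P_def u_def)
    then show ?thesis using that by (simp add: field_simps)
  qed
  have tu: "t \<le> u" "0 \<le> t" using ub[OF t] t by (auto simp: u_def S_def)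
  have tc: "t * l i \<le> c i" if "i \<in> b" for i using t that by (auto simp: S_def)
  have uS: "u \<in> S"
    unfolding S_def
  proof (clarsimp, intro conjI ballI)
    show "0 \<le> u" using tu by simp
    fix i assume i: "i \<in> b"
    show "u * l i \<le> c i"
    proof (cases "0 < l i")
      case False
      then have "u * l i \<le> t * l i" using tu by (intro mult_right_mono_neg) auto
      then show ?thesis using tc[OF i] by simp
    qed (use up i in auto)
  qed
  have E_pos: "j = p" if "j \<in> E" "0 < l j" for j
  proof -
    have "c j / l j \<le> u" using ub that by (simp add: E_def u_def)
    moreover have "u \<le> c j / l j" using uS that by (auto simp: S_def E_def field_simps)
    ultimately have "c j / l j = c p / l p" by (simp add: u_def)
    then show ?thesis by (intro ne) (use that pb in \<open>simp_all add: E_def\<close>)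
  qed
  have pE: "p \<in> E" using pb uS by (simp add: E_def u_def)
  have u0: "0 < u" using tu assms(3)[OF pb(1)] pb by (auto simp: u_def less_le)
  show ?thesis
  proof (cases "\<forall>i\<in>b. 0 \<le> c i")
    case True
    have "j = p" if "j \<in> E" for j
    proof (cases "0 < l j")
      case False
      then have "l j < 0" "j \<in> b" "0 \<le> c j / l j" using that by (auto simp: E_def S_def)
      then have "c j \<le> 0" by (simp add: zero_le_divide_iff)
      then show ?thesis using True assms(3) \<open>j \<in> b\<close> by (metis antisym)
    qed (use E_pos that in auto)
    with pE have "E = {p}" by blast
    moreover have "S = {0..u}"
    proof (intro set_eqI iffI)
      fix s assume "s \<in> {0..u}"
      moreover have "s * l i \<le> c i" if "i \<in> b" "s \<in> {0..u}" for i
      proof (cases "0 < l i")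
        case False
        then have "s * l i \<le> 0" using that by (simp add: mult_nonneg_nonpos)
        then show ?thesis using True that by force
      qed (use up that in auto)
      ultimately show "s \<in> S" by (auto simp: S_def)
    qed (use ub in \<open>auto simp: S_def u_def\<close>)
    ultimately show ?thesis using pb u0 by (auto simp: u_def)
  next
    case False
    then obtain z where z: "z \<in> b" "c z < 0" by (auto simp: not_le)
    have lz: "l z < 0"
    proof (rule ccontr)
      assume "\<not> l z < 0"
      then have "0 \<le> t * l z" using tu by simp
      then show False using tc[OF z(1)] z by simp
    qed
    \<comment> \<open>The point starts outside, so some coordinate is negative and has to increase.
      The last coordinate with negative \<open>l\<close> to reach its zero, at time
      \<open>w\<close>, determines the entry.\<close>
    define N where "N = {i\<in>b. l i < 0}"
    have N: "finite N" "N \<noteq> {}" using assms z lz by (auto simp: N_def)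
    obtain n where n: "n \<in> N" "\<And>i. i \<in> N \<Longrightarrow> c i / l i \<le> c n / l n"
      using arg_min_if_finite[OF N, of "\<lambda>i. - (c i / l i)"] by (auto simp: not_less)
    have nb: "n \<in> b" "l n < 0" using n by (auto simp: N_def)
    define w where "w = c n / l n"
    have w0: "0 < w" using n(2)[of z] z lz divide_neg_neg[of "c z" "l z"] by (auto simp: N_def w_def)
    have lb: "w \<le> s" if "s \<in> S" for s
      using that nb by (auto simp: S_def w_def field_simps)
    have lo: "s * l i \<le> c i" if "i \<in> b" "l i < 0" "w \<le> s" for i s
    proof -
      have "c i / l i \<le> s" using that n(2)[of i] by (auto simp: N_def w_def)
      then show ?thesis using that by (simp add: field_simps)
    qed
    have Siff: "S = {w..u}"
    proof (intro set_eqI iffI)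
      fix s assume s: "s \<in> {w..u}"
      have "s * l i \<le> c i" if i: "i \<in> b" for i
      proof (cases "l i" "0::real" rule: linorder_cases)
        case equal
        then show ?thesis using tc[OF i] by simp
      qed (use lo up i s in auto)
      then show "s \<in> S" using s w0 by (auto simp: S_def)
    qed (use ub lb in \<open>auto simp: u_def\<close>)
    have wu: "w \<le> u" using lb[OF uS] .
    have nE: "n \<in> E" using nb Siff wu by (simp add: E_def w_def)
    have E_neg: "j = n" if "j \<in> E" "l j < 0" for j
    proof -
      have "w \<le> c j / l j" using lb that by (simp add: E_def)
      moreover have "c j / l j \<le> w" using that n(2)[of j] by (auto simp: N_def w_def E_def)
      ultimately have "c j / l j = c n / l n" by (simp add: w_def)
      then show ?thesis by (intro ne) (use that nb in \<open>simp_all add: E_def\<close>)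
    qed
    have "j = p \<or> j = n" if "j \<in> E" for j
    proof -
      have "l j \<noteq> 0" using that by (simp add: E_def)
      then have "0 < l j \<or> l j < 0" by linarith
      then show ?thesis using E_pos[OF that] E_neg[OF that] by blast
    qed
    with pE nE have "E = {p, n}" by blast
    moreover have "w \<noteq> u"
    proof
      assume "w = u"
      then have "n = p" by (intro ne) (use nb pb in \<open>simp_all add: w_def u_def\<close>)
      then show False using nb pb by simp
    qed
    ultimately have "E = {p, n} \<and> p \<noteq> n \<and> 0 < l p \<and> l n < 0 \<and> 0 < c n / l n \<and> c n / l n < c p / l p \<and>
        S = {c n / l n..c p / l p}"
      using Siff pb nb w0 wu by (auto simp: u_def w_def)
    then show ?thesis by blast
  qed
qed

text \<open>The condition on the convex hull is used in this form (see \<open>pointed_hull\<close>):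
  it makes every ray in direction \<open>- a k\<close> leave the cone, it passes to subfamilies, and
  since cones contain 0 it excludes zero vectors.\<close>

definition pointed :: "(nat \<Rightarrow> 'a::real_vector) \<Rightarrow> nat set \<Rightarrow> bool" where
  "pointed a I \<longleftrightarrow> (\<forall>i\<in>I. - a i \<notin> gcone a I)"

text \<open>The class \<open>K\<close> of coefficients is a parameter: constants when indicators are
  rewritten, polynomials for splines. \<open>G\<close> will be the set of generic points.\<close>

definition conic_comb ::
    "('a \<Rightarrow> real) set \<Rightarrow> (nat \<Rightarrow> 'a::real_vector) \<Rightarrow> nat set set \<Rightarrow> 'a set \<Rightarrow> ('a \<Rightarrow> real) \<Rightarrow> bool" where
  "conic_comb K a \<B> G F \<longleftrightarrow>
     (\<exists>q. (\<forall>b\<in>\<B>. q b \<in> K) \<and> (\<forall>x\<in>G. F x = (\<Sum>b\<in>\<B>. if x \<in> gcone a b then q b x else 0)))"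

lemma gcone_mono:
  assumes "I \<subseteq> J" "finite J"
  shows "gcone a I \<subseteq> gcone a J"
proof -
  have "finite I" using assms finite_subset by blast
  then show ?thesis using assms by (simp add: gcone_eq_hull hull_mono image_mono)
qed

lemma pointed_mono: "pointed a J \<Longrightarrow> I \<subseteq> J \<Longrightarrow> finite J \<Longrightarrow> pointed a I"
  using gcone_mono[of I J a] by (auto simp: pointed_def)

lemma zero_in_gcone: "0 \<in> gcone a I"
  unfolding gcone_def by (auto intro!: exI[of _ "\<lambda>_. 0"])

lemma pointed_nonzero: "pointed a I \<Longrightarrow> i \<in> I \<Longrightarrow> a i \<noteq> 0"
  using zero_in_gcone[of a I] by (auto simp: pointed_def)

lemma finite_bases: "finite I \<Longrightarrow> finite (bases a I)"
  by (rule finite_subset[of _ "Pow I"]) (auto simp: bases_def)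

lemma finite_nb_bases: "finite I \<Longrightarrow> finite (nb_bases a I)"
  by (rule finite_subset[of _ "Pow I"]) (auto simp: bases_def nb_bases_def)

lemma nb_bases_subset: "nb_bases a I \<subseteq> bases a I"
  by (auto simp: nb_bases_def)

lemma generic_coord_nonzero:
  assumes "generic a I x" "b \<in> bases a I" "i \<in> b"
  shows "coord a b x i \<noteq> 0"
proof -
  have b: "b \<subseteq> I" "lin_indep a b" "span (a ` b) = span (a ` I)"
    using assms(2) by (auto simp: bases_def)
  have "a i \<notin> span (a ` (b - {i}))" by (rule lin_indep_remove(2)[OF b(2) assms(3)])
  moreover have "a i \<in> span (a ` I)" using assms b by (auto intro: span_base)
  ultimately have "span (a ` (b - {i})) \<noteq> span (a ` I)" by metis
  then show ?thesis
    using coord_eq_0_iff[OF b(2) assms(3), of x] assms(1) b unfolding generic_def by blast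
qed

text \<open>The walls are named through cones with edge \<open>a k\<close>, so that membership of
  \<open>x\<close> alone decides which walls the ray meets. This is what turns crossings into
  indicators.\<close>

lemma gcone_crossing:
  assumes "generic a I x" "b \<in> bases a I" "k \<in> I" "- a k \<notin> gcone a b"
  defines "l \<equiv> coord a b (a k)"
  defines "\<tau> \<equiv> \<lambda>j. coord a b x j / l j"
  defines "S \<equiv> {t. 0 \<le> t \<and> x - t *\<^sub>R a k \<in> gcone a b}"
  defines "E \<equiv> {j\<in>b. l j \<noteq> 0 \<and> x \<in> gcone a (insert k (b - {j}))}"
  shows "(S = {} \<and> E = {}) \<or> (\<exists>j. E = {j} \<and> 0 < l j \<and> 0 < \<tau> j \<and> S = {0..\<tau> j}) \<or>
    (\<exists>j i. E = {j, i} \<and> j \<noteq> i \<and> 0 < l j \<and> l i < 0 \<and> 0 < \<tau> i \<and> \<tau> i < \<tau> j \<and> S = {\<tau> i..\<tau> j})"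
proof -
  have b: "b \<subseteq> I" "lin_indep a b" "span (a ` b) = span (a ` I)"
    using assms(2) by (auto simp: bases_def)
  have fin: "finite b" using b by (simp add: lin_indep_def)
  have xs: "x \<in> span (a ` b)" using assms(1) b by (simp add: generic_def)
  have ks: "a k \<in> span (a ` b)" using b assms(3) by (auto intro: span_base)
  have proper: "x \<notin> span (a ` J)" if "J \<subseteq> I" "span (a ` J) \<noteq> span (a ` I)" for J
    using assms(1) that by (auto simp: generic_def)
  have xt: "x - t *\<^sub>R a k \<in> span (a ` b)" for t
    using xs ks by (intro span_diff span_scale)
  have ct: "coord a b (x - t *\<^sub>R a k) i = coord a b x i - t * l i" if "i \<in> b" for i t
    using coord_add[OF b(2) that xs, of "(-t) *\<^sub>R a k"] coord_scale[OF b(2) that ks, of "-t"] ks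
    by (simp add: l_def span_neg span_scale)
  have S: "S = {t. 0 \<le> t \<and> (\<forall>i\<in>b. 0 \<le> coord a b x i - t * l i)}"
    unfolding S_def in_gcone_iff[OF b(2) xt] using ct by auto
  have lpos: "\<exists>i\<in>b. 0 < l i"
  proof (rule ccontr)
    assume "\<not> (\<exists>i\<in>b. 0 < l i)"
    then have "\<forall>i\<in>b. 0 \<le> coord a b (- a k) i"
      using coord_scale[OF b(2) _ ks, of _ "-1"] by (auto simp: l_def)
    then show False using in_gcone_iff[OF b(2) span_neg[OF ks]] assms(4) by simp
  qed
  note nz = generic_coord_nonzero[OF assms(1,2)]
  have ty: "x - \<tau> j *\<^sub>R a k \<in> span (a ` (b - {j}))" if "j \<in> b" "l j \<noteq> 0" for j
  proof -
    have "coord a b (x - \<tau> j *\<^sub>R a k) j = 0" using that by (simp only: ct) (simp add: \<tau>_def)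
    then show ?thesis using coord_eq_0_iff[OF b(2) that(1) xt] by blast
  qed
  \<comment> \<open>If two walls were reached at the same time, the common point would lie in the
    span of \<open>b - {j, i}\<close>, and \<open>x\<close> in the span of a basis with one vector
    dropped, against genericity.\<close>
  have ne: "i = j" if ij: "i \<in> b" "j \<in> b" "l i \<noteq> 0" "l j \<noteq> 0" "coord a b x i / l i = coord a b x j / l j" for i j
  proof (rule ccontr)
    assume "i \<noteq> j"
    define y where "y = x - \<tau> j *\<^sub>R a k"
    have ex: "k \<notin> b - {j}" "lin_indep a (insert k (b - {j}))" "span (a ` insert k (b - {j})) = span (a ` b)"
      using exchange[OF b(2) ij(2) ks] ij by (auto simp: l_def)
    have ki: "i \<noteq> k" using ex \<open>i \<noteq> j\<close> ij by auto
    have yj: "y \<in> span (a ` (b - {j}))"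
      using ty[OF ij(2,4)] by (simp add: y_def)

    have "y \<in> span (a ` (b - {i}))"
      using ty[OF ij(1,3)] ij(5) by (simp add: y_def \<tau>_def)
    then have "coord a b y i = 0" using coord_eq_0_iff[OF b(2) ij(1) xt] by (simp add: y_def)
    have "y = (\<Sum>l\<in>b. coord a b y l *\<^sub>R a l)" using coord_sum[OF fin xt] by (simp add: y_def)
    also have "\<dots> = (\<Sum>l\<in>b - {j, i}. coord a b y l *\<^sub>R a l)"
      using \<open>coord a b y i = 0\<close> coord_eq_0_iff[OF b(2) ij(2), of y] yj xt fin
      by (intro sum.mono_neutral_right) (auto simp: y_def)
    finally have "y \<in> span (a ` (b - {j, i}))"
      using in_span_image_iff[of "b - {j,i}" y a] fin by blast
    then have "y + \<tau> j *\<^sub>R a k \<in> span (a ` insert k (b - {j, i}))"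
      by (intro span_add span_scale) (auto intro: span_base span_mono[THEN subsetD])
    then have "x \<in> span (a ` insert k (b - {j, i}))" by (simp add: y_def)
    moreover have "insert k (b - {j, i}) = insert k (b - {j}) - {i}" using ki by auto
    moreover have "a i \<notin> span (a ` (insert k (b - {j}) - {i}))"
      using lin_indep_remove(2)[OF ex(2)] ij \<open>i \<noteq> j\<close> by auto
    moreover have "a i \<in> span (a ` I)" using ij b by (auto intro: span_base)
    ultimately show False using proper[of "insert k (b - {j, i})"] b assms(3) by (metis Diff_subset insert_subset order_trans)
  qed
  \<comment> \<open>The point \<open>x\<close> is its foot on the wall plus \<open>\<tau> j\<close>
    times \<open>a k\<close>, and \<open>a k\<close> is off the wall: \<open>x\<close> is in the
    exchanged cone iff the foot is in the facet and the time is nonnegative.\<close>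
  have E: "E = {j \<in> b. l j \<noteq> 0 \<and> \<tau> j \<in> S}"
  proof -
    have "x \<in> gcone a (insert k (b - {j})) \<longleftrightarrow> \<tau> j \<in> S" if j: "j \<in> b" "l j \<noteq> 0" for j
    proof -
      define y where "y = x - \<tau> j *\<^sub>R a k"
      have yj: "y \<in> span (a ` (b - {j}))"
        using ty[OF j] by (simp add: y_def)
      have nk: "a k \<notin> span (a ` (b - {j}))"
        using exchange(2)[OF b(2) j(1) ks] j by (simp add: l_def)
      have "x \<in> gcone a (insert k (b - {j})) \<longleftrightarrow> y \<in> gcone a (b - {j}) \<and> 0 \<le> \<tau> j"
        using gcone_insert_iff[OF _ yj nk, of "\<tau> j"] fin by (simp add: y_def)
      also have "y \<in> gcone a (b - {j}) \<longleftrightarrow> y \<in> gcone a b"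
        using gcone_insert_iff[OF _ yj lin_indep_remove(2)[OF b(2) j(1)], of 0] fin j
        by (simp add: insert_absorb)
      finally show ?thesis by (auto simp: S_def y_def)
    qed
    then show ?thesis by (auto simp: E_def)
  qed
  show ?thesis
    using crossing[of b l "coord a b x", OF fin lpos nz ne] unfolding E S \<tau>_def by blast
qed

text \<open>Walls parallel to \<open>a k\<close> have sign 0, so the sum may run over all of
  \<open>b\<close>.\<close>

lemma gcone_crossing_sum:
  assumes "generic a I x" "b \<in> bases a I" "k \<in> I" "- a k \<notin> gcone a b"
  shows "(\<Sum>j\<in>b. if x \<in> gcone a (insert k (b - {j})) then sgn (coord a b (a k) j) * g j else 0)
    = (\<Sum>j\<in>{j\<in>b. coord a b (a k) j \<noteq> 0 \<and> x \<in> gcone a (insert k (b - {j}))}. sgn (coord a b (a k) j) * g j)"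
proof -
  have "finite b" using assms by (simp add: bases_def lin_indep_def)
  then show ?thesis by (intro sum.mono_neutral_cong_right) auto
qed

text \<open>Exits count 1 and entries -1. A ray starting in the cone has one exit; any other ray has
  as many entries as exits.\<close>

lemma gcone_indicator_crossing:
  assumes "generic a I x" "b \<in> bases a I" "k \<in> I" "- a k \<notin> gcone a b"
  shows "(if x \<in> gcone a b then 1 else 0) =
    (\<Sum>j\<in>b. if x \<in> gcone a (insert k (b - {j})) then sgn (coord a b (a k) j) else 0)"
proof -
  define S where "S = {t. 0 \<le> t \<and> x - t *\<^sub>R a k \<in> gcone a b}"
  have S: "x \<in> gcone a b \<longleftrightarrow> 0 \<in> S" by (simp add: S_def)
  show ?thesis
    using gcone_crossing_sum[OF assms, of "\<lambda>_. 1"] gcone_crossing[OF assms]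
    unfolding S mult_1_right S_def[symmetric]
    by (elim disjE exE conjE) (simp_all add: sgn_if)
qed

section \<open>Reduction of all simplicial cones to no broken ones\<close>

lemma conic_comb_zero: "(\<And>b. b \<in> \<B> \<Longrightarrow> (\<lambda>_. 0) \<in> K) \<Longrightarrow> conic_comb K a \<B> G (\<lambda>x. 0)"
  unfolding conic_comb_def by (intro exI[of _ "\<lambda>_ _. 0"]) (auto intro!: sum.neutral[symmetric])

lemma conic_comb_add:
  assumes "\<And>f g. f \<in> K \<Longrightarrow> g \<in> K \<Longrightarrow> (\<lambda>x. f x + g x) \<in> K"
    and "conic_comb K a \<B> G F1" "conic_comb K a \<B> G F2"
  shows "conic_comb K a \<B> G (\<lambda>x. F1 x + F2 x)"
proof -
  obtain q1 q2 where q: "\<forall>b\<in>\<B>. q1 b \<in> K" "\<forall>x\<in>G. F1 x = (\<Sum>b\<in>\<B>. if x \<in> gcone a b then q1 b x else 0)"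
    "\<forall>b\<in>\<B>. q2 b \<in> K" "\<forall>x\<in>G. F2 x = (\<Sum>b\<in>\<B>. if x \<in> gcone a b then q2 b x else 0)"
    using assms(2,3) unfolding conic_comb_def by blast
  show ?thesis
    unfolding conic_comb_def
    using q assms(1) by (intro exI[of _ "\<lambda>b x. q1 b x + q2 b x"])
      (auto simp: sum.distrib[symmetric] intro!: sum.cong)
qed

lemma conic_comb_sum:
  assumes "\<And>f g. f \<in> K \<Longrightarrow> g \<in> K \<Longrightarrow> (\<lambda>x. f x + g x) \<in> K" "(\<lambda>_. 0) \<in> K"
    and "finite N" "\<And>n. n \<in> N \<Longrightarrow> conic_comb K a \<B> G (F n)"
  shows "conic_comb K a \<B> G (\<lambda>x. \<Sum>n\<in>N. F n x)"
  using assms(3,4)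
proof (induction N)
  case empty
  then show ?case using conic_comb_zero[of \<B> K] assms(2) by simp
next
  case (insert n N)
  have "conic_comb K a \<B> G (\<lambda>x. F n x + (\<Sum>n\<in>N. F n x))"
    by (rule conic_comb_add[OF assms(1)]) (use insert in auto)
  then show ?case using insert.hyps by simp
qed

lemma conic_comb_single:
  assumes "(\<lambda>_. 0) \<in> K" "finite \<B>" "b \<in> \<B>" "p \<in> K"
  shows "conic_comb K a \<B> G (\<lambda>x. if x \<in> gcone a b then p x else 0)"
  unfolding conic_comb_def
proof (intro exI[of _ "\<lambda>b'. if b' = b then p else (\<lambda>_. 0)"] conjI ballI)
  fix x assume "x \<in> G"
  have "(\<Sum>b'\<in>\<B>. if x \<in> gcone a b' then (if b' = b then p else (\<lambda>_. 0)) x else 0) =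
      (\<Sum>b'\<in>\<B>. if b' = b then if x \<in> gcone a b then p x else 0 else 0)"
    by (intro sum.cong) auto
  then show "(if x \<in> gcone a b then p x else 0) = (\<Sum>b'\<in>\<B>. if x \<in> gcone a b' then (if b' = b then p else (\<lambda>_. 0)) x else 0)"
    using assms by simp
qed (use assms in auto)

lemma conic_comb_mult:
  assumes "\<And>f. f \<in> K \<Longrightarrow> (\<lambda>x. f x * p x) \<in> K'" "conic_comb K a \<B> G F"
  shows "conic_comb K' a \<B> G (\<lambda>x. F x * p x)"
proof -
  obtain q where q: "\<forall>b\<in>\<B>. q b \<in> K" "\<forall>x\<in>G. F x = (\<Sum>b\<in>\<B>. if x \<in> gcone a b then q b x else 0)"
    using assms(2) unfolding conic_comb_def by blast
  show ?thesis
    unfolding conic_comb_def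
    using q assms(1) by (intro exI[of _ "\<lambda>b x. q b x * p x"])
      (auto simp: sum_distrib_right intro!: sum.cong)
qed

lemma conic_comb_cong:
  assumes "conic_comb K a \<B> G F" "\<And>x. x \<in> G \<Longrightarrow> F' x = F x"
  shows "conic_comb K a \<B> G F'"
  using assms unfolding conic_comb_def by force

text \<open>Modular law: an element of \<open>H\<close> is a vector of \<open>span S\<close> plus a
  multiple of \<open>v\<close>; that multiple is again in \<open>H\<close>, hence 0.\<close>

lemma subspace_insert_eq:
  assumes "subspace H" "S \<subseteq> H" "v \<notin> H" "H \<subseteq> span (insert v S)"
  shows "H = span S"
proof
  show "span S \<subseteq> H" using assms by (simp add: span_minimal)
  show "H \<subseteq> span S"
  proof
    fix y assume y: "y \<in> H"
    then obtain r where r: "y - r *\<^sub>R v \<in> span S" using assms(4) span_insert[of v S] by auto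
    then have "y - (y - r *\<^sub>R v) \<in> H" using y \<open>span S \<subseteq> H\<close> subspace_diff[OF assms(1)] by blast
    then have "r *\<^sub>R v \<in> H" by simp
    have "r = 0"
    proof (rule ccontr)
      assume "r \<noteq> 0"
      then have "v = inverse r *\<^sub>R (r *\<^sub>R v)" by simp
      then show False using assms(3) subspace_scale[OF assms(1) \<open>r *\<^sub>R v \<in> H\<close>, of "inverse r"] by simp
    qed
    then show "y \<in> span S" using r by simp
  qed
qed

text \<open>Genericity survives the projection to \<open>H\<close> along \<open>a m\<close>: a
  proper span in \<open>H\<close> containing \<open>h\<close> becomes, after adding
  \<open>a m\<close>, a proper span containing \<open>x\<close>.\<close>

lemma generic_decomp:
  assumes "generic a I x" "m \<in> I" "H = span (a ` {i \<in> I. a i \<in> H})" "a m \<notin> H"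
    "span (insert (a m) H) = span (a ` I)"
  obtains h t where "x = h + t *\<^sub>R a m" "generic a {i \<in> I. a i \<in> H} h"
proof -
  have Hsub: "subspace H" using assms(3) subspace_span by metis
  have "x \<in> span (insert (a m) H)" using assms by (simp add: generic_def)
  then obtain t where t: "x - t *\<^sub>R a m \<in> H"
    using span_insert[of "a m" H] span_eq_iff[THEN iffD2, OF Hsub] by auto
  define h where "h = x - t *\<^sub>R a m"
  have "generic a {i \<in> I. a i \<in> H} h"
    unfolding generic_def
  proof (intro conjI allI impI notI)
    show "h \<in> span (a ` {i \<in> I. a i \<in> H})" using t assms(3) by (simp add: h_def)
    fix J assume J: "J \<subseteq> {i \<in> I. a i \<in> H}" "span (a ` J) \<noteq> span (a ` {i \<in> I. a i \<in> H})" "h \<in> span (a ` J)"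
    have "h + t *\<^sub>R a m \<in> span (a ` insert m J)"
      using J(3) by (intro span_add span_scale) (auto intro: span_base span_mono[THEN subsetD])
    then have "x \<in> span (a ` insert m J)" by (simp add: h_def)
    moreover have "span (a ` insert m J) \<noteq> span (a ` I)"
    proof
      assume "span (a ` insert m J) = span (a ` I)"
      then have "H \<subseteq> span (insert (a m) (a ` J))"
        using assms(5) span_superset[of "insert (a m) H"] by auto
      moreover have "a ` J \<subseteq> H" using J by auto
      ultimately have "H = span (a ` J)" using subspace_insert_eq[OF Hsub _ assms(4)] by blast
      then show False using J(2) assms(3) by metis
    qed
    ultimately show False using assms(1,2) J(1) unfolding generic_def
      by (metis (no_types, lifting) insert_subset mem_Collect_eq subset_iff)
  qed
  moreover have "x = h + t *\<^sub>R a m" by (simp add: h_def)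
  ultimately show ?thesis using that by blast
qed

text \<open>With \<open>m\<close> the least index, all cones in the crossing identity have the edge
  \<open>a m\<close>: each is a cone in a hyperplane \<open>H\<close> times a half-line. The
  inductive identity in \<open>H\<close> lifts through this product, and adding \<open>m\<close>
  keeps bases no broken. The induction is on the number of vectors, which drops because
  \<open>a m\<close> is not in \<open>H\<close>.\<close>

lemma cone_conic_comb_nb:
  assumes "finite I" "pointed a I" "b \<in> bases a I"
  shows "conic_comb (range (\<lambda>c _. c)) a (nb_bases a I) {x. generic a I x}
    (\<lambda>x. if x \<in> gcone a b then 1 else 0)"
  using assms
proof (induction "card I" arbitrary: I b rule: less_induct)
  case less
  let ?K = "range (\<lambda>(c::real) (_::'a). c)"
  have K0: "(\<lambda>_. 0) \<in> ?K" by blast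
  have Kadd: "(\<lambda>x. f x + g x) \<in> ?K" if "f \<in> ?K" "g \<in> ?K" for f g using that by auto
  show ?case
  proof (cases "I = {}")
    case True
    then have "b = {}" using less.prems by (auto simp: bases_def)
    then show ?thesis
      using conic_comb_single[where K = ?K and \<B> = "nb_bases a I" and b = "{}" and p = "\<lambda>_. 1" and a = a] True
      by (auto simp: nb_bases_empty)
  next
    case False
    define m where "m = Min I"
    have m: "m \<in> I" "\<And>i. i \<in> I \<Longrightarrow> m \<le> i" using False less.prems by (auto simp: m_def)
    have b: "b \<subseteq> I" "lin_indep a b" "span (a ` b) = span (a ` I)"
      using less.prems by (auto simp: bases_def)
    have fb: "finite b" using b by (simp add: lin_indep_def)
    have npos: "- a m \<notin> gcone a b"
      using less.prems m gcone_mono[OF b(1), of a] by (auto simp: pointed_def)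
    have ms: "a m \<in> span (a ` b)" using b m by (auto intro: span_base)
    let ?l = "coord a b (a m)"
    have "conic_comb ?K a (nb_bases a I) {x. generic a I x}
        (\<lambda>x. if x \<in> gcone a (insert m (b - {j})) then sgn (?l j) else 0)" if j: "j \<in> b" for j
    proof (cases "?l j = 0")
      case True
      then show ?thesis by (intro conic_comb_cong[OF conic_comb_zero]) (auto simp: K0)
    next
      case l: False
      define H where "H = span (a ` (b - {j}))"
      define IH where "IH = {i \<in> I. a i \<in> H}"
      have mH: "a m \<notin> H" using exchange(2)[OF b(2) j ms l] by (simp add: H_def)
      have bI: "b - {j} \<subseteq> IH" using b by (auto simp: IH_def H_def intro: span_base)
      have HI: "H = span (a ` IH)"
      proof
        show "H \<subseteq> span (a ` IH)" unfolding H_def by (intro span_mono image_mono bI)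
        show "span (a ` IH) \<subseteq> H" unfolding H_def by (rule span_minimal) (auto simp: IH_def H_def)
      qed
      have sp: "span (insert (a m) H) = span (a ` I)"
      proof -
        have "span (insert (a m) H) = span (a ` insert m (b - {j}))"
          unfolding image_insert span_insert H_def span_span by simp
        then show ?thesis using exchange(4)[OF b(2) j ms l] b by simp
      qed
      have fIH: "finite IH" using less.prems by (simp add: IH_def)
      have "IH \<subset> I" using m mH by (auto simp: IH_def)
      then have "card IH < card I" using less.prems by (simp add: psubset_card_mono)
      moreover have "pointed a IH" using less.prems \<open>IH \<subset> I\<close> by (auto intro: pointed_mono)
      moreover have "b - {j} \<in> bases a IH"
        using bI lin_indep_remove(1)[OF b(2) j] HI by (simp add: bases_def H_def)
      ultimately have "conic_comb ?K a (nb_bases a IH) {x. generic a IH x}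
          (\<lambda>x. if x \<in> gcone a (b - {j}) then 1 else 0)"
        using less.hyps fIH by blast
      then obtain q where q: "\<forall>b\<in>nb_bases a IH. q b \<in> ?K"
        "\<And>x. generic a IH x \<Longrightarrow> (if x \<in> gcone a (b - {j}) then 1 else 0) =
            (\<Sum>b\<in>nb_bases a IH. if x \<in> gcone a b then q b x else 0)"
        unfolding conic_comb_def by blast
      have "\<forall>b\<in>nb_bases a IH. \<exists>c. q b = (\<lambda>_. c)" using q(1) by blast
      then obtain c where c: "\<And>b. b \<in> nb_bases a IH \<Longrightarrow> q b = (\<lambda>_. c b)" by metis
      have "conic_comb ?K a (nb_bases a I) {x. generic a I x}
          (\<lambda>x. \<Sum>b'\<in>nb_bases a IH. if x \<in> gcone a (insert m b') then (\<lambda>_. sgn (?l j) * c b') x else 0)"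
      proof (rule conic_comb_sum[OF Kadd K0 finite_nb_bases[OF fIH]])
        fix b' assume "b' \<in> nb_bases a IH"
        then have "insert m b' \<in> nb_bases a I"
          unfolding IH_def by (rule nb_bases_insert[OF _ HI[unfolded IH_def] m mH sp])
        then show "conic_comb ?K a (nb_bases a I) {x. generic a I x}
            (\<lambda>x. if x \<in> gcone a (insert m b') then (\<lambda>_. sgn (?l j) * c b') x else 0)"
          using less.prems(1) by (intro conic_comb_single K0 finite_nb_bases) auto
      qed
      then show ?thesis
      proof (rule conic_comb_cong)
        fix x assume "x \<in> {x. generic a I x}"
        then obtain h t where ht: "x = h + t *\<^sub>R a m" "generic a IH h"
          using generic_decomp[OF _ m(1) HI[unfolded IH_def] mH sp] unfolding IH_def by blast
        have hH: "h \<in> H" using ht HI by (simp add: generic_def)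
        have 1: "x \<in> gcone a (insert m (b - {j})) \<longleftrightarrow> h \<in> gcone a (b - {j}) \<and> 0 \<le> t"
          unfolding ht(1) using gcone_insert_iff[of "b - {j}" h a m t] fb hH mH by (simp add: H_def)
        have 2: "x \<in> gcone a (insert m b') \<longleftrightarrow> h \<in> gcone a b' \<and> 0 \<le> t" if "b' \<in> nb_bases a IH" for b'
        proof -
          have "finite b'" "span (a ` b') = H"
            using that HI by (auto simp: nb_bases_def bases_def lin_indep_def)
          then show ?thesis unfolding ht(1) using gcone_insert_iff[of b' h a m t] hH mH by simp
        qed
        have "(if x \<in> gcone a (insert m (b - {j})) then sgn (?l j) else 0)
            = sgn (?l j) * (if 0 \<le> t then (if h \<in> gcone a (b - {j}) then 1 else 0) else 0)"
          using 1 by simp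
        also have "\<dots> = (\<Sum>b'\<in>nb_bases a IH. if x \<in> gcone a (insert m b') then (\<lambda>_. sgn (?l j) * c b') x else 0)"
          unfolding q(2)[OF ht(2)] using 2 c
          by (auto simp: sum_distrib_left intro!: sum.cong)
        finally show "(if x \<in> gcone a (insert m (b - {j})) then sgn (?l j) else 0) =
          (\<Sum>b'\<in>nb_bases a IH. if x \<in> gcone a (insert m b') then (\<lambda>_. sgn (?l j) * c b') x else 0)" .
      qed
    qed
    then have "conic_comb ?K a (nb_bases a I) {x. generic a I x}
        (\<lambda>x. \<Sum>j\<in>b. if x \<in> gcone a (insert m (b - {j})) then sgn (?l j) else 0)"
      by (intro conic_comb_sum[OF Kadd K0 fb])
    then show ?thesis
      by (rule conic_comb_cong)
        (use gcone_indicator_crossing[OF _ less.prems(3) m(1) npos] in auto)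
  qed
qed

section \<open>Linear independence of the indicators of no broken cones\<close>

lemma eventually_not_in_subspace:
  fixes w :: "'a::real_vector"
  assumes "subspace K" "w \<notin> K \<or> x \<notin> K"
  shows "\<forall>\<^sub>F t in at_right 0. x + t *\<^sub>R w \<notin> K"
proof (cases "w \<in> K")
  case True
  then have "x + t *\<^sub>R w \<notin> K" for t
    using assms subspace_diff[OF assms(1), of "x + t *\<^sub>R w" "t *\<^sub>R w"] subspace_scale[OF assms(1) True, of t] by auto
  then show ?thesis by simp
next
  case w: False
  show ?thesis
  proof (cases "\<exists>s. x + s *\<^sub>R w \<in> K")
    case True
    then obtain s where s: "x + s *\<^sub>R w \<in> K" by blast
    have "x + t *\<^sub>R w \<notin> K" if "t \<noteq> s" for t
    proof
      assume "x + t *\<^sub>R w \<in> K"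
      then have "(x + t *\<^sub>R w) - (x + s *\<^sub>R w) \<in> K" by (intro subspace_diff assms s)
      then have "(t - s) *\<^sub>R w \<in> K" by (simp add: algebra_simps)
      then have "inverse (t - s) *\<^sub>R ((t - s) *\<^sub>R w) \<in> K" by (rule subspace_scale[OF assms(1)])
      moreover have "inverse (t - s) *\<^sub>R ((t - s) *\<^sub>R w) = w" using that by simp
      ultimately show False using w by simp
    qed
    then show ?thesis
      using eventually_neq_at_within[of s "0::real" "{0<..}"] by (auto elim: eventually_mono)
  qed auto
qed

text \<open>A real subspace is no finite union of proper subspaces: adding a small positive multiple
  of a vector outside the new one moves the point off it and keeps it off the others.\<close>

lemma subspace_avoid:
  fixes H :: "'a::real_vector set"
  assumes "finite \<K>" "\<And>K. K \<in> \<K> \<Longrightarrow> subspace K" "subspace H" "\<And>K. K \<in> \<K> \<Longrightarrow> \<not> H \<subseteq> K"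
  shows "\<exists>w\<in>H. \<forall>K\<in>\<K>. w \<notin> K"
  using assms(1,2,4)
proof (induction \<K>)
  case empty
  then show ?case using subspace_0[OF assms(3)] by auto
next
  case (insert K \<K>)
  then obtain w u where w: "w \<in> H" "\<forall>K\<in>\<K>. w \<notin> K" and u: "u \<in> H" "u \<notin> K" by (metis insertCI subsetI)
  have "\<forall>\<^sub>F t in at_right (0::real). \<forall>K'\<in>insert K \<K>. w + t *\<^sub>R u \<notin> K'"
    using insert.hyps insert.prems w u
    by (intro eventually_ball_finite ballI eventually_not_in_subspace) auto
  then obtain t where "\<forall>K'\<in>insert K \<K>. w + t *\<^sub>R u \<notin> K'"
    using eventually_happens'[OF trivial_limit_at_right_real] by blast
  moreover have "w + t *\<^sub>R u \<in> H" using w u assms(3) by (simp add: subspace_add subspace_scale)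
  ultimately show ?case by blast
qed

lemma eventually_sign_stable:
  fixes c w :: real
  assumes "c \<noteq> 0"
  shows "\<forall>\<^sub>F t in at_right 0. 0 \<le> c + t * w \<longleftrightarrow> 0 \<le> c"
proof -
  have lim: "((\<lambda>t. c + t * w) \<longlongrightarrow> c) (at_right 0)"
    by (auto intro!: tendsto_eq_intros)
  show ?thesis
  proof (cases "0 < c")
    case True
    then have "\<forall>\<^sub>F t in at_right 0. 0 < c + t * w" using order_tendstoD(1)[OF lim] by blast
    then show ?thesis by (rule eventually_mono) (use True in auto)
  next
    case False
    then have "\<forall>\<^sub>F t in at_right 0. c + t * w < 0" using order_tendstoD(2)[OF lim] assms by simp
    then show ?thesis by (rule eventually_mono) (use False assms in auto)
  qed
qed

lemma eventually_gcone_stable: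
  assumes "lin_indep a b" "x \<in> span (a ` b)" "w \<in> span (a ` b)"
    "\<And>i. i \<in> b \<Longrightarrow> coord a b x i \<noteq> 0"
  shows "\<forall>\<^sub>F t in at_right 0. x + t *\<^sub>R w \<in> gcone a b \<longleftrightarrow> x \<in> gcone a b"
proof -
  have "finite b" using assms by (simp add: lin_indep_def)
  then have "\<forall>\<^sub>F t in at_right 0. \<forall>i\<in>b. 0 \<le> coord a b x i + t * coord a b w i \<longleftrightarrow> 0 \<le> coord a b x i"
    using assms(4) by (intro eventually_ball_finite ballI eventually_sign_stable) auto
  then show ?thesis
  proof (rule eventually_mono)
    fix t assume t: "\<forall>i\<in>b. 0 \<le> coord a b x i + t * coord a b w i \<longleftrightarrow> 0 \<le> coord a b x i"
    have "coord a b (x + t *\<^sub>R w) i = coord a b x i + t * coord a b w i" if "i \<in> b" for i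
      using coord_add[OF assms(1) that assms(2)] coord_scale[OF assms(1) that assms(3)] assms(3)
      by (simp add: span_scale)
    moreover have "x + t *\<^sub>R w \<in> span (a ` b)" using assms by (simp add: span_add span_scale)
    ultimately show "x + t *\<^sub>R w \<in> gcone a b \<longleftrightarrow> x \<in> gcone a b"
      using t in_gcone_iff[OF assms(1)] assms(2) by auto
  qed
qed

text \<open>
  The coefficients are read off from jumps: across the hyperplane \<open>H\<close> spanned by a basis without its
  first element, only the cones having a facet in \<open>H\<close> jump, and the jump is a combination of
  the no broken cones of \<open>H\<close>.
\<close>

lemma nb_cones_independent:
  fixes v :: "nat set \<Rightarrow> real"
  assumes "finite I" "\<And>i. i \<in> I \<Longrightarrow> a i \<noteq> 0"
    and "\<And>x. generic a I x \<Longrightarrow> (\<Sum>b\<in>nb_bases a I. if x \<in> gcone a b then v b else 0) = 0"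
    and "b0 \<in> nb_bases a I"
  shows "v b0 = 0"
  using assms
proof (induction "card I" arbitrary: I v b0 rule: less_induct)
  case less
  show ?case
  proof (cases "I = {}")
    case True
    then show ?thesis
      using less.prems(3)[of 0] less.prems(4) by (simp add: nb_bases_empty generic_def zero_in_gcone)
  next
    case False
    define m where "m = Min I"
    have m: "m \<in> I" "\<And>i. i \<in> I \<Longrightarrow> m \<le> i" using False less.prems(1) by (auto simp: m_def)
    have am: "a m \<noteq> 0" using m less.prems(2) by blast
    define H where "H = span (a ` (b0 - {m}))"
    define IH where "IH = {i \<in> I. a i \<in> H}"
    note b0 = nb_bases_remove[OF less.prems(1,4) m am H_def]
    have mb: "m \<in> b0" by (rule b0(1))
    have b0H: "b0 - {m} \<in> nb_bases a IH" unfolding IH_def by (rule b0(2))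
    have HI: "H = span (a ` IH)" unfolding IH_def by (rule b0(3))
    have mH: "a m \<notin> H" by (rule b0(4))
    have sp: "span (insert (a m) H) = span (a ` I)" by (rule b0(5))
    have Hsub: "subspace H" by (simp add: H_def)
    have fIH: "finite IH" using less.prems(1) by (simp add: IH_def)
    have "IH \<subset> I" using m mH by (auto simp: IH_def)
    then have card: "card IH < card I" using less.prems(1) by (simp add: psubset_card_mono)
    have HsI: "H \<subseteq> span (a ` I)" using sp span_superset[of "insert (a m) H"] by auto
    have msI: "a m \<in> span (a ` I)" using m by (auto intro: span_base)
    \<comment> \<open>Coefficients of the cones over \<open>H\<close>, indexed by bases of
      \<open>H\<close>. Once the hypothesis is shown for them, induction gives
      \<open>v' (b0 - {m}) = 0\<close>.\<close>
    define v' where "v' b = v (insert m b)" for b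
    have "(\<Sum>b\<in>nb_bases a IH. if h \<in> gcone a b then v' b else 0) = 0" if gh: "generic a IH h" for h
    proof -
      have hH: "h \<in> H" using gh HI by (simp add: generic_def)
      \<comment> \<open>A generic point of \<open>H\<close> may still lie in a span that uses
        vectors off \<open>H\<close>. The spans not containing \<open>H\<close> cut it in proper
        subspaces; \<open>w\<close> avoids them, and \<open>g = h + t0 w\<close> leaves them all
        without changing membership in the cones of \<open>H\<close>.\<close>
      define \<K> where "\<K> = {span (a ` J) | J. J \<subseteq> I \<and> \<not> H \<subseteq> span (a ` J)}"
      have "\<K> \<subseteq> (\<lambda>J. span (a ` J)) ` Pow I" by (auto simp: \<K>_def)
      then have fK: "finite \<K>" using less.prems(1) finite_subset by blast
      have sK: "subspace K" if "K \<in> \<K>" for K using that by (auto simp: \<K>_def)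
      obtain w where w: "w \<in> H" "\<forall>K\<in>\<K>. w \<notin> K"
      proof -
        have "\<not> H \<subseteq> K" if "K \<in> \<K>" for K using that by (auto simp: \<K>_def)
        then show ?thesis using subspace_avoid[OF fK sK Hsub] that by blast
      qed
      have "\<forall>\<^sub>F t in at_right 0. \<forall>K\<in>\<K>. h + t *\<^sub>R w \<notin> K"
        using w sK by (intro eventually_ball_finite fK ballI eventually_not_in_subspace) auto
      moreover have "\<forall>\<^sub>F t in at_right 0. \<forall>b\<in>nb_bases a IH. h + t *\<^sub>R w \<in> gcone a b \<longleftrightarrow> h \<in> gcone a b"
      proof (intro eventually_ball_finite ballI finite_nb_bases[OF fIH] eventually_gcone_stable)
        fix b assume b: "b \<in> nb_bases a IH"
        then show "lin_indep a b" "h \<in> span (a ` b)" "w \<in> span (a ` b)"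
          using hH w HI by (auto simp: nb_bases_def bases_def)
        fix i assume "i \<in> b"
        then show "coord a b h i \<noteq> 0"
          using generic_coord_nonzero[OF gh, of b i] b nb_bases_subset[of a IH] by blast
      qed
      ultimately have "\<forall>\<^sub>F t in at_right 0. (\<forall>K\<in>\<K>. h + t *\<^sub>R w \<notin> K) \<and>
          (\<forall>b\<in>nb_bases a IH. h + t *\<^sub>R w \<in> gcone a b \<longleftrightarrow> h \<in> gcone a b)"
        by (rule eventually_conj)
      then obtain t0 where t0: "\<forall>K\<in>\<K>. h + t0 *\<^sub>R w \<notin> K"
          "\<forall>b\<in>nb_bases a IH. h + t0 *\<^sub>R w \<in> gcone a b \<longleftrightarrow> h \<in> gcone a b"
        using eventually_happens'[OF trivial_limit_at_right_real] by blast
      define g where "g = h + t0 *\<^sub>R w"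
      have gH: "g \<in> H" using hH w Hsub by (simp add: g_def subspace_add subspace_scale)
      have gs: "g \<in> span (a ` I)" using gH HsI by blast
      have gK: "g \<notin> span (a ` J)" if "J \<subseteq> I" "\<not> H \<subseteq> span (a ` J)" for J
        using t0(1) that by (auto simp: \<K>_def g_def)
      \<comment> \<open>From \<open>g\<close>, both directions along \<open>a m\<close> lead at once
        to generic points, where the hypothesis applies.\<close>
      have near_generic: "\<forall>\<^sub>F e in at_right 0. generic a I (g + e *\<^sub>R (s *\<^sub>R a m))" if s: "s \<noteq> 0" for s :: real
      proof -
        define \<J> where "\<J> = {J \<in> Pow I. span (a ` J) \<noteq> span (a ` I)}"
        have "\<forall>\<^sub>F e in at_right 0. \<forall>J\<in>\<J>. g + e *\<^sub>R (s *\<^sub>R a m) \<notin> span (a ` J)"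
        proof (intro eventually_ball_finite ballI eventually_not_in_subspace)
          show "finite \<J>" using less.prems(1) by (simp add: \<J>_def)
          fix J assume J: "J \<in> \<J>"
          show "s *\<^sub>R a m \<notin> span (a ` J) \<or> g \<notin> span (a ` J)"
          proof (cases "H \<subseteq> span (a ` J)")
            case True
            have "a m \<notin> span (a ` J)"
            proof
              assume "a m \<in> span (a ` J)"
              then have "span (insert (a m) H) \<subseteq> span (a ` J)" using True by (intro span_minimal) auto
              moreover have "span (a ` J) \<subseteq> span (a ` I)" using J by (intro span_mono) (auto simp: \<J>_def)
              ultimately show False using J sp by (auto simp: \<J>_def)
            qed
            moreover have "a m = inverse s *\<^sub>R (s *\<^sub>R a m)" using s by simp
            ultimately show ?thesis by (metis span_scale)
          qed (use gK J in \<open>auto simp: \<J>_def\<close>)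
        qed simp
        then show ?thesis
        proof (rule eventually_mono)
          fix e assume "\<forall>J\<in>\<J>. g + e *\<^sub>R (s *\<^sub>R a m) \<notin> span (a ` J)"
          moreover have "g + e *\<^sub>R (s *\<^sub>R a m) \<in> span (a ` I)" using gs msI by (intro span_add span_scale)
          ultimately show "generic a I (g + e *\<^sub>R (s *\<^sub>R a m))" by (auto simp: generic_def \<J>_def)
        qed
      qed
      \<comment> \<open>The bases with a facet in \<open>H\<close>; all other cones have no wall
        through \<open>g\<close>.\<close>
      define N where "N = {b \<in> nb_bases a I. span (a ` (b - {m})) = H}"
      have stable: "\<forall>\<^sub>F e in at_right 0. \<forall>b\<in>nb_bases a I - N.
          g + e *\<^sub>R (s *\<^sub>R a m) \<in> gcone a b \<longleftrightarrow> g \<in> gcone a b" for s :: real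
      proof (intro eventually_ball_finite ballI eventually_gcone_stable)
        show "finite (nb_bases a I - N)" using finite_nb_bases[OF less.prems(1), of a] by simp
        fix b assume b: "b \<in> nb_bases a I - N"
        then have bb: "b \<subseteq> I" "lin_indep a b" "span (a ` b) = span (a ` I)"
          by (auto simp: nb_bases_def bases_def)
        then show "lin_indep a b" "g \<in> span (a ` b)" "s *\<^sub>R a m \<in> span (a ` b)"
          using gs msI by (auto intro: span_scale)
        note bm = nb_bases_remove[where b = b and m = m and a = a and H = "span (a ` (b - {m}))", OF less.prems(1) _ m am refl]
        have mb: "m \<in> b" using bm b by blast
        fix i assume i: "i \<in> b"
        \<comment> \<open>A wall containing \<open>H\<close> is either opposite to \<open>m\<close>,
          and then equals \<open>H\<close>, which puts \<open>b\<close> in \<open>N\<close>; or it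
          contains \<open>a m\<close> too, and then is the whole span.\<close>
        have "\<not> H \<subseteq> span (a ` (b - {i}))"
        proof
          assume Hs: "H \<subseteq> span (a ` (b - {i}))"
          show False
          proof (cases "i = m")
            case True
            have nm: "a m \<notin> span (a ` (b - {m}))" by (rule lin_indep_remove(2)[OF bb(2) mb])
            have "a ` IH \<subseteq> H" by (auto simp: IH_def)
            then have "a ` IH \<subseteq> span (a ` (b - {m}))" using Hs True by (meson order_trans)
            moreover have "span (a ` (b - {m})) \<subseteq> span (insert (a m) (a ` IH))"
            proof -
              have "span (insert (a m) (a ` IH)) = span (insert (a m) H)"
                unfolding span_insert HI span_span by simp
              also have "\<dots> = span (a ` b)" using sp bb by simp
              finally show ?thesis by (simp add: span_mono image_mono)
            qed
            ultimately have "span (a ` (b - {m})) = span (a ` IH)"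
              by (intro subspace_insert_eq[OF subspace_span _ nm])
            then show False using b HI by (simp add: N_def)
          next
            case False
            then have "a m \<in> span (a ` (b - {i}))" using mb by (auto intro: span_base)
            then have "span (insert (a m) H) \<subseteq> span (a ` (b - {i}))"
              using Hs by (intro span_minimal) auto
            moreover have "a i \<in> span (a ` I)" using i bb by (auto intro: span_base)
            ultimately show False using sp lin_indep_remove(2)[OF bb(2) i] by auto
          qed
        qed
        then have "g \<notin> span (a ` (b - {i}))" using gK bb by blast
        then show "coord a b g i \<noteq> 0" using coord_eq_0_iff[OF bb(2) i] bb gs by simp
      qed
      have onN: "g + r *\<^sub>R a m \<in> gcone a b \<longleftrightarrow> g \<in> gcone a (b - {m}) \<and> 0 \<le> r" if "b \<in> N" for b r
      proof -
        have "m \<in> b" using nb_bases_remove(1)[where b = b and m = m and a = a and H = "span (a ` (b - {m}))", OF less.prems(1) _ m am refl] that by (simp add: N_def)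
        moreover have "finite b" using that by (auto simp: N_def nb_bases_def bases_def lin_indep_def)
        moreover have "span (a ` (b - {m})) = H" using that by (simp add: N_def)
        ultimately show ?thesis
          using gcone_insert_iff[of "b - {m}" g a m r] gH mH by (simp add: insert_absorb)
      qed
      have "\<forall>\<^sub>F e in at_right (0::real). 0 < e" by (simp add: eventually_at_right_less)
      then have "\<forall>\<^sub>F e in at_right 0. 0 < e \<and> generic a I (g + e *\<^sub>R (1 *\<^sub>R a m)) \<and>
          generic a I (g + e *\<^sub>R ((-1) *\<^sub>R a m)) \<and>
          (\<forall>b\<in>nb_bases a I - N. g + e *\<^sub>R (1 *\<^sub>R a m) \<in> gcone a b \<longleftrightarrow> g \<in> gcone a b) \<and>
          (\<forall>b\<in>nb_bases a I - N. g + e *\<^sub>R ((-1) *\<^sub>R a m) \<in> gcone a b \<longleftrightarrow> g \<in> gcone a b)"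
        by (intro eventually_conj near_generic stable) auto
      then obtain e where e: "0 < e" "generic a I (g + e *\<^sub>R a m)" "generic a I (g + (-e) *\<^sub>R a m)"
          "\<forall>b\<in>nb_bases a I - N. g + e *\<^sub>R a m \<in> gcone a b \<longleftrightarrow> g \<in> gcone a b"
          "\<forall>b\<in>nb_bases a I - N. g + (-e) *\<^sub>R a m \<in> gcone a b \<longleftrightarrow> g \<in> gcone a b"
        using eventually_happens'[OF trivial_limit_at_right_real] by force
      have split: "(\<Sum>b\<in>nb_bases a I. f b) = (\<Sum>b\<in>N. f b) + (\<Sum>b\<in>nb_bases a I - N. f b)" for f :: "nat set \<Rightarrow> real"
        by (subst sum.subset_diff[of N]) (auto simp: N_def finite_nb_bases[OF less.prems(1)])
      have out: "(\<Sum>b\<in>nb_bases a I - N. if g + r *\<^sub>R a m \<in> gcone a b then v b else 0)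
          = (\<Sum>b\<in>nb_bases a I - N. if g \<in> gcone a b then v b else 0)" if "r = e \<or> r = -e" for r
        using e(4,5) that by (intro sum.cong) auto
      \<comment> \<open>The cones outside \<open>N\<close> contribute the same on both sides of
        \<open>H\<close>; those in \<open>N\<close> contain no point on the negative side.\<close>
      have "(\<Sum>b\<in>N. if g + e *\<^sub>R a m \<in> gcone a b then v b else 0)
          = (\<Sum>b\<in>N. if g + (-e) *\<^sub>R a m \<in> gcone a b then v b else 0)"
        using less.prems(3)[OF e(2)] less.prems(3)[OF e(3)] out[of e] out[of "-e"] unfolding split by simp
      also have "\<dots> = 0"
      proof (intro sum.neutral ballI)
        fix b assume "b \<in> N"
        then have "g + (-e) *\<^sub>R a m \<notin> gcone a b" using onN[of b "-e"] e(1) by simp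
        then show "(if g + (-e) *\<^sub>R a m \<in> gcone a b then v b else 0) = 0" by (simp only: if_False)
      qed
      finally have "(\<Sum>b\<in>N. if g \<in> gcone a (b - {m}) then v b else 0) = 0"
        using onN e(1) by simp
      moreover have "(\<Sum>b\<in>nb_bases a IH. if g \<in> gcone a b then v' b else 0)
          = (\<Sum>b\<in>N. if g \<in> gcone a (b - {m}) then v b else 0)"
      proof (rule sum.reindex_bij_witness[of _ "\<lambda>b. b - {m}" "insert m"])
        fix b assume b: "b \<in> nb_bases a IH"
        then have "m \<notin> b" using mH by (auto simp: nb_bases_def bases_def IH_def)
        then show "insert m b - {m} = b" by simp
        have "span (a ` b) = H" using b HI by (simp add: nb_bases_def bases_def)
        moreover have "insert m b \<in> nb_bases a I"
          using b unfolding IH_def by (rule nb_bases_insert[OF _ HI[unfolded IH_def] m mH sp])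
        ultimately show "insert m b \<in> N" using \<open>m \<notin> b\<close> by (simp add: N_def)
        show "(if g \<in> gcone a (insert m b - {m}) then v (insert m b) else 0) =
            (if g \<in> gcone a b then v' b else 0)"
          using \<open>m \<notin> b\<close> by (simp add: v'_def)
      next
        fix b assume b: "b \<in> N"
        note bm = nb_bases_remove[where b = b and m = m and a = a and H = "span (a ` (b - {m}))", OF less.prems(1) _ m am refl]
        show "insert m (b - {m}) = b" using bm(1) b by (auto simp: N_def)
        show "b - {m} \<in> nb_bases a IH" using bm(2) b by (simp add: N_def IH_def)
      qed
      moreover have "(\<Sum>b\<in>nb_bases a IH. if g \<in> gcone a b then v' b else 0)
          = (\<Sum>b\<in>nb_bases a IH. if h \<in> gcone a b then v' b else 0)"
        using t0(2) by (intro sum.cong) (auto simp: g_def)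
      ultimately show ?thesis by simp
    qed
    then have "v' (b0 - {m}) = 0"
      using less.hyps[OF card fIH _ _ b0H] less.prems(2) \<open>IH \<subset> I\<close> by blast
    then show ?thesis using mb by (simp add: v'_def insert_absorb)
  qed
qed

section \<open>Polynomial functions and integration over cones\<close>

text \<open>The expansion in \<open>t\<close> with coefficients polynomial in \<open>x\<close>
  allows integration along a ray term by term. The class \<open>C\<close> of functions with such an
  expansion is closed under sums and products, which gives the induction.\<close>

lemma poly_along_line:
  fixes q :: "'a::real_normed_vector \<Rightarrow> real"
  assumes "real_polynomial_function q"
  shows "\<exists>n r. (\<forall>i. real_polynomial_function (r i)) \<and>
    (\<forall>x t. q (x + t *\<^sub>R v) = (\<Sum>i\<le>(n::nat). t ^ i * r i x))"
proof -
  define C :: "('a \<Rightarrow> real \<Rightarrow> real) set" where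
    "C = {f. \<exists>n r. (\<forall>i. real_polynomial_function (r i)) \<and> (\<forall>x t. f x t = (\<Sum>i\<le>(n::nat). t ^ i * r i x))}"
  have C_mono: "(\<lambda>x t. t ^ k * p x) \<in> C" if "real_polynomial_function p" for k p
    unfolding C_def
  proof (intro CollectI exI conjI allI)
    show "real_polynomial_function (if i = k then p else (\<lambda>_. 0))" for i using that by auto
    show "t ^ k * p x = (\<Sum>i\<le>k. t ^ i * (if i = k then p else (\<lambda>_. 0)) x)" for x t
    proof -
      have "(\<Sum>i\<le>k. t ^ i * (if i = k then p else (\<lambda>_. 0)) x) = (\<Sum>i\<le>k. if i = k then t ^ k * p x else 0)"
        by (intro sum.cong) auto
      then show ?thesis by simp
    qed
  qed
  have C_add: "(\<lambda>x t. f x t + g x t) \<in> C" if fg: "f \<in> C" "g \<in> C" for f g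
  proof -
    obtain n r where r: "\<And>i. real_polynomial_function (r i)" "\<And>x t. f x t = (\<Sum>i\<le>(n::nat). t ^ i * r i x)"
      using fg(1) unfolding C_def by blast
    obtain m s where s: "\<And>i. real_polynomial_function (s i)" "\<And>x t. g x t = (\<Sum>i\<le>(m::nat). t ^ i * s i x)"
      using fg(2) unfolding C_def by blast
    define z where "z i = (\<lambda>x. (if i \<le> n then r i x else 0) + (if i \<le> m then s i x else 0))" for i
    have trunc: "(\<Sum>i\<le>k. t ^ i * u i) = (\<Sum>i\<le>max n m. t ^ i * (if i \<le> k then u i else 0))"
      if "k \<le> max n m" for k t and u :: "nat \<Rightarrow> real"
    proof -
      have "(\<Sum>i\<le>max n m. t ^ i * (if i \<le> k then u i else 0)) = (\<Sum>i\<le>k. t ^ i * (if i \<le> k then u i else 0))"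
        using that by (intro sum.mono_neutral_right) auto
      then show ?thesis by simp
    qed
    have "real_polynomial_function (z i)" for i
      unfolding z_def using r(1)[of i] s(1)[of i] by (cases "i \<le> n"; cases "i \<le> m") auto
    moreover have "f x t + g x t = (\<Sum>i\<le>max n m. t ^ i * z i x)" for x t
      unfolding r s z_def using trunc[of n t "\<lambda>i. r i x"] trunc[of m t "\<lambda>i. s i x"]
      by (simp add: distrib_left sum.distrib)
    ultimately show ?thesis unfolding C_def by blast
  qed
  have C_0: "(\<lambda>x t. 0) \<in> C" using C_mono[of "\<lambda>_. 0" 0] by auto
  have C_sum: "(\<lambda>x t. \<Sum>i\<in>A. F i x t) \<in> C" if "finite A" "\<And>i. i \<in> A \<Longrightarrow> F i \<in> C" for A :: "nat set" and F
    using that by (induction A) (auto intro: C_0 C_add)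
  have C_mult: "(\<lambda>x t. f x t * g x t) \<in> C" if fg: "f \<in> C" "g \<in> C" for f g
  proof -
    obtain n r where r: "\<And>i. real_polynomial_function (r i)" "\<And>x t. f x t = (\<Sum>i\<le>(n::nat). t ^ i * r i x)"
      using fg(1) unfolding C_def by blast
    obtain m s where s: "\<And>i. real_polynomial_function (s i)" "\<And>x t. g x t = (\<Sum>i\<le>(m::nat). t ^ i * s i x)"
      using fg(2) unfolding C_def by blast
    have "(\<lambda>x t. f x t * g x t) = (\<lambda>x t. \<Sum>i\<le>n. \<Sum>j\<le>m. t ^ (i + j) * (r i x * s j x))"
      unfolding r s sum_product by (auto simp: power_add algebra_simps intro!: ext sum.cong)
    also have "\<dots> \<in> C" using r s by (intro C_sum C_mono finite_atMost) auto
    finally show ?thesis .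
  qed
  have "(\<lambda>x t. q (x + t *\<^sub>R v)) \<in> C"
    using assms
  proof (induction q rule: real_polynomial_function.induct)
    case (linear f)
    then have "(\<lambda>x t. f (x + t *\<^sub>R v)) = (\<lambda>x t. t ^ 0 * f x + t ^ 1 * f v)"
      by (simp add: bounded_linear.linear linear_add linear_scale)
    then show ?case using C_add[OF C_mono C_mono, of f "\<lambda>_. f v" 0 1] linear by auto
  next
    case (const c)
    then show ?case using C_mono[of "\<lambda>_. c" 0] by auto
  qed (use C_add C_mult in auto)
  then show ?thesis by (simp add: C_def)
qed

lemma poly_dir_deriv:
  assumes "real_polynomial_function p"
  obtains p' where "real_polynomial_function p'"
    "\<And>x. ((\<lambda>t. p (x + t *\<^sub>R v)) has_real_derivative p' x) (at 0)"
proof -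
  have "\<exists>p'. real_polynomial_function p' \<and> (\<forall>x. ((\<lambda>t. p (x + t *\<^sub>R v)) has_real_derivative p' x) (at 0))"
    using assms
  proof (induction p rule: real_polynomial_function.induct)
    case (linear f)
    then have "(\<lambda>t. f (x + t *\<^sub>R v)) = (\<lambda>t. f x + t * f v)" for x
      by (simp add: bounded_linear.linear linear_add linear_scale)
    then show ?case
      by (auto intro!: exI[of _ "\<lambda>_. f v"] derivative_eq_intros)
  next
    case (const c)
    then show ?case by (auto intro!: exI[of _ "\<lambda>_. 0"] derivative_eq_intros)
  next
    case (add f g)
    then obtain f' g' where "real_polynomial_function f'" "real_polynomial_function g'"
      "\<And>x. ((\<lambda>t. f (x + t *\<^sub>R v)) has_real_derivative f' x) (at 0)"
      "\<And>x. ((\<lambda>t. g (x + t *\<^sub>R v)) has_real_derivative g' x) (at 0)" by auto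
    then show ?case
      by (intro exI[of _ "\<lambda>x. f' x + g' x"]) (auto intro!: derivative_eq_intros)
  next
    case (mult f g)
    then obtain f' g' where fg: "real_polynomial_function f'" "real_polynomial_function g'"
      "\<And>x. ((\<lambda>t. f (x + t *\<^sub>R v)) has_real_derivative f' x) (at 0)"
      "\<And>x. ((\<lambda>t. g (x + t *\<^sub>R v)) has_real_derivative g' x) (at 0)" by auto
    have "((\<lambda>t. f (x + t *\<^sub>R v) * g (x + t *\<^sub>R v)) has_real_derivative f x * g' x + f' x * g x) (at 0)" for x
      using DERIV_mult'[OF fg(3,4), of x] by simp
    then show ?case
      using fg mult by (intro exI[of _ "\<lambda>x. f x * g' x + f' x * g x"]) auto
  qed
  then show ?thesis using that by blast
qed

lemma poly_affine_line:
  assumes "real_polynomial_function p"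
  shows "real_polynomial_function (\<lambda>t::real. p (x + t *\<^sub>R y))"
proof -
  have "polynomial_function (\<lambda>t::real. x + t *\<^sub>R y)"
    by (intro polynomial_function_add polynomial_function_const polynomial_function_bounded_linear)
      (simp add: bounded_linear_scaleR_left)
  then have "real_polynomial_function (p \<circ> (\<lambda>t::real. x + t *\<^sub>R y))"
    using assms by (rule real_polynomial_function_compose)
  then show ?thesis by (simp add: o_def)
qed

lemma real_poly_infinite_zeros:
  fixes p :: "real \<Rightarrow> real"
  assumes "real_polynomial_function p" "infinite {t. p t = 0}"
  shows "p t = 0"
proof -
  obtain a n where p: "p = (\<lambda>x. \<Sum>i\<le>(n::nat). a i * x ^ i)"
    using assms(1) real_polynomial_function_iff_sum by blast
  then have "\<forall>i\<le>n. a i = 0"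
    using assms(2) polyfun_finite_roots[where n = n and c = a] by auto
  then show ?thesis by (simp add: p)
qed

text \<open>On the line through \<open>x\<close> and an arbitrary \<open>y\<close> the polynomial
  has infinitely many zeros, those near \<open>x\<close>.\<close>

lemma poly_zero_open:
  fixes p :: "'a::euclidean_space \<Rightarrow> real"
  assumes "real_polynomial_function p" "open U" "x \<in> U" "\<And>y. y \<in> U \<Longrightarrow> p y = 0"
  shows "p = (\<lambda>_. 0)"
proof
  fix y
  define f where "f t = p (x + t *\<^sub>R (y - x))" for t
  have f: "real_polynomial_function f" unfolding f_def by (rule poly_affine_line[OF assms(1)])
  have "continuous (at 0) (\<lambda>t::real. x + t *\<^sub>R (y - x))" by (intro continuous_intros)
  then have "\<forall>\<^sub>F t in at (0::real). x + t *\<^sub>R (y - x) \<in> U"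
    using assms(2,3) by (auto simp: continuous_at dest!: topological_tendstoD)
  then have "\<forall>\<^sub>F t in at (0::real). f t = 0" by (rule eventually_mono) (simp add: f_def assms(4))
  then obtain d where d: "d > 0" "\<And>t. t \<noteq> 0 \<Longrightarrow> dist t 0 < d \<Longrightarrow> f t = 0"
    unfolding eventually_at by auto
  have "{0<..<d} \<subseteq> {t. f t = 0}" using d by auto
  then have "infinite {t. f t = 0}" using d(1) infinite_Ioo finite_subset by blast
  then have "f 1 = 0" by (rule real_poly_infinite_zeros[OF f])
  then show "p y = 0" by (simp add: f_def)
qed

lemma poly_linear_comp:
  fixes p :: "'a::euclidean_space \<Rightarrow> real"
  assumes "real_polynomial_function p" "linear f"
  shows "real_polynomial_function (\<lambda>x::'a. p (f x))"
proof -
  have "polynomial_function f"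
    using assms(2) by (intro polynomial_function_bounded_linear) (simp add: linear_conv_bounded_linear)
  then have "real_polynomial_function (p \<circ> f)" using assms(1) by (rule real_polynomial_function_compose)
  then show ?thesis by (simp add: o_def)
qed

section \<open>Integrals over the space of coefficients\<close>

abbreviation lprod :: "nat set \<Rightarrow> (nat \<Rightarrow> real) measure" where
  "lprod I \<equiv> Pi\<^sub>M I (\<lambda>_. lborel)"

interpretation lprod: product_sigma_finite "\<lambda>_::nat. lborel :: real measure"
  by standard

lemma measurable_comb [measurable]:
  fixes a :: "nat \<Rightarrow> 'a::euclidean_space"
  shows "(\<lambda>t. \<Sum>i\<in>I. t i *\<^sub>R a i) \<in> borel_measurable (lprod I)"
proof (intro borel_measurable_sum borel_measurable_scaleR borel_measurable_const)
  fix i assume "i \<in> I"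
  then have "(\<lambda>t. t i) \<in> measurable (lprod I) lborel" by (rule measurable_component_singleton)
  then show "(\<lambda>t. t i) \<in> borel_measurable (lprod I)" by simp
qed

lemma nn_integral_lborel_shift:
  fixes g :: "'a::euclidean_space \<Rightarrow> ennreal"
  assumes [measurable]: "g \<in> borel_measurable borel"
  shows "(\<integral>\<^sup>+x. g (x + v) \<partial>lborel) = (\<integral>\<^sup>+x. g x \<partial>lborel)"
proof -
  have "(\<integral>\<^sup>+x. g x \<partial>lborel) = (\<integral>\<^sup>+x. g x \<partial>distr lborel borel ((+) v))" by (simp add: lborel_distr_plus)
  also have "\<dots> = (\<integral>\<^sup>+x. g (v + x) \<partial>lborel)" by (subst nn_integral_distr) auto
  finally show ?thesis by (simp add: add.commute)
qed

text \<open>The weights serve two uses: constant 1 for the invariant functional on all coefficients,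
  the indicator of the half-line for splines.\<close>

lemma nn_integral_comb_insert:
  fixes a :: "nat \<Rightarrow> 'a::euclidean_space" and w :: "nat \<Rightarrow> real \<Rightarrow> ennreal"
  assumes "finite I" "k \<notin> I" and [measurable]: "g \<in> borel_measurable borel" "\<And>i. w i \<in> borel_measurable borel"
  shows "(\<integral>\<^sup>+t. (\<Prod>i\<in>insert k I. w i (t i)) * g (\<Sum>i\<in>insert k I. t i *\<^sub>R a i) \<partial>lprod (insert k I)) =
    (\<integral>\<^sup>+y. w k y * (\<integral>\<^sup>+t. (\<Prod>i\<in>I. w i (t i)) * g ((\<Sum>i\<in>I. t i *\<^sub>R a i) + y *\<^sub>R a k) \<partial>lprod I) \<partial>lborel)"
proof -
  have m: "(\<lambda>t. w i (t i)) \<in> borel_measurable (lprod J)" if "i \<in> J" for i J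
  proof -
    have "(\<lambda>t. t i) \<in> measurable (lprod J) lborel" by (rule measurable_component_singleton[OF that])
    then show ?thesis by (rule measurable_compose) simp
  qed
  have M: "(\<lambda>t. (\<Prod>i\<in>insert k I. w i (t i)) * g (\<Sum>i\<in>insert k I. t i *\<^sub>R a i)) \<in> borel_measurable (lprod (insert k I))"
    by (intro borel_measurable_times_ennreal borel_measurable_prod_ennreal m measurable_compose[OF measurable_comb]) auto
  have "(\<integral>\<^sup>+t. (\<Prod>i\<in>insert k I. w i (t i)) * g (\<Sum>i\<in>insert k I. t i *\<^sub>R a i) \<partial>lprod (insert k I)) =
    (\<integral>\<^sup>+y. (\<integral>\<^sup>+t. w k y * ((\<Prod>i\<in>I. w i (t i)) * g ((\<Sum>i\<in>I. t i *\<^sub>R a i) + y *\<^sub>R a k)) \<partial>lprod I) \<partial>lborel)"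
  proof (subst lprod.product_nn_integral_insert_rev[OF assms(1,2) M], intro nn_integral_cong)
    fix y :: real and t :: "nat \<Rightarrow> real"
    have "(\<Prod>i\<in>I. w i ((t(k := y)) i)) = (\<Prod>i\<in>I. w i (t i))"
      "(\<Sum>i\<in>I. (t(k := y)) i *\<^sub>R a i) = (\<Sum>i\<in>I. t i *\<^sub>R a i)"
      using assms(2) by (auto intro!: prod.cong sum.cong)
    then show "(\<Prod>i\<in>insert k I. w i ((t(k := y)) i)) * g (\<Sum>i\<in>insert k I. (t(k := y)) i *\<^sub>R a i) =
        w k y * ((\<Prod>i\<in>I. w i (t i)) * g ((\<Sum>i\<in>I. t i *\<^sub>R a i) + y *\<^sub>R a k))"
      using assms(1,2) by (simp add: mult.assoc add.commute)
  qed
  also have "\<dots> = (\<integral>\<^sup>+y. w k y * (\<integral>\<^sup>+t. (\<Prod>i\<in>I. w i (t i)) * g ((\<Sum>i\<in>I. t i *\<^sub>R a i) + y *\<^sub>R a k) \<partial>lprod I) \<partial>lborel)"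
  proof (intro nn_integral_cong nn_integral_cmult borel_measurable_times_ennreal borel_measurable_prod_ennreal m)
    fix y :: real
    have "(\<lambda>x. g (x + y *\<^sub>R a k)) \<in> borel_measurable borel" by measurable
    then show "(\<lambda>t. g ((\<Sum>i\<in>I. t i *\<^sub>R a i) + y *\<^sub>R a k)) \<in> borel_measurable (lprod I)"
      using measurable_compose[OF measurable_comb, of "\<lambda>x. g (x + y *\<^sub>R a k)"] by simp
  qed
  finally show ?thesis .
qed

text \<open>A shift by a multiple of \<open>a k\<close> is a translation of the single variable
  \<open>t k\<close>, which Tonelli isolates; a general \<open>v\<close> is reached by adding such
  multiples.\<close>

lemma nn_integral_comb_shift:
  fixes a :: "nat \<Rightarrow> 'a::euclidean_space"
  assumes "finite I" "v \<in> span (a ` I)" and [measurable]: "g \<in> borel_measurable borel"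
  shows "(\<integral>\<^sup>+t. g ((\<Sum>i\<in>I. t i *\<^sub>R a i) + v) \<partial>lprod I) = (\<integral>\<^sup>+t. g (\<Sum>i\<in>I. t i *\<^sub>R a i) \<partial>lprod I)"
  using assms(2,3)
proof (induction v arbitrary: g rule: span_induct_alt)
  case base
  then show ?case by simp
next
  case (step c x y)
  note [measurable] = step.prems
  obtain k where k: "k \<in> I" "x = a k" using step by auto
  define J where "J = I - {k}"
  have J: "I = insert k J" "k \<notin> J" "finite J" using k assms(1) by (auto simp: J_def)
  have ins: "(\<integral>\<^sup>+t. f (\<Sum>i\<in>I. t i *\<^sub>R a i) \<partial>lprod I) =
      (\<integral>\<^sup>+z. (\<integral>\<^sup>+t. f ((\<Sum>i\<in>J. t i *\<^sub>R a i) + z *\<^sub>R a k) \<partial>lprod J) \<partial>lborel)"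
    if "f \<in> borel_measurable borel" for f :: "'a \<Rightarrow> ennreal"
    using nn_integral_comb_insert[OF J(3,2) that, of "\<lambda>_ _. 1" a] J(1) by simp
  have [measurable]: "(\<lambda>z. g (z + w)) \<in> borel_measurable borel" for w by measurable
  have "(\<integral>\<^sup>+t. g ((\<Sum>i\<in>I. t i *\<^sub>R a i) + (c *\<^sub>R x + y)) \<partial>lprod I) =
      (\<integral>\<^sup>+t. g ((\<Sum>i\<in>I. t i *\<^sub>R a i) + y + c *\<^sub>R x) \<partial>lprod I)" by (simp add: algebra_simps)
  also have "\<dots> = (\<integral>\<^sup>+t. g ((\<Sum>i\<in>I. t i *\<^sub>R a i) + c *\<^sub>R x) \<partial>lprod I)"
    using step.IH[of "\<lambda>z. g (z + c *\<^sub>R x)"] by simp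
  also have "\<dots> = (\<integral>\<^sup>+z. (\<integral>\<^sup>+t. g ((\<Sum>i\<in>J. t i *\<^sub>R a i) + (z + c) *\<^sub>R a k) \<partial>lprod J) \<partial>lborel)"
    using ins[of "\<lambda>z. g (z + c *\<^sub>R x)"] k by (simp add: algebra_simps)
  also have "\<dots> = (\<integral>\<^sup>+z. (\<integral>\<^sup>+t. g ((\<Sum>i\<in>J. t i *\<^sub>R a i) + z *\<^sub>R a k) \<partial>lprod J) \<partial>lborel)"
  proof (rule nn_integral_lborel_shift)
    interpret sigma_finite_measure "lprod J" by (rule lprod.sigma_finite[OF J(3)])
    have "(\<lambda>(z::real, t). (\<Sum>i\<in>J. t i *\<^sub>R a i) + z *\<^sub>R a k) \<in> borel_measurable (borel \<Otimes>\<^sub>M lprod J)"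
      by measurable
    from measurable_compose[OF this step.prems]
    have "(\<lambda>(z::real, t). g ((\<Sum>i\<in>J. t i *\<^sub>R a i) + z *\<^sub>R a k)) \<in> borel_measurable (borel \<Otimes>\<^sub>M lprod J)"
      by (simp add: split_beta')
    then show "(\<lambda>z. \<integral>\<^sup>+ t. g ((\<Sum>i\<in>J. t i *\<^sub>R a i) + z *\<^sub>R a k) \<partial>lprod J) \<in> borel_measurable borel"
      by (rule borel_measurable_nn_integral)
  qed
  also have "\<dots> = (\<integral>\<^sup>+t. g (\<Sum>i\<in>I. t i *\<^sub>R a i) \<partial>lprod I)" using ins[of g] by simp
  finally show ?case .
qed

section \<open>Existence of the spline\<close>

lemma continuous_coord:
  fixes a :: "nat \<Rightarrow> 'a::euclidean_space"
  assumes "lin_indep a I" "span (a ` I) = UNIV" "i \<in> I"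
  shows "continuous_on S (\<lambda>x. coord a I x i)"
  by (rule linear_continuous_on)
    (use linear_coord[OF assms(1,3,2)] in \<open>simp add: linear_conv_bounded_linear\<close>)

text \<open>
  A translation invariant functional \<open>N\<close> is proportional to the Lebesgue integral: with a weight \<open>w\<close> of
  integral 1, write \<open>N f = \<integral> w y N (\<lambda>x. f (x + y)) dy\<close>, exchange the two functionals and shift \<open>y\<close>.
\<close>

lemma nn_integral_comb_basis:
  fixes a :: "nat \<Rightarrow> 'a::euclidean_space"
  assumes "lin_indep a I" "span (a ` I) = UNIV"
  obtains K :: real where "0 < K"
    "\<And>g. g \<in> borel_measurable borel \<Longrightarrow>
      (\<integral>\<^sup>+t. g (\<Sum>i\<in>I. t i *\<^sub>R a i) \<partial>lprod I) = ennreal K * (\<integral>\<^sup>+x. g x \<partial>lborel)"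
    "0 < measure lborel {x. \<forall>i\<in>I. 0 \<le> coord a I x i \<and> coord a I x i \<le> 1}"
proof -
  have fin: "finite I" using assms(1) by (simp add: lin_indep_def)
  interpret L: sigma_finite_measure "lprod I" by (rule lprod.sigma_finite[OF fin])
  interpret LP: pair_sigma_finite "lprod I" "lborel :: 'a measure" ..
  define N where "N g = (\<integral>\<^sup>+t. g (\<Sum>i\<in>I. t i *\<^sub>R a i) \<partial>lprod I)" for g :: "'a \<Rightarrow> ennreal"
  define w :: "'a \<Rightarrow> ennreal" where "w = indicator (cbox 0 One)"
  have [measurable]: "w \<in> borel_measurable borel" by (simp add: w_def)
  have w1: "(\<integral>\<^sup>+y. w y \<partial>lborel) = 1" by (simp add: w_def emeasure_lborel_cbox_eq)
  have shift: "N (\<lambda>x. g (x + v)) = N g" if "g \<in> borel_measurable borel" for g v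
    unfolding N_def using nn_integral_comb_shift[OF fin _ that, of v] assms(2) by simp
  define K' where "K' = N (\<lambda>x. w (- x))"
  have N: "N f = K' * (\<integral>\<^sup>+x. f x \<partial>lborel)" if [measurable]: "f \<in> borel_measurable borel" for f
  proof -
    have "N f = (\<integral>\<^sup>+y. w y * N (\<lambda>x. f (x + y)) \<partial>lborel)"
      by (simp add: shift nn_integral_multc w1)
    also have "\<dots> = (\<integral>\<^sup>+y. (\<integral>\<^sup>+t. w y * f ((\<Sum>i\<in>I. t i *\<^sub>R a i) + y) \<partial>lprod I) \<partial>lborel)"
      unfolding N_def by (intro nn_integral_cong nn_integral_cmult[symmetric]) measurable
    also have "\<dots> = (\<integral>\<^sup>+t. (\<integral>\<^sup>+y. w y * f ((\<Sum>i\<in>I. t i *\<^sub>R a i) + y) \<partial>lborel) \<partial>lprod I)"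
      by (rule LP.Fubini') measurable
    also have "\<dots> = (\<integral>\<^sup>+t. (\<integral>\<^sup>+y. w (y - (\<Sum>i\<in>I. t i *\<^sub>R a i)) * f y \<partial>lborel) \<partial>lprod I)"
    proof (rule nn_integral_cong)
      fix t :: "nat \<Rightarrow> real"
      have "(\<lambda>y. w (y - (\<Sum>i\<in>I. t i *\<^sub>R a i)) * f y) \<in> borel_measurable borel" by measurable
      from nn_integral_lborel_shift[OF this, of "\<Sum>i\<in>I. t i *\<^sub>R a i"]
      show "(\<integral>\<^sup>+y. w y * f ((\<Sum>i\<in>I. t i *\<^sub>R a i) + y) \<partial>lborel) =
          (\<integral>\<^sup>+y. w (y - (\<Sum>i\<in>I. t i *\<^sub>R a i)) * f y \<partial>lborel)" by (simp add: add.commute)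
    qed
    also have "\<dots> = (\<integral>\<^sup>+y. (\<integral>\<^sup>+t. w (y - (\<Sum>i\<in>I. t i *\<^sub>R a i)) * f y \<partial>lprod I) \<partial>lborel)"
      by (rule LP.Fubini'[symmetric]) measurable
    also have "\<dots> = (\<integral>\<^sup>+y. K' * f y \<partial>lborel)"
    proof (intro nn_integral_cong)
      fix y :: 'a
      have "(\<integral>\<^sup>+t. w (y - (\<Sum>i\<in>I. t i *\<^sub>R a i)) * f y \<partial>lprod I) = N (\<lambda>x. w (y - x)) * f y"
        unfolding N_def by (intro nn_integral_multc) measurable
      also have "N (\<lambda>x. w (y - x)) = K'"
        using shift[of "\<lambda>x. w (- x)" "-y"] by (simp add: K'_def)
      finally show "(\<integral>\<^sup>+t. w (y - (\<Sum>i\<in>I. t i *\<^sub>R a i)) * f y \<partial>lprod I) = K' * f y" .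
    qed
    also have "\<dots> = K' * (\<integral>\<^sup>+x. f x \<partial>lborel)" by (intro nn_integral_cmult) simp
    finally show ?thesis .
  qed
  \<comment> \<open>\<open>P\<close> corresponds to the unit cube of coefficients, so
    \<open>N (indicator P) = 1\<close> and \<open>K'\<close> times the volume of \<open>P\<close> is
    1. Hence \<open>K'\<close> is neither 0 nor infinite, and the volume is positive.\<close>
  define P where "P = {x. \<forall>i\<in>I. 0 \<le> coord a I x i \<and> coord a I x i \<le> 1}"
  have "closed P"
  proof -
    have "P = (\<Inter>i\<in>I. {x. 0 \<le> coord a I x i} \<inter> {x. coord a I x i \<le> 1})" by (auto simp: P_def)
    also have "closed \<dots>"
      using continuous_coord[OF assms]
      by (intro closed_INT ballI closed_Int closed_Collect_le continuous_on_const) auto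
    finally show ?thesis .
  qed
  then have [measurable]: "P \<in> sets borel" by simp
  have comb: "coord a I (\<Sum>i\<in>I. t i *\<^sub>R a i) j = t j" if "j \<in> I" for t j
    by (rule coord_unique[OF assms(1) that])
  have "N (indicator P) = 1"
  proof -
    have "N (indicator P) = (\<integral>\<^sup>+t. indicator (Pi\<^sub>E I (\<lambda>_. {0..1})) t \<partial>lprod I)"
      unfolding N_def
      by (intro nn_integral_cong) (auto simp: indicator_def P_def comb space_PiM PiE_iff)
    also have "\<dots> = emeasure (lprod I) (Pi\<^sub>E I (\<lambda>_. {0..1}))"
      using fin by (intro nn_integral_indicator sets_PiM_I_finite) auto
    also have "\<dots> = 1" using fin by (subst lprod.emeasure_PiM) auto
    finally show ?thesis .
  qed
  then have KP: "K' * emeasure lborel P = 1" using N[of "indicator P"] by simp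
  have "bounded P"
  proof (rule boundedI)
    fix x assume x: "x \<in> P"
    have "norm x = norm (\<Sum>i\<in>I. coord a I x i *\<^sub>R a i)" using coord_sum[OF fin, of x a] assms(2) by simp
    also have "\<dots> \<le> (\<Sum>i\<in>I. norm (a i))"
      using x by (intro sum_norm_le) (auto simp: P_def intro: mult_left_le_one_le)
    finally show "norm x \<le> (\<Sum>i\<in>I. norm (a i))" .
  qed
  then have eP: "emeasure lborel P < \<infinity>" by (rule emeasure_bounded_finite)
  have "K' \<noteq> 0" "emeasure lborel P \<noteq> 0" using KP by auto
  then have "K' \<noteq> \<infinity>" using KP by (auto simp: ennreal_top_mult)
  define K where "K = enn2real K'"
  have K: "K' = ennreal K" using \<open>K' \<noteq> \<infinity>\<close> by (simp add: K_def ennreal_enn2real_if)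
  have "0 < K" using \<open>K' \<noteq> 0\<close> \<open>K' \<noteq> \<infinity>\<close> by (simp add: K_def enn2real_positive_iff less_top[symmetric] zero_less_iff_neq_zero)
  moreover have "0 < measure lborel P"
    using \<open>emeasure lborel P \<noteq> 0\<close> eP
    by (simp add: measure_def enn2real_positive_iff zero_less_iff_neq_zero)
  ultimately show ?thesis using that[of K] N unfolding N_def K P_def by blast
qed

text \<open>Test functions are all nonnegative Borel functions, with values in
  \<open>ennreal\<close>, so that Tonelli applies to each of them; \<open>spline_integral\<close>
  returns to real test functions. The density refers to \<open>lborel\<close>, and continuity on the
  closed cone selects the representative.\<close>

definition spline :: "(nat \<Rightarrow> 'a::euclidean_space) \<Rightarrow> nat set \<Rightarrow> ('a \<Rightarrow> real) \<Rightarrow> bool" where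
  "spline a I T \<longleftrightarrow> continuous_on (gcone a I) T \<and> (\<forall>x. x \<notin> gcone a I \<longrightarrow> T x = 0) \<and> (\<forall>x. 0 \<le> T x) \<and>
    (\<forall>g\<in>borel_measurable borel.
      (\<integral>\<^sup>+t. (\<Prod>i\<in>I. indicator {0..} (t i)) * g (\<Sum>i\<in>I. t i *\<^sub>R a i) \<partial>lprod I) =
      (\<integral>\<^sup>+x. g x * ennreal (T x) \<partial>lborel))"

lemma closed_gcone:
  fixes a :: "nat \<Rightarrow> 'a::euclidean_space"
  shows "finite I \<Longrightarrow> closed (gcone a I)"
  by (simp add: gcone_eq_hull closed_convex_cone_hull)

lemma measurable_cone_supported:
  fixes a :: "nat \<Rightarrow> 'a::euclidean_space" and T :: "'a \<Rightarrow> real"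
  assumes "finite I" "continuous_on (gcone a I) T" "\<And>x. x \<notin> gcone a I \<Longrightarrow> T x = 0"
  shows "T \<in> borel_measurable borel"
proof -
  have "(\<lambda>x. indicator (gcone a I) x *\<^sub>R T x) \<in> borel_measurable borel"
    using closed_gcone[OF assms(1), of a] assms(2) by (intro borel_measurable_continuous_on_indicator) auto
  also have "(\<lambda>x. indicator (gcone a I) x *\<^sub>R T x) = T"
  proof
    fix x show "indicator (gcone a I) x *\<^sub>R T x = T x"
      using assms(3)[of x] by (cases "x \<in> gcone a I") auto
  qed
  finally show ?thesis .
qed

text \<open>For a basis the map from coefficients to vectors is bijective and carries the orthant to
  the cone. The weight becomes the indicator of the cone, and \<open>K\<close> is the constant of
  the linear change of variables.\<close>

lemma spline_basis:
  fixes a :: "nat \<Rightarrow> 'a::euclidean_space"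
  assumes "lin_indep a I" "span (a ` I) = UNIV"
  obtains K where "0 < K" "spline a I (\<lambda>x. if x \<in> gcone a I then K else 0)"
proof -
  have fin: "finite I" using assms(1) by (simp add: lin_indep_def)
  obtain K where K: "0 < K" "\<And>g. g \<in> borel_measurable borel \<Longrightarrow>
      (\<integral>\<^sup>+t. g (\<Sum>i\<in>I. t i *\<^sub>R a i) \<partial>lprod I) = ennreal K * (\<integral>\<^sup>+x. g x \<partial>lborel)"
    using nn_integral_comb_basis[OF assms] by blast
  have [measurable]: "gcone a I \<in> sets borel" using closed_gcone[OF fin, of a] by simp
  have "spline a I (\<lambda>x. if x \<in> gcone a I then K else 0)"
    unfolding spline_def
  proof (intro conjI ballI allI impI)
    show "continuous_on (gcone a I) (\<lambda>x. if x \<in> gcone a I then K else 0)"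
      by (rule continuous_on_eq[OF continuous_on_const]) auto
    fix g :: "'a \<Rightarrow> ennreal" assume [measurable]: "g \<in> borel_measurable borel"
    have ind: "(\<Prod>i\<in>I. indicator {0..} (t i)) = (indicator (gcone a I) (\<Sum>i\<in>I. t i *\<^sub>R a i) :: ennreal)" for t
    proof -
      have "(\<Sum>i\<in>I. t i *\<^sub>R a i) \<in> gcone a I \<longleftrightarrow> (\<forall>i\<in>I. 0 \<le> t i)"
        using in_gcone_iff[OF assms(1)] assms(2) coord_unique[OF assms(1), of _ t] by auto
      moreover have "(\<Prod>i\<in>I. indicator {0..} (t i)) = (if \<forall>i\<in>I. 0 \<le> t i then 1 else (0::ennreal))"
        using fin by (auto simp: prod_zero_iff indicator_def intro!: prod.neutral)
      ultimately show ?thesis by (simp add: indicator_def)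
    qed
    have "(\<integral>\<^sup>+t. (\<Prod>i\<in>I. indicator {0..} (t i)) * g (\<Sum>i\<in>I. t i *\<^sub>R a i) \<partial>lprod I) =
        (\<integral>\<^sup>+t. (\<lambda>x. indicator (gcone a I) x * g x) (\<Sum>i\<in>I. t i *\<^sub>R a i) \<partial>lprod I)" by (simp add: ind)
    also have "\<dots> = ennreal K * (\<integral>\<^sup>+x. indicator (gcone a I) x * g x \<partial>lborel)" by (rule K(2)) measurable
    also have "\<dots> = (\<integral>\<^sup>+x. ennreal K * (indicator (gcone a I) x * g x) \<partial>lborel)"
      by (rule nn_integral_cmult[symmetric]) measurable
    also have "\<dots> = (\<integral>\<^sup>+x. g x * ennreal (if x \<in> gcone a I then K else 0) \<partial>lborel)"
      by (intro nn_integral_cong) (auto simp: indicator_def mult.commute)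
    finally show "(\<integral>\<^sup>+t. (\<Prod>i\<in>I. indicator {0..} (t i)) * g (\<Sum>i\<in>I. t i *\<^sub>R a i) \<partial>lprod I) =
      (\<integral>\<^sup>+x. g x * ennreal (if x \<in> gcone a I then K else 0) \<partial>lborel)" .
  qed (use K(1) in auto)
  then show ?thesis using that K(1) by blast
qed

section \<open>Integration along rays\<close>

lemma continuous_on_Min_image:
  fixes f :: "'i \<Rightarrow> 'a::topological_space \<Rightarrow> real"
  assumes "finite F" "F \<noteq> {}" "\<And>h. h \<in> F \<Longrightarrow> continuous_on S (f h)"
  shows "continuous_on S (\<lambda>x. Min ((\<lambda>h. f h x) ` F))"
  using assms
proof (induction F rule: finite_ne_induct)
  case (insert h F)
  then have "(\<lambda>x. Min ((\<lambda>h. f h x) ` insert h F)) = (\<lambda>x. min (f h x) (Min ((\<lambda>h. f h x) ` F)))" by auto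
  then show ?case using insert by (auto intro: continuous_on_min)
qed auto

lemma continuous_on_Max_image:
  fixes f :: "'i \<Rightarrow> 'a::topological_space \<Rightarrow> real"
  assumes "finite F" "F \<noteq> {}" "\<And>h. h \<in> F \<Longrightarrow> continuous_on S (f h)"
  shows "continuous_on S (\<lambda>x. Max ((\<lambda>h. f h x) ` F))"
  using assms
proof (induction F rule: finite_ne_induct)
  case (insert h F)
  then have "(\<lambda>x. Max ((\<lambda>h. f h x) ` insert h F)) = (\<lambda>x. max (f h x) (Max ((\<lambda>h. f h x) ` F)))" by auto
  then show ?case using insert by (auto intro: continuous_on_max)
qed auto

text \<open>Continuity of the two end points relies on the cone being polyhedral.\<close>

lemma gcone_line_interval:
  fixes a :: "nat \<Rightarrow> 'a::euclidean_space"
  assumes "finite I" "k \<notin> I" "- a k \<notin> gcone a I"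
  obtains t0 t1 :: "'a \<Rightarrow> real" where "continuous_on UNIV t0" "continuous_on UNIV t1" "\<And>x. 0 \<le> t0 x"
    "\<And>x. x \<in> gcone a (insert k I) \<Longrightarrow> t0 x \<le> t1 x"
    "\<And>x t. x \<in> gcone a (insert k I) \<Longrightarrow> 0 \<le> t \<Longrightarrow> x - t *\<^sub>R a k \<in> gcone a I \<longleftrightarrow> t0 x \<le> t \<and> t \<le> t1 x"
proof -
  have "polyhedron (gcone a I)" using assms(1) by (simp add: gcone_eq_hull polyhedron_convex_cone_hull)
  then obtain F where F: "finite F" "gcone a I = \<Inter> F" "\<forall>h\<in>F. \<exists>n b. h = {x. n \<bullet> x \<le> b}"
    unfolding polyhedron_def by (elim exE conjE) (rule that, assumption+, metis)
  obtain n where n: "\<forall>h\<in>F. \<exists>b. h = {x. n h \<bullet> x \<le> b}"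
    using bchoice[OF F(3)] by (elim exE) (rule that)
  obtain b where nb: "\<forall>h\<in>F. h = {x. n h \<bullet> x \<le> b h}"
    using bchoice[OF n] by (elim exE) (rule that)
  have "y \<in> h \<longleftrightarrow> n h \<bullet> y \<le> b h" if "h \<in> F" for h y
  proof -
    have "y \<in> h \<longleftrightarrow> y \<in> {x. n h \<bullet> x \<le> b h}" using nb that by metis
    then show ?thesis by simp
  qed
  then have C: "y \<in> gcone a I \<longleftrightarrow> (\<forall>h\<in>F. n h \<bullet> y \<le> b h)" for y
    unfolding F(2) by simp
  define r where "r h x = (n h \<bullet> x - b h) / (n h \<bullet> a k)" for h x
  \<comment> \<open>A half-space bounds \<open>t\<close> from below if
    \<open>n h \<bullet> a k\<close> is positive and from above if it is negative, both by
    \<open>r h x\<close>. Those parallel to \<open>a k\<close> do not restrict \<open>t\<close>, and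
    hold as soon as the ray meets the cone at all.\<close>
  define Fp Fn where "Fp = {h \<in> F. 0 < n h \<bullet> a k}" and "Fn = {h \<in> F. n h \<bullet> a k < 0}"
  have fin: "finite Fp" "finite Fn" using F(1) by (auto simp: Fp_def Fn_def)
  \<comment> \<open>Each \<open>b h\<close> is nonnegative because 0 is in the cone; without upper
    bounds \<open>- a k\<close> would satisfy every inequality.\<close>
  have "Fn \<noteq> {}"
  proof
    assume "Fn = {}"
    then have "n h \<bullet> (- a k) \<le> b h" if "h \<in> F" for h
      using that zero_in_gcone[of a I] C[of 0] by (fastforce simp: Fn_def not_less)
    then show False using C assms(3) by blast
  qed
  define t0 where "t0 x = Max (insert 0 ((\<lambda>h. r h x) ` Fp))" for x
  define t1 where "t1 x = Min ((\<lambda>h. r h x) ` Fn)" for x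
  have rc: "continuous_on UNIV (r h)" for h
    unfolding r_def divide_inverse by (intro continuous_intros)
  have t0: "t0 x \<le> t \<longleftrightarrow> 0 \<le> t \<and> (\<forall>h\<in>Fp. r h x \<le> t)" for x t
    unfolding t0_def using fin by (simp add: ball_simps)
  have t1: "t \<le> t1 x \<longleftrightarrow> (\<forall>h\<in>Fn. t \<le> r h x)" for x t
    unfolding t1_def using fin \<open>Fn \<noteq> {}\<close> by simp
  have iff: "x - t *\<^sub>R a k \<in> gcone a I \<longleftrightarrow> t0 x \<le> t \<and> t \<le> t1 x \<and> (\<forall>h\<in>F. n h \<bullet> a k = 0 \<longrightarrow> n h \<bullet> x \<le> b h)"
    if "0 \<le> t" for x t
  proof -
    have p: "n h \<bullet> (x - t *\<^sub>R a k) \<le> b h \<longleftrightarrow> r h x \<le> t" if "h \<in> Fp" for h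
      using that by (simp add: Fp_def r_def inner_diff_right pos_divide_le_eq algebra_simps)
    have q: "n h \<bullet> (x - t *\<^sub>R a k) \<le> b h \<longleftrightarrow> t \<le> r h x" if "h \<in> Fn" for h
      using that by (simp add: Fn_def r_def inner_diff_right neg_le_divide_eq algebra_simps)
    have z: "n h \<bullet> (x - t *\<^sub>R a k) \<le> b h \<longleftrightarrow> n h \<bullet> x \<le> b h" if "n h \<bullet> a k = 0" for h
      using that by (simp add: inner_diff_right)
    have "F = Fp \<union> Fn \<union> {h\<in>F. n h \<bullet> a k = 0}" by (auto simp: Fp_def Fn_def)
    then have "x - t *\<^sub>R a k \<in> gcone a I \<longleftrightarrow> (\<forall>h\<in>Fp. n h \<bullet> (x - t *\<^sub>R a k) \<le> b h) \<and>
        (\<forall>h\<in>Fn. n h \<bullet> (x - t *\<^sub>R a k) \<le> b h) \<and> (\<forall>h\<in>F. n h \<bullet> a k = 0 \<longrightarrow> n h \<bullet> (x - t *\<^sub>R a k) \<le> b h)"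
      unfolding C by blast
    then show ?thesis using p q z t0 t1 that by auto
  qed
  have ex: "\<exists>t\<ge>0. x - t *\<^sub>R a k \<in> gcone a I" if "x \<in> gcone a (insert k I)" for x
    using that unfolding gcone_insert[OF assms(1,2)] by force
  show ?thesis
  proof (rule that[of t0 t1])
    \<comment> \<open>The 0 in \<open>t0\<close> is the constraint that \<open>t\<close> is
      nonnegative; \<open>None\<close> serves as its index, so that the maximum runs over an
      image.\<close>
    have "t0 = (\<lambda>x. Max ((\<lambda>h. case h of None \<Rightarrow> 0 | Some h \<Rightarrow> r h x) ` insert None (Some ` Fp)))"
      by (rule ext) (simp add: t0_def image_image)
    moreover have "continuous_on UNIV (\<lambda>x. Max ((\<lambda>h. case h of None \<Rightarrow> 0 | Some h \<Rightarrow> r h x) ` insert None (Some ` Fp)))"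
      using fin rc by (intro continuous_on_Max_image) (auto split: option.splits)
    ultimately show "continuous_on UNIV t0" by simp
    show "continuous_on UNIV t1"
      unfolding t1_def by (intro continuous_on_Min_image fin \<open>Fn \<noteq> {}\<close> rc)
    show "0 \<le> t0 x" for x unfolding t0_def using fin by (intro Max_ge) auto
    fix x assume x: "x \<in> gcone a (insert k I)"
    then show "t0 x \<le> t1 x" using ex iff by (meson order_trans)
    fix t :: real assume "0 \<le> t"
    then show "x - t *\<^sub>R a k \<in> gcone a I \<longleftrightarrow> t0 x \<le> t \<and> t \<le> t1 x"
      using ex[OF x] iff by blast
  qed
qed

definition ray_integral :: "'a::euclidean_space \<Rightarrow> ('a \<Rightarrow> real) \<Rightarrow> 'a \<Rightarrow> real" where
  "ray_integral v T x = integral {0..} (\<lambda>t. T (x - t *\<^sub>R v))"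

lemma gcone_add_ray: "finite I \<Longrightarrow> k \<notin> I \<Longrightarrow> 0 \<le> t \<Longrightarrow> x - t *\<^sub>R a k \<in> gcone a I \<Longrightarrow> x \<in> gcone a (insert k I)"
  unfolding gcone_insert by force

text \<open>The chord from \<open>t0 x\<close> to \<open>t1 x\<close> is rescaled to the unit
  interval. The integrand is then jointly continuous over a fixed interval, so the integral depends
  continuously on \<open>x\<close>; a degenerate chord is covered by the factor
  \<open>t1 x - t0 x\<close>.\<close>

lemma ray_integral_cone:
  fixes a :: "nat \<Rightarrow> 'a::euclidean_space"
  assumes "finite I" "k \<notin> I" "- a k \<notin> gcone a I"
    and "continuous_on (gcone a I) T" "\<And>x. x \<notin> gcone a I \<Longrightarrow> T x = 0"
  shows "((\<lambda>t. T (x - t *\<^sub>R a k)) has_integral ray_integral (a k) T x) {0..}"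
    and "continuous_on (gcone a (insert k I)) (ray_integral (a k) T)"
    and "x \<notin> gcone a (insert k I) \<Longrightarrow> ray_integral (a k) T x = 0"
proof -
  obtain t0 t1 :: "'a \<Rightarrow> real" where t: "continuous_on UNIV t0" "continuous_on UNIV t1" "\<And>x. 0 \<le> t0 x"
    "\<And>x. x \<in> gcone a (insert k I) \<Longrightarrow> t0 x \<le> t1 x"
    "\<And>x t. x \<in> gcone a (insert k I) \<Longrightarrow> 0 \<le> t \<Longrightarrow> x - t *\<^sub>R a k \<in> gcone a I \<longleftrightarrow> t0 x \<le> t \<and> t \<le> t1 x"
    using gcone_line_interval[where a = a and k = k, OF assms(1-3)] by metis
  have out: "((\<lambda>t. T (x - t *\<^sub>R a k)) has_integral 0) {0..}" if "x \<notin> gcone a (insert k I)" for x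
    using that gcone_add_ray[OF assms(1,2)] assms(5) by (intro has_integral_is_0) auto
  define J where "J x = integral {0..1} (\<lambda>u. T (x - (t0 x + u * (t1 x - t0 x)) *\<^sub>R a k))" for x
  have ins: "((\<lambda>t. T (x - t *\<^sub>R a k)) has_integral (t1 x - t0 x) * J x) {0..}"
    if x: "x \<in> gcone a (insert k I)" for x
  proof -
    let ?f = "\<lambda>t. T (x - t *\<^sub>R a k)"
    have in_cone: "x - s *\<^sub>R a k \<in> gcone a I" if "s \<in> {t0 x..t1 x}" for s
      using t(5)[OF x, of s] t(3)[of x] that by auto
    have "continuous_on {t0 x..t1 x} ?f"
      by (rule continuous_on_compose2[OF assms(4)]) (use in_cone in \<open>auto intro!: continuous_intros\<close>)
    then have i: "(?f has_integral integral {t0 x..t1 x} ?f) {t0 x..t1 x}"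
      by (intro integrable_integral integrable_continuous_real)
    have "integral {t0 x..t1 x} ?f = (t1 x - t0 x) * J x"
    proof (cases "t0 x = t1 x")
      case False
      define d where "d = t1 x - t0 x"
      have d: "0 < d" using False t(4)[OF x] by (simp add: d_def)
      have "((\<lambda>u. ?f (d *\<^sub>R u + t0 x)) has_integral integral {t0 x..t1 x} ?f /\<^sub>R d ^ DIM(real))
          (cbox ((t0 x - t0 x) /\<^sub>R d) ((t1 x - t0 x) /\<^sub>R d))"
        using i by (intro has_integral_affinity' d) simp
      then have "((\<lambda>u. ?f (t0 x + u * d)) has_integral integral {t0 x..t1 x} ?f / d) {0..1}"
        using d by (simp add: d_def[symmetric] divide_inverse mult.commute add.commute)
      then have "J x = integral {t0 x..t1 x} ?f / d"
        unfolding J_def d_def by (rule integral_unique)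
      then show ?thesis using d by (simp add: d_def[symmetric])
    qed simp
    then have "((\<lambda>s. if s \<in> {t0 x..t1 x} then ?f s else 0) has_integral (t1 x - t0 x) * J x) {0..}"
      using i t(3)[of x] by (subst has_integral_restrict) auto
    then show ?thesis
      by (rule has_integral_eq[rotated]) (use t(5)[OF x] assms(5) in auto)
  qed
  show "((\<lambda>t. T (x - t *\<^sub>R a k)) has_integral ray_integral (a k) T x) {0..}"
    using ins[of x] out[of x] unfolding ray_integral_def by (metis integral_unique)
  show "x \<notin> gcone a (insert k I) \<Longrightarrow> ray_integral (a k) T x = 0"
    using out[of x] unfolding ray_integral_def by (metis integral_unique)
  have "continuous_on (gcone a (insert k I)) (\<lambda>x. (t1 x - t0 x) * J x)"
  proof (intro continuous_on_mult continuous_on_diff)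
    have c: "continuous_on (gcone a (insert k I) \<times> {0..1}) (\<lambda>z. fst z - (t0 (fst z) + snd z * (t1 (fst z) - t0 (fst z))) *\<^sub>R a k)"
      by (intro continuous_intros continuous_on_compose2[OF t(1)] continuous_on_compose2[OF t(2)]) auto
    have "x - (t0 x + u * (t1 x - t0 x)) *\<^sub>R a k \<in> gcone a I"
      if "x \<in> gcone a (insert k I)" "0 \<le> u" "u \<le> 1" for x u
    proof -
      have le: "t0 x \<le> t1 x" by (rule t(4)[OF that(1)])
      then have "0 \<le> u * (t1 x - t0 x)" using that by simp
      moreover have "u * (t1 x - t0 x) \<le> 1 * (t1 x - t0 x)" using that le by (intro mult_right_mono) auto
      ultimately show ?thesis using t(3)[of x] by (subst t(5)[OF that(1)]) auto
    qed
    then have "continuous_on (gcone a (insert k I) \<times> cbox 0 1) (\<lambda>(x, u). T (x - (t0 x + u * (t1 x - t0 x)) *\<^sub>R a k))"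
      unfolding split_beta' by (intro continuous_on_compose2[OF assms(4)]) (use c in auto)
    then have "continuous_on (gcone a (insert k I)) (\<lambda>x. integral (cbox 0 1) (\<lambda>u. T (x - (t0 x + u * (t1 x - t0 x)) *\<^sub>R a k)))"
      by (rule integral_continuous_on_param)
    then show "continuous_on (gcone a (insert k I)) J" by (simp add: J_def[abs_def])
  qed (use t continuous_on_subset in blast)+
  moreover have "(t1 x - t0 x) * J x = ray_integral (a k) T x" if "x \<in> gcone a (insert k I)" for x
    using ins[OF that] unfolding ray_integral_def by (metis integral_unique)
  ultimately show "continuous_on (gcone a (insert k I)) (ray_integral (a k) T)"
    by (rule continuous_on_eq)
qed

text \<open>Tonelli with the new variable outermost, followed by a translation along
  \<open>a k\<close>. The second equation expresses the gauge integral in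
  \<open>ray_integral\<close> by a nonnegative one, for use in the scaling argument.\<close>

lemma spline_insert:
  fixes a :: "nat \<Rightarrow> 'a::euclidean_space"
  assumes "finite I" "k \<notin> I" "- a k \<notin> gcone a I" "spline a I T"
  shows "spline a (insert k I) (ray_integral (a k) T)"
    and "ennreal (ray_integral (a k) T x) = (\<integral>\<^sup>+t. indicator {0..} t * ennreal (T (x - t *\<^sub>R a k)) \<partial>lborel)"
proof -
  have T: "continuous_on (gcone a I) T" "\<And>x. x \<notin> gcone a I \<Longrightarrow> T x = 0" "\<And>x. 0 \<le> T x"
    and TI: "\<And>g. g \<in> borel_measurable borel \<Longrightarrow>
      (\<integral>\<^sup>+t. (\<Prod>i\<in>I. indicator {0..} (t i)) * g (\<Sum>i\<in>I. t i *\<^sub>R a i) \<partial>lprod I) =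
      (\<integral>\<^sup>+x. g x * ennreal (T x) \<partial>lborel)"
    using assms(4) by (auto simp: spline_def)
  note ray = ray_integral_cone[OF assms(1-3) T(1,2)]
  have [measurable]: "T \<in> borel_measurable borel" by (rule measurable_cone_supported[OF assms(1) T(1,2)])
  show nn: "ennreal (ray_integral (a k) T x) = (\<integral>\<^sup>+t. indicator {0..} t * ennreal (T (x - t *\<^sub>R a k)) \<partial>lborel)" for x
    using nn_integral_has_integral_lebesgue'[OF _ ray(1)[of x]] T(3) by (simp add: mult.commute)
  show "spline a (insert k I) (ray_integral (a k) T)"
    unfolding spline_def
  proof (intro conjI allI impI ballI ray)
    show "0 \<le> ray_integral (a k) T x" for x
      using has_integral_nonneg[OF ray(1)] T(3) by blast
    fix g :: "'a \<Rightarrow> ennreal" assume g[measurable]: "g \<in> borel_measurable borel"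
    have psf: "pair_sigma_finite (lborel :: 'a measure) (lborel :: real measure)" ..
    have "(\<integral>\<^sup>+t. (\<Prod>i\<in>insert k I. indicator {0..} (t i)) * g (\<Sum>i\<in>insert k I. t i *\<^sub>R a i) \<partial>lprod (insert k I)) =
        (\<integral>\<^sup>+y. indicator {0..} y * (\<integral>\<^sup>+t. (\<Prod>i\<in>I. indicator {0..} (t i)) * g ((\<Sum>i\<in>I. t i *\<^sub>R a i) + y *\<^sub>R a k) \<partial>lprod I) \<partial>lborel)"
      using nn_integral_comb_insert[OF assms(1,2) g, of "\<lambda>_. indicator {0..}" a] by simp
    also have "\<dots> = (\<integral>\<^sup>+y. indicator {0..} y * (\<integral>\<^sup>+x. g (x + y *\<^sub>R a k) * ennreal (T x) \<partial>lborel) \<partial>lborel)"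
      using TI[of "\<lambda>x. g (x + _ *\<^sub>R a k)"] by simp
    also have "\<dots> = (\<integral>\<^sup>+y. (\<integral>\<^sup>+x. indicator {0..} y * (g x * ennreal (T (x - y *\<^sub>R a k))) \<partial>lborel) \<partial>lborel)"
    proof (intro nn_integral_cong)
      fix y :: real
      have "(\<lambda>x. g x * ennreal (T (x - y *\<^sub>R a k))) \<in> borel_measurable borel" by measurable
      from nn_integral_lborel_shift[OF this, of "y *\<^sub>R a k"]
      have "(\<integral>\<^sup>+x. g (x + y *\<^sub>R a k) * ennreal (T x) \<partial>lborel) = (\<integral>\<^sup>+x. g x * ennreal (T (x - y *\<^sub>R a k)) \<partial>lborel)"
        by simp
      then show "indicator {0..} y * (\<integral>\<^sup>+x. g (x + y *\<^sub>R a k) * ennreal (T x) \<partial>lborel) =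
          (\<integral>\<^sup>+x. indicator {0..} y * (g x * ennreal (T (x - y *\<^sub>R a k))) \<partial>lborel)"
        by (simp add: nn_integral_cmult)
    qed
    also have "\<dots> = (\<integral>\<^sup>+x. (\<integral>\<^sup>+y. indicator {0..} y * (g x * ennreal (T (x - y *\<^sub>R a k))) \<partial>lborel) \<partial>lborel)"
      by (rule pair_sigma_finite.Fubini'[OF psf]) measurable
    also have "\<dots> = (\<integral>\<^sup>+x. g x * ennreal (ray_integral (a k) T x) \<partial>lborel)"
    proof (intro nn_integral_cong)
      fix x :: 'a
      have "(\<integral>\<^sup>+y. indicator {0..} y * (g x * ennreal (T (x - y *\<^sub>R a k))) \<partial>lborel) =
          (\<integral>\<^sup>+y. g x * (indicator {0..} y * ennreal (T (x - y *\<^sub>R a k))) \<partial>lborel)"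
        by (simp add: mult.left_commute)
      also have "\<dots> = g x * (\<integral>\<^sup>+y. indicator {0..} y * ennreal (T (x - y *\<^sub>R a k)) \<partial>lborel)"
        by (rule nn_integral_cmult) measurable
      finally show "(\<integral>\<^sup>+y. indicator {0..} y * (g x * ennreal (T (x - y *\<^sub>R a k))) \<partial>lborel) =
          g x * ennreal (ray_integral (a k) T x)" by (simp add: nn)
    qed
    finally show "(\<integral>\<^sup>+t. (\<Prod>i\<in>insert k I. indicator {0..} (t i)) * g (\<Sum>i\<in>insert k I. t i *\<^sub>R a i) \<partial>lprod (insert k I)) =
        (\<integral>\<^sup>+x. g x * ennreal (ray_integral (a k) T x) \<partial>lborel)" .
  qed
qed

section \<open>Piecewise polynomials, homogeneity and directions of constancy\<close>

abbreviation polys :: "('a::real_normed_vector \<Rightarrow> real) set" where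
  "polys \<equiv> Collect real_polynomial_function"

lemma gcone_add: "x \<in> gcone a I \<Longrightarrow> y \<in> gcone a I \<Longrightarrow> finite I \<Longrightarrow> x + y \<in> gcone a I"
  by (simp add: gcone_eq_hull convex_cone_hull_add)

lemma gcone_scale: "x \<in> gcone a I \<Longrightarrow> 0 \<le> c \<Longrightarrow> finite I \<Longrightarrow> c *\<^sub>R x \<in> gcone a I"
  by (simp add: gcone_eq_hull convex_cone_hull_mul)

lemma gcone_gen: "i \<in> I \<Longrightarrow> finite I \<Longrightarrow> a i \<in> gcone a I"
  by (simp add: gcone_eq_hull hull_inc)

lemma convex_gcone: "finite I \<Longrightarrow> convex (gcone a I)"
  by (simp add: gcone_eq_hull convex_convex_cone_hull)

text \<open>If two points of the line lay in one proper span, so would \<open>a k\<close>, and then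
  \<open>x\<close>. Finitely many exceptions do not affect an integral along the line.\<close>

lemma generic_line_finite:
  fixes a :: "nat \<Rightarrow> 'a::euclidean_space"
  assumes "finite I" "span (a ` I) = UNIV" "generic a (insert k I) x"
  shows "finite {t. \<not> generic a I (x - t *\<^sub>R a k)}"
proof -
  define \<J> where "\<J> = {J \<in> Pow I. span (a ` J) \<noteq> UNIV}"
  have U: "span (a ` insert k I) = UNIV"
    using span_mono[of "a ` I" "a ` insert k I"] assms(2) by auto
  have "finite {t. x - t *\<^sub>R a k \<in> span (a ` J)}" if "J \<in> \<J>" for J
  proof -
    have xJ: "x \<notin> span (a ` J)"
      using that assms(3) U unfolding generic_def \<J>_def by auto
    have "t = s" if ts: "x - t *\<^sub>R a k \<in> span (a ` J)" "x - s *\<^sub>R a k \<in> span (a ` J)" for t s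
    proof (rule ccontr)
      assume "t \<noteq> s"
      have "(x - t *\<^sub>R a k) - (x - s *\<^sub>R a k) \<in> span (a ` J)" using ts by (rule span_diff)
      then have "(s - t) *\<^sub>R a k \<in> span (a ` J)" by (simp add: algebra_simps)
      then have "inverse (s - t) *\<^sub>R (s - t) *\<^sub>R a k \<in> span (a ` J)" by (rule span_scale)
      moreover have "inverse (s - t) *\<^sub>R (s - t) *\<^sub>R a k = a k" using \<open>t \<noteq> s\<close> by simp
      ultimately have "t *\<^sub>R a k \<in> span (a ` J)" by (metis span_scale)
      then have "(x - t *\<^sub>R a k) + t *\<^sub>R a k \<in> span (a ` J)" using ts(1) by (intro span_add)
      then show False using xJ by simp
    qed
    then have "\<exists>s. {t. x - t *\<^sub>R a k \<in> span (a ` J)} \<subseteq> {s}" by blast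
    then show ?thesis using finite_subset by blast
  qed
  moreover have "finite \<J>" using assms(1) by (simp add: \<J>_def)
  moreover have "{t. \<not> generic a I (x - t *\<^sub>R a k)} \<subseteq> (\<Union>J\<in>\<J>. {t. x - t *\<^sub>R a k \<in> span (a ` J)})"
    using assms(2) by (auto simp: generic_def \<J>_def)
  ultimately show ?thesis by (meson finite_UN_I finite_subset)
qed

text \<open>Over each piece the integral is a difference of values of an antiderivative at the
  crossing times. These times are linear in \<open>x\<close>, so the values are polynomials; the
  signs of entry and exit attach them to the exchanged cones.\<close>

lemma ray_integral_piecewise:
  fixes a :: "nat \<Rightarrow> 'a::euclidean_space"
  assumes "finite I" "k \<notin> I" "- a k \<notin> gcone a I" "span (a ` I) = UNIV"
    and "conic_comb polys a (bases a I) {x. generic a I x} T"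
  shows "conic_comb polys a (bases a (insert k I)) {x. generic a (insert k I) x} (ray_integral (a k) T)"
proof -
  obtain q where q: "\<And>b. b \<in> bases a I \<Longrightarrow> real_polynomial_function (q b)"
    "\<And>x. generic a I x \<Longrightarrow> T x = (\<Sum>b\<in>bases a I. if x \<in> gcone a b then q b x else 0)"
    using assms(5) unfolding conic_comb_def by auto
  have "\<forall>b\<in>bases a I. \<exists>nr. (\<forall>i. real_polynomial_function (snd nr i)) \<and>
      (\<forall>x t. q b (x + t *\<^sub>R (- a k)) = (\<Sum>i\<le>(fst nr::nat). t ^ i * snd nr i x))"
    using poly_along_line[OF q(1), of _ "- a k"] by simp
  from bchoice[OF this] obtain nr where nr: "\<And>b i. b \<in> bases a I \<Longrightarrow> real_polynomial_function (snd (nr b) i)"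
      "\<And>b x t. b \<in> bases a I \<Longrightarrow> q b (x + t *\<^sub>R (- a k)) = (\<Sum>i\<le>fst (nr b). t ^ i * snd (nr b) i x)"
    by blast
  \<comment> \<open>Antiderivative in \<open>t\<close> of \<open>q b\<close> along the ray,
    normalised to vanish at 0: a ray starting inside the cone then contributes its exit
    only.\<close>
  define G where "G b x t = (\<Sum>i\<le>fst (nr b). t ^ Suc i / Suc i * snd (nr b) i x)" for b x t
  have G0: "G b x 0 = 0" for b x by (simp add: G_def)
  have Gd: "((\<lambda>t. G b x t) has_real_derivative q b (x - t *\<^sub>R a k)) (at t within A)"
    if "b \<in> bases a I" for b x t A
  proof -
    have "((\<lambda>t. t ^ Suc i / Suc i * c) has_real_derivative t ^ i * c) (at t within A)" for i c
    proof -
      fix i c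
      have "((\<lambda>t. t ^ Suc i) has_real_derivative real (Suc i) * t ^ i) (at t within A)"
        using DERIV_pow[of "Suc i" t A] by simp
      from DERIV_cmult_right[OF DERIV_cdivide[OF this, of "real (Suc i)"], of c]
      show "((\<lambda>t. t ^ Suc i / Suc i * c) has_real_derivative t ^ i * c) (at t within A)" by simp
    qed
    then have "((\<lambda>t. G b x t) has_real_derivative (\<Sum>i\<le>fst (nr b). t ^ i * snd (nr b) i x)) (at t within A)"
      unfolding G_def by (intro DERIV_sum)
    then show ?thesis using nr(2)[OF that, of x t] by simp
  qed
  have U: "span (a ` insert k I) = UNIV"
    using span_mono[of "a ` I" "a ` insert k I"] assms(4) by auto
  have bases_ins: "b \<in> bases a (insert k I)" if "b \<in> bases a I" for b
    using that U assms(4) by (auto simp: bases_def)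
  have npos: "- a k \<notin> gcone a b" if "b \<in> bases a I" for b
    using that gcone_mono[OF _ assms(1), of b a] assms(3) by (auto simp: bases_def)
  let ?l = "\<lambda>b j. coord a b (a k) j"
  have bint: "((\<lambda>t. if x - t *\<^sub>R a k \<in> gcone a b then q b (x - t *\<^sub>R a k) else 0) has_integral
      (\<Sum>j\<in>b. if x \<in> gcone a (insert k (b - {j})) then sgn (?l b j) * G b x (coord a b x j / ?l b j) else 0)) {0..}"
    if x: "generic a (insert k I) x" and b: "b \<in> bases a I" for x b
  proof -
    define S where "S = {t. 0 \<le> t \<and> x - t *\<^sub>R a k \<in> gcone a b}"
    define E where "E = {j\<in>b. ?l b j \<noteq> 0 \<and> x \<in> gcone a (insert k (b - {j}))}"
    have ftc: "((\<lambda>t. if t \<in> {l..u} then q b (x - t *\<^sub>R a k) else 0) has_integral (G b x u - G b x l)) {0..}"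
      if "0 \<le> l" "l \<le> u" for l u
    proof -
      have "((\<lambda>t. q b (x - t *\<^sub>R a k)) has_integral (G b x u - G b x l)) {l..u}"
        using Gd[OF b] \<open>l \<le> u\<close>
        by (intro fundamental_theorem_of_calculus) (auto simp: has_real_derivative_iff_has_vector_derivative[symmetric])
      then show ?thesis using that by (subst has_integral_restrict) auto
    qed
    have eq: "((\<lambda>t. if x - t *\<^sub>R a k \<in> gcone a b then q b (x - t *\<^sub>R a k) else 0) has_integral y) {0..}"
      if "((\<lambda>t. if t \<in> S then q b (x - t *\<^sub>R a k) else 0) has_integral y) {0..}" for y
      using that by (rule has_integral_eq[rotated]) (auto simp: S_def)
    have "(\<Sum>j\<in>b. if x \<in> gcone a (insert k (b - {j})) then sgn (?l b j) * G b x (coord a b x j / ?l b j) else 0)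
        = (\<Sum>j\<in>E. sgn (?l b j) * G b x (coord a b x j / ?l b j))"
      unfolding E_def by (rule gcone_crossing_sum[OF x bases_ins[OF b] insertI1 npos[OF b]])
    moreover have "((\<lambda>t. if t \<in> S then q b (x - t *\<^sub>R a k) else 0) has_integral
        (\<Sum>j\<in>E. sgn (?l b j) * G b x (coord a b x j / ?l b j))) {0..}"
      using gcone_crossing[OF x bases_ins[OF b] insertI1 npos[OF b]]
      unfolding S_def[symmetric] E_def[symmetric]
    proof (elim disjE exE conjE)
      fix j assume j: "E = {j}" "0 < ?l b j" "0 < coord a b x j / ?l b j" "S = {0..coord a b x j / ?l b j}"
      show ?thesis unfolding j(1,4) using ftc[of 0 "coord a b x j / ?l b j"] j G0 by simp
    next
      fix j i assume j: "E = {j, i}" "j \<noteq> i" "0 < ?l b j" "?l b i < 0" "0 < coord a b x i / ?l b i"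
        "coord a b x i / ?l b i < coord a b x j / ?l b j" "S = {coord a b x i / ?l b i..coord a b x j / ?l b j}"
      show ?thesis unfolding j(1,7)
        using ftc[of "coord a b x i / ?l b i" "coord a b x j / ?l b j"] j(2-6) by simp
    qed simp
    ultimately show ?thesis using eq by simp
  qed
  have val: "ray_integral (a k) T x = (\<Sum>b\<in>bases a I. \<Sum>j\<in>b.
      if x \<in> gcone a (insert k (b - {j})) then sgn (?l b j) * G b x (coord a b x j / ?l b j) else 0)"
    if x: "generic a (insert k I) x" for x
  proof -
    have "((\<lambda>t. T (x - t *\<^sub>R a k)) has_integral (\<Sum>b\<in>bases a I. \<Sum>j\<in>b.
      if x \<in> gcone a (insert k (b - {j})) then sgn (?l b j) * G b x (coord a b x j / ?l b j) else 0)) {0..}"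
      by (rule has_integral_spike_finite[OF generic_line_finite[OF assms(1,4) x] _
            has_integral_sum[OF finite_bases[OF assms(1)] bint[OF x]]])
        (use q(2) in auto)
    then show ?thesis unfolding ray_integral_def by (rule integral_unique)
  qed
  have K0: "(\<lambda>_. 0) \<in> polys" and Kadd: "\<And>f g. f \<in> polys \<Longrightarrow> g \<in> polys \<Longrightarrow> (\<lambda>x. f x + g x) \<in> polys"
    by auto
  have "conic_comb polys a (bases a (insert k I)) {x. generic a (insert k I) x} (\<lambda>x. \<Sum>b\<in>bases a I. \<Sum>j\<in>b.
      if x \<in> gcone a (insert k (b - {j})) then sgn (?l b j) * G b x (coord a b x j / ?l b j) else 0)"
  proof (intro conic_comb_sum[OF Kadd K0] finite_bases[OF assms(1)])
    fix b assume b: "b \<in> bases a I"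
    have bb: "b \<subseteq> I" "lin_indep a b" "span (a ` b) = UNIV" using b assms(4) by (auto simp: bases_def)
    show "finite b" using bb by (simp add: lin_indep_def)
    fix j assume j: "j \<in> b"
    show "conic_comb polys a (bases a (insert k I)) {x. generic a (insert k I) x}
        (\<lambda>x. if x \<in> gcone a (insert k (b - {j})) then sgn (?l b j) * G b x (coord a b x j / ?l b j) else 0)"
    proof (cases "?l b j = 0")
      case True
      then show ?thesis by (intro conic_comb_cong[OF conic_comb_zero]) (auto simp: K0)
    next
      case False
      have ks: "a k \<in> span (a ` b)" using bb by simp
      have "insert k (b - {j}) \<in> bases a (insert k I)"
        using exchange[OF bb(2) j ks False] bb U by (auto simp: bases_def)
      moreover have "real_polynomial_function (\<lambda>x. coord a b x j)"
        using linear_coord[OF bb(2) j bb(3)] by (simp add: linear_conv_bounded_linear real_polynomial_function.intros(1))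
      then have "real_polynomial_function (\<lambda>x. sgn (?l b j) * G b x (coord a b x j / ?l b j))"
        unfolding G_def using nr(1)[OF b]
        by (intro real_polynomial_function.intros(2,4) real_polynomial_function_sum
            real_polynomial_function_divide real_polynomial_function_power) auto
      ultimately show ?thesis
        using assms(1) by (intro conic_comb_single K0 finite_bases) auto
    qed
  qed
  then show ?thesis by (rule conic_comb_cong) (use val in auto)
qed

text \<open>The substitution of \<open>s * t\<close> for \<open>t\<close> contributes the additional
  factor \<open>s\<close>.\<close>

lemma ray_integral_scale:
  fixes a :: "nat \<Rightarrow> 'a::euclidean_space"
  assumes "finite I" "k \<notin> I" "- a k \<notin> gcone a I" "spline a I T"
    and "0 < s" "\<And>x. T (s *\<^sub>R x) = s ^ d * T x"
  shows "ray_integral (a k) T (s *\<^sub>R x) = s ^ Suc d * ray_integral (a k) T x"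
proof -
  have T: "continuous_on (gcone a I) T" "\<And>x. x \<notin> gcone a I \<Longrightarrow> T x = 0" "\<And>x. 0 \<le> T x"
    using assms(4) by (auto simp: spline_def)
  have [measurable]: "T \<in> borel_measurable borel" by (rule measurable_cone_supported[OF assms(1) T(1,2)])
  note nn = spline_insert(2)[OF assms(1-4)]
  have pos: "0 \<le> ray_integral (a k) T x" for x
    using spline_insert(1)[OF assms(1-4)] by (simp add: spline_def)
  have "ennreal (ray_integral (a k) T (s *\<^sub>R x)) =
      ennreal \<bar>s\<bar> * (\<integral>\<^sup>+t. indicator {0..} (0 + s * t) * ennreal (T (s *\<^sub>R x - (0 + s * t) *\<^sub>R a k)) \<partial>lborel)"
    unfolding nn by (rule nn_integral_real_affine) (measurable, use assms(5) in simp)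
  also have "\<dots> = ennreal s * (\<integral>\<^sup>+t. ennreal (s ^ d) * (indicator {0..} t * ennreal (T (x - t *\<^sub>R a k))) \<partial>lborel)"
  proof -
    have "T (s *\<^sub>R x - (s * t) *\<^sub>R a k) = s ^ d * T (x - t *\<^sub>R a k)" for t
      using assms(6)[of "x - t *\<^sub>R a k"] by (simp add: scaleR_diff_right)
    moreover have "indicator {0..} (s * t) = (indicator {0..} t :: ennreal)" for t
      using assms(5) by (auto simp: indicator_def zero_le_mult_iff)
    ultimately show ?thesis
      using assms(5) T(3) by (simp add: ennreal_mult mult_ac)
  qed
  also have "\<dots> = ennreal s * (ennreal (s ^ d) * ennreal (ray_integral (a k) T x))"
    unfolding nn by (subst nn_integral_cmult) measurable
  also have "\<dots> = ennreal (s ^ Suc d * ray_integral (a k) T x)"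
    using assms(5) pos by (simp add: ennreal_mult mult_ac)
  finally show ?thesis using pos assms(5) by (simp del: power_Suc)
qed

text \<open>If dropping \<open>j\<close> destroys spanning, then \<open>a k\<close> lies in the span
  of the vectors of \<open>I\<close> other than \<open>a j\<close>. So \<open>j\<close> has the same
  property in \<open>I\<close>, and the cone is a product with the half-line along
  \<open>a j\<close>; rays in direction \<open>a k\<close> are parallel to the base of this
  product.\<close>

lemma ray_integral_coloop:
  fixes a :: "nat \<Rightarrow> 'a::euclidean_space"
  assumes "finite I" "k \<notin> I" "span (a ` I) = UNIV" "\<And>x. x \<notin> gcone a I \<Longrightarrow> T x = 0"
    and "j \<in> insert k I" "span (a ` (insert k I - {j})) \<noteq> UNIV"
    and "\<And>x s. j \<in> I \<Longrightarrow> span (a ` (I - {j})) \<noteq> UNIV \<Longrightarrow> x \<in> gcone a I \<Longrightarrow> 0 \<le> s \<Longrightarrow> T (x + s *\<^sub>R a j) = T x"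
    and "x \<in> gcone a (insert k I)" "0 \<le> s"
  shows "ray_integral (a k) T (x + s *\<^sub>R a j) = ray_integral (a k) T x"
proof -
  have jk: "j \<noteq> k" using assms(2,3,6) by auto
  then have jI: "j \<in> I" using assms(5) by simp
  define c where "c = I - {j}"
  have c: "I = insert j c" "j \<notin> c" "finite c" using jI assms(1) by (auto simp: c_def)
  have ins: "insert k I - {j} = insert k c" "insert k I = insert j (insert k c)" "j \<notin> insert k c"
    using jk jI by (auto simp: c_def)
  define H where "H = span (a ` insert k c)"
  have HU: "H \<noteq> UNIV" using assms(6) ins by (simp add: H_def)
  have jH: "a j \<notin> H"
  proof
    assume "a j \<in> H"
    then have "a ` I \<subseteq> H" unfolding c(1) H_def by (auto intro: span_base)
    then have "span (a ` I) \<subseteq> H" unfolding H_def by (intro span_minimal) auto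
    then show False using assms(3) HU by auto
  qed
  have Hc: "H = span (a ` c)"
  proof (rule subspace_insert_eq[OF _ _ jH])
    show "a ` c \<subseteq> H" unfolding H_def by (auto intro: span_base)
    show "H \<subseteq> span (insert (a j) (a ` c))" using assms(3) c(1) by simp
  qed (simp add: H_def)
  have cU: "span (a ` (I - {j})) \<noteq> UNIV" using Hc HU by (simp add: c_def)
  have kH: "a k \<in> H" by (auto simp: H_def intro: span_base)
  obtain h r where hr: "x = h + r *\<^sub>R a j" "h \<in> gcone a (insert k c)" "0 \<le> r"
    using assms(8) gcone_insert[OF _ ins(3), of a] c(3) unfolding ins(2) by auto
  have hH: "h \<in> H" using hr(2) gcone_subset_span[of "insert k c" a] c(3) by (auto simp: H_def)
  have "T (x + s *\<^sub>R a j - t *\<^sub>R a k) = T (x - t *\<^sub>R a k)" if "0 \<le> t" for t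
  proof (cases "x - t *\<^sub>R a k \<in> gcone a I")
    case True
    have "x + s *\<^sub>R a j - t *\<^sub>R a k = (x - t *\<^sub>R a k) + s *\<^sub>R a j" by simp
    then show ?thesis using assms(7)[OF jI cU True assms(9)] by metis
  next
    case False
    have hs: "h - t *\<^sub>R a k \<in> span (a ` c)"
      using hH kH unfolding Hc by (intro span_diff span_scale)
    \<comment> \<open>Membership in the cone does not depend on the height along \<open>a j\<close>
      as long as it is nonnegative; both \<open>r\<close> and \<open>r + s\<close> are, so the two
      points lie outside together.\<close>
    have iff: "(h - t *\<^sub>R a k) + u *\<^sub>R a j \<in> gcone a I \<longleftrightarrow> h - t *\<^sub>R a k \<in> gcone a c \<and> 0 \<le> u" for u
      unfolding c(1) using gcone_insert_iff[OF c(3) hs] jH Hc by simp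
    have "x - t *\<^sub>R a k = (h - t *\<^sub>R a k) + r *\<^sub>R a j" using hr(1) by simp
    then have "h - t *\<^sub>R a k \<notin> gcone a c" using False iff[of r] hr(3) by metis
    moreover have "x + s *\<^sub>R a j - t *\<^sub>R a k = (h - t *\<^sub>R a k) + (r + s) *\<^sub>R a j"
      using hr(1) by (simp add: algebra_simps)
    ultimately have "x + s *\<^sub>R a j - t *\<^sub>R a k \<notin> gcone a I" using iff[of "r + s"] by metis
    then show ?thesis using assms(4) False by simp
  qed
  then show ?thesis unfolding ray_integral_def by (intro integral_cong) auto
qed

text \<open>The properties of the spline that adding a vector preserves. The last one, constancy
  along a vector whose removal destroys spanning, is where a chain of cocircuit derivatives ends.
  The subtraction of natural numbers is exact for spanning \<open>I\<close>, by
  \<open>card_spanning\<close>.\<close>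

definition cone_spline :: "(nat \<Rightarrow> 'a::euclidean_space) \<Rightarrow> nat set \<Rightarrow> ('a \<Rightarrow> real) \<Rightarrow> bool" where
  "cone_spline a I T \<longleftrightarrow> spline a I T \<and> conic_comb polys a (bases a I) {x. generic a I x} T \<and>
    (\<forall>s>0. \<forall>x. T (s *\<^sub>R x) = s ^ (card I - DIM('a)) * T x) \<and>
    (\<forall>j\<in>I. span (a ` (I - {j})) \<noteq> UNIV \<longrightarrow> (\<forall>x\<in>gcone a I. \<forall>s\<ge>0. T (x + s *\<^sub>R a j) = T x))"

section \<open>Existence by adding vectors to a basis\<close>

lemma lin_indep_iff:
  "lin_indep a b \<longleftrightarrow> finite b \<and> inj_on a b \<and> independent (a ` b)"
proof (cases "finite b")
  case True
  then show ?thesis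
  proof (induction b)
    case (insert k b)
    have "inj_on a (insert k b) \<and> independent (a ` insert k b) \<longleftrightarrow>
        inj_on a b \<and> independent (a ` b) \<and> a k \<notin> span (a ` b)"
    proof
      assume *: "inj_on a (insert k b) \<and> independent (a ` insert k b)"
      then have "a k \<notin> a ` b" using insert.hyps by auto
      then show "inj_on a b \<and> independent (a ` b) \<and> a k \<notin> span (a ` b)"
        using * by (auto simp: independent_insert)
    next
      assume *: "inj_on a b \<and> independent (a ` b) \<and> a k \<notin> span (a ` b)"
      then have "a k \<notin> a ` b" by (auto intro: span_base)
      then show "inj_on a (insert k b) \<and> independent (a ` insert k b)"
        using * by (auto simp: independent_insert)
    qed
    then show ?case using lin_indep_insert[OF insert.hyps(2), of a] insert by auto
  qed (simp add: lin_indep_def independent_empty)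
qed (simp add: lin_indep_def)

lemma card_basis:
  fixes a :: "nat \<Rightarrow> 'a::euclidean_space"
  assumes "lin_indep a b" "span (a ` b) = UNIV"
  shows "card b = DIM('a)"
proof -
  have "card (a ` b) = dim (span (a ` b))"
    using assms(1) by (simp add: lin_indep_iff dim_eq_card_independent)
  then show ?thesis using assms by (simp add: lin_indep_iff card_image)
qed

lemma card_spanning:
  fixes a :: "nat \<Rightarrow> 'a::euclidean_space"
  assumes "finite I" "span (a ` I) = UNIV"
  shows "DIM('a) \<le> card I"
proof -
  have "dim (span (a ` I)) \<le> card (a ` I)" using assms(1) by (simp add: dim_le_card')
  also have "\<dots> \<le> card I" by (rule card_image_le[OF assms(1)])
  finally show ?thesis using assms(2) by simp
qed

lemma dependent_remove:
  assumes "finite I" "\<not> lin_indep a I"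
  shows "\<exists>k\<in>I. span (a ` (I - {k})) = span (a ` I)"
proof -
  obtain u k where u: "(\<Sum>i\<in>I. u i *\<^sub>R a i) = 0" "k \<in> I" "u k \<noteq> 0"
    using assms by (auto simp: lin_indep_def)
  have "u k *\<^sub>R a k = - (\<Sum>i\<in>I-{k}. u i *\<^sub>R a i)"
    using u(1) sum.remove[OF assms(1) u(2), of "\<lambda>i. u i *\<^sub>R a i"] by (simp add: eq_neg_iff_add_eq_0)
  also have "\<dots> \<in> span (a ` (I - {k}))" by (intro span_neg span_sum span_scale span_base) auto
  finally have "inverse (u k) *\<^sub>R (u k *\<^sub>R a k) \<in> span (a ` (I - {k}))" by (rule span_scale)
  then have "a k \<in> span (a ` (I - {k}))" using u(3) by simp
  moreover have "a ` I = insert (a k) (a ` (I - {k}))" using u(2) by auto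
  ultimately show ?thesis using u(2) by (metis span_redundant)
qed

lemma cone_spline_insert:
  fixes a :: "nat \<Rightarrow> 'a::euclidean_space"
  assumes "finite I" "k \<notin> I" "- a k \<notin> gcone a I" "span (a ` I) = UNIV" "cone_spline a I T"
  shows "cone_spline a (insert k I) (ray_integral (a k) T)"
proof -
  have sp: "spline a I T" using assms(5) by (simp add: cone_spline_def)
  show ?thesis
    unfolding cone_spline_def
  proof (intro conjI allI impI ballI)
    show "spline a (insert k I) (ray_integral (a k) T)" by (rule spline_insert(1)[OF assms(1-3) sp])
    show "conic_comb polys a (bases a (insert k I)) {x. generic a (insert k I) x} (ray_integral (a k) T)"
      by (rule ray_integral_piecewise) (use assms in \<open>auto simp: cone_spline_def\<close>)
  next
    fix s :: real and x :: 'a assume "0 < s"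
    then have "ray_integral (a k) T (s *\<^sub>R x) = s ^ Suc (card I - DIM('a)) * ray_integral (a k) T x"
      by (rule ray_integral_scale[OF assms(1-3) sp]) (use assms(5) \<open>0 < s\<close> in \<open>simp add: cone_spline_def\<close>)
    moreover have "Suc (card I - DIM('a)) = card (insert k I) - DIM('a)"
      using card_spanning[OF assms(1,4)] assms(1,2) by simp
    ultimately show "ray_integral (a k) T (s *\<^sub>R x) = s ^ (card (insert k I) - DIM('a)) * ray_integral (a k) T x"
      by simp
  next
    fix j x and s :: real
    assume j: "j \<in> insert k I" "span (a ` (insert k I - {j})) \<noteq> UNIV" "x \<in> gcone a (insert k I)" "0 \<le> s"
    show "ray_integral (a k) T (x + s *\<^sub>R a j) = ray_integral (a k) T x"
    proof (rule ray_integral_coloop[OF assms(1,2,4) _ j(1,2) _ j(3,4)])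
      show "x \<notin> gcone a I \<Longrightarrow> T x = 0" for x using sp by (simp add: spline_def)
      show "j \<in> I \<Longrightarrow> span (a ` (I - {j})) \<noteq> UNIV \<Longrightarrow> x \<in> gcone a I \<Longrightarrow> 0 \<le> s \<Longrightarrow> T (x + s *\<^sub>R a j) = T x" for x s
        using assms(5) by (simp add: cone_spline_def)
    qed
  qed
qed

text \<open>The vector split off is one whose removal keeps the span, and such a vector exists as
  long as the family is dependent. For a basis the exponent \<open>card I - DIM('a)\<close> is 0, in
  accordance with a constant density.\<close>

lemma cone_spline_exists:
  fixes a :: "nat \<Rightarrow> 'a::euclidean_space"
  assumes "finite I" "pointed a I" "span (a ` I) = UNIV"
  shows "\<exists>T. cone_spline a I T"
  using assms
proof (induction "card I" arbitrary: I rule: less_induct)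
  case less
  show ?case
  proof (cases "lin_indep a I")
    case True
    obtain K where K: "0 < K" "spline a I (\<lambda>x. if x \<in> gcone a I then K else 0)"
      using spline_basis[OF True less.prems(3)] by blast
    have "cone_spline a I (\<lambda>x. if x \<in> gcone a I then K else 0)"
      unfolding cone_spline_def
    proof (intro conjI allI impI ballI K(2))
      have "I \<in> bases a I" using True by (simp add: bases_def)
      then show "conic_comb polys a (bases a I) {x. generic a I x} (\<lambda>x. if x \<in> gcone a I then K else 0)"
        using finite_bases[OF less.prems(1)] by (intro conic_comb_single) auto
    next
      fix s :: real and x :: 'a assume "0 < s"
      then have "s *\<^sub>R x \<in> gcone a I \<longleftrightarrow> x \<in> gcone a I"
        using gcone_scale[of x a I s] gcone_scale[of "s *\<^sub>R x" a I "inverse s"] less.prems(1) by auto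
      then show "(if s *\<^sub>R x \<in> gcone a I then K else 0) = s ^ (card I - DIM('a)) * (if x \<in> gcone a I then K else 0)"
        using card_basis[OF True less.prems(3)] by simp
    next
      fix j x and s :: real assume "j \<in> I" "x \<in> gcone a I" "0 \<le> s"
      then have "x + s *\<^sub>R a j \<in> gcone a I" using less.prems(1) by (intro gcone_add gcone_scale gcone_gen)
      then show "(if x + s *\<^sub>R a j \<in> gcone a I then K else 0) = (if x \<in> gcone a I then K else 0)"
        using \<open>x \<in> gcone a I\<close> by simp
    qed
    then show ?thesis by blast
  next
    case False
    then obtain k where k: "k \<in> I" "span (a ` (I - {k})) = span (a ` I)"
      using dependent_remove[OF less.prems(1)] by blast
    define J where "J = I - {k}"
    have J: "finite J" "k \<notin> J" "insert k J = I" "J \<subseteq> I" using k less.prems by (auto simp: J_def)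
    have "card J < card I" unfolding J_def by (rule card_Diff1_less[OF less.prems(1) k(1)])
    then obtain T where "cone_spline a J T"
      using less.hyps[of J] J k less.prems pointed_mono[OF less.prems(2) J(4)] by (auto simp: J_def)
    moreover have "- a k \<notin> gcone a J"
      using less.prems k gcone_mono[OF J(4) less.prems(1), of a] by (auto simp: pointed_def)
    ultimately have "cone_spline a I (ray_integral (a k) T)"
      using cone_spline_insert[OF J(1,2)] k less.prems(3) J by (simp add: J_def)
    then show ?thesis by blast
  qed
qed

text \<open>Substituting \<open>u = s - t\<close> turns the integral into that of \<open>g\<close>
  up to \<open>s\<close>, and the fundamental theorem applies at a point of continuity.\<close>

lemma ray_integral_derivative:
  fixes a :: "nat \<Rightarrow> 'a::euclidean_space"
  assumes "finite I" "k \<notin> I" "- a k \<notin> gcone a I"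
    and "continuous_on (gcone a I) T" "\<And>x. x \<notin> gcone a I \<Longrightarrow> T x = 0" "isCont T y"
  shows "((\<lambda>s. ray_integral (a k) T (y + s *\<^sub>R a k)) has_real_derivative T y) (at 0)"
proof -
  note ray = ray_integral_cone[OF assms(1-5)]
  define g where "g u = T (y + u *\<^sub>R a k)" for u
  \<comment> \<open>The condition on \<open>- a k\<close> makes the ray leave the cone for good, so
    the lower limit of integration may be taken finite.\<close>
  have "\<exists>L\<ge>0. \<forall>t\<ge>L. T (y - t *\<^sub>R a k) = 0"
  proof (cases "y \<in> gcone a (insert k I)")
    case True
    obtain t0 t1 :: "'a \<Rightarrow> real" where t:
      "\<And>t. 0 \<le> t \<Longrightarrow> y - t *\<^sub>R a k \<in> gcone a I \<longleftrightarrow> t0 y \<le> t \<and> t \<le> t1 y"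
      using gcone_line_interval[where a = a and k = k, OF assms(1-3)] True by metis
    show ?thesis
    proof (intro exI[of _ "max 0 (t1 y) + 1"] conjI allI impI assms(5))
      fix s assume "max 0 (t1 y) + 1 \<le> s"
      then show "y - s *\<^sub>R a k \<notin> gcone a I" using t[of s] by auto
    qed simp
  next
    case False
    then show ?thesis using gcone_add_ray[OF assms(1,2)] assms(5) by (intro exI[of _ 0]) auto
  qed
  then obtain L where L: "0 \<le> L" "\<And>t. L \<le> t \<Longrightarrow> T (y - t *\<^sub>R a k) = 0" by blast
  \<comment> \<open>The 1 leaves room for \<open>s\<close> down to -1, so that 0 is interior to the
    range of \<open>s\<close>, while \<open>g\<close> vanishes below \<open>- M\<close>.\<close>
  define M where "M = L + 1"
  have gz: "g u = 0" if "u \<le> -L" for u using L(2)[of "-u"] that by (simp add: g_def)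
  have rep: "ray_integral (a k) T (y + s *\<^sub>R a k) = integral {-M..s} g \<and> g integrable_on {-M..s}" if s: "-1 \<le> s" for s
  proof -
    have h: "((\<lambda>t. g (s - t)) has_integral ray_integral (a k) T (y + s *\<^sub>R a k)) {0..}"
      using ray(1)[of "y + s *\<^sub>R a k"] by (simp add: g_def algebra_simps)
    have sM: "0 \<le> s + M" using s L by (simp add: M_def)
    have "((\<lambda>t. if t \<in> {0..s + M} then g (s - t) else 0) has_integral ray_integral (a k) T (y + s *\<^sub>R a k)) {0..}"
      using h by (rule has_integral_eq[rotated]) (use gz in \<open>auto simp: M_def\<close>)
    then have "((\<lambda>t. g (s - t)) has_integral ray_integral (a k) T (y + s *\<^sub>R a k)) {0..s + M}"
      by (subst (asm) has_integral_restrict) auto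
    then have "((\<lambda>t. g (s + (- t))) has_integral ray_integral (a k) T (y + s *\<^sub>R a k)) {-0..-(-(s + M))}"
      by (simp add: add.commute)
    then have "((\<lambda>t. g (t + s)) has_integral ray_integral (a k) T (y + s *\<^sub>R a k)) {-(s + M)..0}"
      by (subst (asm) has_integral_reflect_real[where f = "\<lambda>t. g (s + t)"]) (simp add: add.commute)
    then have "((\<lambda>t. g (t + s)) has_integral ray_integral (a k) T (y + s *\<^sub>R a k)) {-M - s..s - s}"
      by (simp add: algebra_simps)
    then have "(g has_integral ray_integral (a k) T (y + s *\<^sub>R a k)) {-M..s}"
      by (subst has_integral_shift_real_ivl_iff[of _ _ _ _ s])
    then show ?thesis by (auto simp: integral_unique)
  qed
  have "continuous (at 0) g"
  proof -
    have "continuous (at 0) (\<lambda>u::real. y + u *\<^sub>R a k)" by (intro continuous_intros)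
    then show ?thesis using assms(6) isCont_o2[of 0 "\<lambda>u::real. y + u *\<^sub>R a k" T] by (simp add: g_def[abs_def])
  qed
  then have "((\<lambda>u. integral {-M..u} g) has_vector_derivative g 0) (at 0 within ({-M..1} - {}))"
    using rep[of 1] L by (intro integral_has_vector_derivative_continuous_at)
      (auto simp: M_def continuous_at_imp_continuous_at_within)
  then have "((\<lambda>u. integral {-M..u} g) has_vector_derivative g 0) (at 0 within {-1<..<1})"
    by (rule has_vector_derivative_within_subset) (use L in \<open>auto simp: M_def\<close>)
  then have "((\<lambda>u. integral {-M..u} g) has_real_derivative g 0) (at 0)"
    by (subst (asm) has_vector_derivative_within_open)
      (auto simp: has_real_derivative_iff_has_vector_derivative)
  moreover have "g 0 = T y" by (simp add: g_def)
  ultimately have "((\<lambda>u. integral {-M..u} g) has_real_derivative T y) (at 0)" by simp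
  then show ?thesis
    by (rule has_field_derivative_transform_within_open[where S = "{-1<..<1}"]) (use rep in auto)
qed

section \<open>Uniqueness and local structure of the spline\<close>

lemma gcone_interior_nonempty:
  fixes a :: "nat \<Rightarrow> 'a::euclidean_space"
  assumes "finite I" "span (a ` I) = UNIV"
  shows "interior (gcone a I) \<noteq> {}"
proof
  assume "interior (gcone a I) = {}"
  then obtain n d where n: "n \<noteq> 0" "gcone a I \<subseteq> {x. n \<bullet> x = d}"
    using empty_interior_subset_hyperplane[OF convex_gcone[OF assms(1)]] by metis
  then have "d = 0" using zero_in_gcone[of a I] by auto
  then have "a ` I \<subseteq> {x. n \<bullet> x = 0}" using n gcone_gen[OF _ assms(1), of _ a] by auto
  then have "span (a ` I) \<subseteq> {x. n \<bullet> x = 0}" by (rule span_minimal) (rule subspace_hyperplane)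
  then have "n \<in> {x. n \<bullet> x = 0}" using assms(2) by blast
  then show False using n(1) by simp
qed

text \<open>A supporting hyperplane at \<open>y\<close> passes through 0, by comparing
  \<open>y\<close> with its double and with 0. All generators lie on one side of it, so those with
  positive coefficient in \<open>y\<close> lie in it, and the generators in it do not span.\<close>

lemma gcone_boundary:
  fixes a :: "nat \<Rightarrow> 'a::euclidean_space"
  assumes "finite I" "span (a ` I) = UNIV" "y \<in> gcone a I" "y \<notin> interior (gcone a I)"
  shows "\<exists>J\<subseteq>I. span (a ` J) \<noteq> UNIV \<and> y \<in> gcone a J"
proof -
  have "rel_interior (gcone a I) = interior (gcone a I)"
    by (rule rel_interior_nonempty_interior[OF gcone_interior_nonempty[OF assms(1,2)]])
  then obtain n where n: "n \<noteq> 0" "\<And>z. z \<in> gcone a I \<Longrightarrow> n \<bullet> y \<le> n \<bullet> z"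
    using supporting_hyperplane_relative_frontier[OF convex_gcone[OF assms(1)], of y a] assms(3,4)
      closure_closed[OF closed_gcone[OF assms(1), of a]] by metis
  have "n \<bullet> y \<le> n \<bullet> (2 *\<^sub>R y)" using gcone_scale[OF assms(3) _ assms(1), of 2] by (intro n(2)) auto
  moreover have "n \<bullet> y \<le> n \<bullet> 0" by (intro n(2) zero_in_gcone)
  ultimately have ny: "n \<bullet> y = 0" by simp
  obtain t where t: "y = (\<Sum>i\<in>I. t i *\<^sub>R a i)" "\<And>i. i \<in> I \<Longrightarrow> 0 \<le> t i"
    using assms(3) by (auto simp: gcone_def)
  have na: "0 \<le> n \<bullet> a i" if "i \<in> I" for i using n(2)[OF gcone_gen[OF that assms(1)]] ny by simp
  have "(\<Sum>i\<in>I. t i * (n \<bullet> a i)) = 0" using ny unfolding t(1) by (simp add: inner_sum_right)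
  then have z: "t i * (n \<bullet> a i) = 0" if "i \<in> I" for i
    using sum_nonneg_eq_0_iff[OF assms(1), of "\<lambda>i. t i * (n \<bullet> a i)"] t(2) na that by auto
  define J where "J = {i \<in> I. n \<bullet> a i = 0}"
  have "y = (\<Sum>i\<in>J. t i *\<^sub>R a i)"
    unfolding t(1) using z assms(1) by (intro sum.mono_neutral_right) (auto simp: J_def)
  then have "y \<in> gcone a J" using t(2) unfolding gcone_def J_def by blast
  moreover have "span (a ` J) \<subseteq> {x. n \<bullet> x = 0}"
    by (intro span_minimal subspace_hyperplane) (auto simp: J_def)
  then have "span (a ` J) \<noteq> UNIV"
    using n(1) by (metis (mono_tags, lifting) UNIV_I inner_eq_zero_iff mem_Collect_eq subsetD)
  ultimately show ?thesis by (intro exI[of _ J]) (auto simp: J_def)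
qed

lemma generic_interior:
  fixes a :: "nat \<Rightarrow> 'a::euclidean_space"
  assumes "finite I" "span (a ` I) = UNIV" "generic a N y" "I \<subseteq> N" "y \<in> gcone a I"
  shows "y \<in> interior (gcone a I)"
proof (rule ccontr)
  assume "y \<notin> interior (gcone a I)"
  then obtain J where J: "J \<subseteq> I" "span (a ` J) \<noteq> UNIV" "y \<in> gcone a J"
    using gcone_boundary[OF assms(1,2,5)] by blast
  have "span (a ` N) = UNIV" using span_mono[OF image_mono[OF assms(4)], of a] assms(2) by auto
  then show False
    using assms(1,3,4) J gcone_subset_span[of J a] finite_subset[OF J(1)] unfolding generic_def by blast
qed

lemma generic_mono:
  fixes a :: "nat \<Rightarrow> 'a::euclidean_space"
  assumes "generic a N y" "I \<subseteq> N" "span (a ` I) = UNIV"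
  shows "generic a I y"
proof -
  have "span (a ` N) = UNIV" using span_mono[OF image_mono[OF assms(2)], of a] assms(3) by auto
  then show ?thesis using assms unfolding generic_def by auto
qed

text \<open>The density may jump at the boundary of the cone, but a generic point is interior to the
  cone or outside.\<close>

lemma generic_isCont:
  fixes a :: "nat \<Rightarrow> 'a::euclidean_space"
  assumes "finite I" "span (a ` I) = UNIV" "generic a I y"
    and "continuous_on (gcone a I) T" "\<And>x. x \<notin> gcone a I \<Longrightarrow> T x = 0"
  shows "isCont T y"
proof (cases "y \<in> gcone a I")
  case True
  then have "y \<in> interior (gcone a I)" using generic_interior[OF assms(1-3)] by blast
  then show ?thesis using assms(4) by (rule continuous_on_interior[rotated])
next
  case False
  have "open (- gcone a I)" using closed_gcone[OF assms(1), of a] by auto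
  moreover have "continuous_on (- gcone a I) T"
    by (rule continuous_on_eq[OF continuous_on_const[of _ 0]]) (simp add: assms(5))
  ultimately show ?thesis using False by (simp add: continuous_on_eq_continuous_at)
qed

lemma eventually_generic:
  fixes a :: "nat \<Rightarrow> 'a::euclidean_space"
  assumes "finite I" "span (a ` I) = UNIV" "generic a I x"
  shows "\<forall>\<^sub>F y in nhds x. generic a I y"
proof -
  define \<J> where "\<J> = {J \<in> Pow I. span (a ` J) \<noteq> UNIV}"
  have "finite \<J>" using assms(1) by (simp add: \<J>_def)
  have g: "generic a I y \<longleftrightarrow> y \<in> - (\<Union>J\<in>\<J>. span (a ` J))" for y
    using assms(2) by (auto simp: generic_def \<J>_def)
  have "open (- (\<Union>J\<in>\<J>. span (a ` J)))"
    using \<open>finite \<J>\<close> by (intro open_Compl closed_UN ballI closed_subspace) auto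
  from eventually_nhds_in_open[OF this] show ?thesis
    using assms(3) unfolding g by simp
qed

lemma eventually_same_cones:
  fixes a :: "nat \<Rightarrow> 'a::euclidean_space"
  assumes "finite I" "span (a ` I) = UNIV" "generic a I x"
  shows "\<forall>\<^sub>F y in nhds x. \<forall>b\<in>bases a I. y \<in> gcone a b \<longleftrightarrow> x \<in> gcone a b"
proof (intro eventually_ball_finite finite_bases[OF assms(1)] ballI)
  fix b assume "b \<in> bases a I"
  then have b: "b \<subseteq> I" "finite b" "span (a ` b) = UNIV" using assms(2) by (auto simp: bases_def lin_indep_def)
  show "\<forall>\<^sub>F y in nhds x. y \<in> gcone a b \<longleftrightarrow> x \<in> gcone a b"
  proof (cases "x \<in> gcone a b")
    case True
    then have "x \<in> interior (gcone a b)" using generic_interior[OF b(2,3) assms(3) b(1)] by blast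
    then have "\<forall>\<^sub>F y in nhds x. y \<in> interior (gcone a b)" by (intro eventually_nhds_in_open) auto
    then show ?thesis by (rule eventually_mono) (use True interior_subset in auto)
  next
    case False
    then have "\<forall>\<^sub>F y in nhds x. y \<in> - gcone a b"
      using closed_gcone[OF b(2), of a] by (intro eventually_nhds_in_open) auto
    then show ?thesis by (rule eventually_mono) (use False in auto)
  qed
qed

text \<open>Tested on indicators, the defining identity says that the image of Lebesgue measure on
  the orthant is the measure with density \<open>T\<close>. Equal measures have equal Bochner
  integrals for every Borel \<open>f\<close>.\<close>

lemma spline_integral:
  fixes a :: "nat \<Rightarrow> 'a::euclidean_space"
  assumes "finite I" "spline a I T" and f[measurable]: "f \<in> borel_measurable borel"
  shows "(LINT t : (I \<rightarrow>\<^sub>E {0..}) | lprod I. f (\<Sum>i\<in>I. t i *\<^sub>R a i)) = (\<integral>x. f x * T x \<partial>lborel)"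
proof -
  have T: "continuous_on (gcone a I) T" "\<And>x. x \<notin> gcone a I \<Longrightarrow> T x = 0" "\<And>x. 0 \<le> T x"
    and TI: "\<And>g. g \<in> borel_measurable borel \<Longrightarrow>
      (\<integral>\<^sup>+t. (\<Prod>i\<in>I. indicator {0..} (t i)) * g (\<Sum>i\<in>I. t i *\<^sub>R a i) \<partial>lprod I) =
      (\<integral>\<^sup>+x. g x * ennreal (T x) \<partial>lborel)"
    using assms(2) by (auto simp: spline_def)
  have [measurable]: "T \<in> borel_measurable borel" by (rule measurable_cone_supported[OF assms(1) T(1,2)])
  define S where "S = (I \<rightarrow>\<^sub>E {0::real..})"
  have S[measurable]: "S \<in> sets (lprod I)"
    unfolding S_def using assms(1) by (intro sets_PiM_I_finite) auto
  let ?w = "\<lambda>t. indicator S t :: real"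
  have wS: "(\<Prod>i\<in>I. indicator {0..} (t i)) = ennreal (?w t)" if "t \<in> space (lprod I)" for t
  proof -
    have "t \<in> S \<longleftrightarrow> (\<forall>i\<in>I. 0 \<le> t i)" using that by (auto simp: S_def space_PiM PiE_iff)
    moreover have "(\<Prod>i\<in>I. indicator {0..} (t i)) = (if \<forall>i\<in>I. 0 \<le> t i then 1 else (0::ennreal))"
      using assms(1) by (auto simp: prod_zero_iff indicator_def intro!: prod.neutral)
    ultimately show ?thesis by simp
  qed
  have "distr (density (lprod I) ?w) borel (\<lambda>t. \<Sum>i\<in>I. t i *\<^sub>R a i) = density lborel T"
  proof (rule measure_eqI)
    fix A :: "'a set" assume "A \<in> sets (distr (density (lprod I) ?w) borel (\<lambda>t. \<Sum>i\<in>I. t i *\<^sub>R a i))"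
    then have A[measurable]: "A \<in> sets borel" by simp
    have "emeasure (distr (density (lprod I) ?w) borel (\<lambda>t. \<Sum>i\<in>I. t i *\<^sub>R a i)) A =
        (\<integral>\<^sup>+x. indicator A x \<partial>distr (density (lprod I) ?w) borel (\<lambda>t. \<Sum>i\<in>I. t i *\<^sub>R a i))" by simp
    also have "\<dots> = (\<integral>\<^sup>+t. indicator A (\<Sum>i\<in>I. t i *\<^sub>R a i) \<partial>density (lprod I) ?w)"
      by (rule nn_integral_distr) auto
    also have "\<dots> = (\<integral>\<^sup>+t. ennreal (?w t) * indicator A (\<Sum>i\<in>I. t i *\<^sub>R a i) \<partial>lprod I)"
      by (rule nn_integral_density) measurable
    also have "\<dots> = (\<integral>\<^sup>+t. (\<Prod>i\<in>I. indicator {0..} (t i)) * indicator A (\<Sum>i\<in>I. t i *\<^sub>R a i) \<partial>lprod I)"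
      by (intro nn_integral_cong) (simp add: wS)
    also have "\<dots> = (\<integral>\<^sup>+x. ennreal (T x) * indicator A x \<partial>lborel)"
      by (subst TI) (auto simp: mult.commute)
    also have "\<dots> = emeasure (density lborel T) A" by (simp add: emeasure_density)
    finally show "emeasure (distr (density (lprod I) ?w) borel (\<lambda>t. \<Sum>i\<in>I. t i *\<^sub>R a i)) A =
        emeasure (density lborel T) A" .
  qed simp
  then have "(\<integral>x. f x \<partial>distr (density (lprod I) ?w) borel (\<lambda>t. \<Sum>i\<in>I. t i *\<^sub>R a i)) = (\<integral>x. f x \<partial>density lborel T)"
    by simp
  also have "(\<integral>x. f x \<partial>density lborel T) = (\<integral>x. f x * T x \<partial>lborel)"
    using T(3) by (subst integral_density) (auto simp: mult.commute)
  also have "(\<integral>x. f x \<partial>distr (density (lprod I) ?w) borel (\<lambda>t. \<Sum>i\<in>I. t i *\<^sub>R a i)) =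
      (\<integral>t. f (\<Sum>i\<in>I. t i *\<^sub>R a i) \<partial>density (lprod I) ?w)"
    by (rule integral_distr) auto
  also have "\<dots> = (LINT t : S | lprod I. f (\<Sum>i\<in>I. t i *\<^sub>R a i))"
    unfolding set_lebesgue_integral_def
    by (rule integral_density) (auto intro!: measurable_compose[OF measurable_comb])
  finally show ?thesis by (simp add: S_def)
qed

text \<open>A tent function on a small ball where \<open>T1\<close> exceeds \<open>T2\<close> would
  separate the integrals. The claim is one-sided so that exchanging \<open>T1\<close> and
  \<open>T2\<close> yields equality.\<close>

lemma cone_function_nonpos:
  fixes a :: "nat \<Rightarrow> 'a::euclidean_space"
  assumes "finite I" "span (a ` I) = UNIV"
    and "continuous_on (gcone a I) T1" "continuous_on (gcone a I) T2"
    and "\<And>f. continuous_on UNIV f \<Longrightarrow> compact (closure {x. f x \<noteq> (0::real)}) \<Longrightarrow>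
      (\<integral>x. f x * T1 x \<partial>lborel) = (\<integral>x. f x * T2 x \<partial>lborel)"
    and "x \<in> interior (gcone a I)"
  shows "T1 x \<le> T2 x"
proof (rule ccontr)
  let ?C = "gcone a I"
  assume "\<not> T1 x \<le> T2 x"
  then have xpos: "0 < T1 x - T2 x" by simp
  have D: "continuous_on (interior ?C) (\<lambda>x. T1 x - T2 x)"
    using assms(3,4) interior_subset by (intro continuous_on_diff) (blast intro: continuous_on_subset)+
  have "open {z \<in> interior ?C. 0 < T1 z - T2 z}"
    using continuous_open_preimage[OF D open_interior open_greaterThan[of 0]]
    by (simp add: vimage_def Int_def)
  then obtain r where r: "0 < r" "cball x r \<subseteq> {z \<in> interior ?C. 0 < T1 z - T2 z}"
    using open_contains_cball xpos assms(6) by (metis (mono_tags, lifting) mem_Collect_eq)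
  define f where "f z = max 0 (r - dist x z)" for z
  have f: "continuous_on UNIV f" unfolding f_def by (intro continuous_intros)
  have f0: "f z = 0" if "z \<notin> ball x r" for z using that by (simp add: f_def)
  have "{z. f z \<noteq> 0} \<subseteq> cball x r" using f0 ball_subset_cball by blast
  then have "compact (closure {z. f z \<noteq> 0})"
    by (meson bounded_cball bounded_subset compact_closure)
  then have eq: "(\<integral>z. f z * T1 z \<partial>lborel) = (\<integral>z. f z * T2 z \<partial>lborel)" using assms(5) f by blast
  have int: "integrable lborel (\<lambda>z. f z * T z)" if "continuous_on ?C T" for T
  proof -
    have "continuous_on (cball x r) (\<lambda>z. f z * T z)"
      using r(2) interior_subset by (intro continuous_on_mult continuous_on_subset[OF f] continuous_on_subset[OF that]) auto
    from borel_integrable_compact[OF compact_cball this]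
    have "integrable lborel (\<lambda>z. indicator (cball x r) z *\<^sub>R (f z * T z))" .
    moreover have "(\<lambda>z. indicator (cball x r) z *\<^sub>R (f z * T z)) = (\<lambda>z. f z * T z)"
    proof
      fix z show "indicator (cball x r) z *\<^sub>R (f z * T z) = f z * T z"
        using f0[of z] ball_subset_cball[of x r] by (cases "z \<in> cball x r") auto
    qed
    ultimately show ?thesis by simp
  qed
  have intD: "integrable lborel (\<lambda>z. f z * (T1 z - T2 z))"
    using Bochner_Integration.integrable_diff[OF int[OF assms(3)] int[OF assms(4)]] by (simp add: right_diff_distrib)
  have "(\<integral>z. f z * (T1 z - T2 z) \<partial>lborel) = 0"
    using Bochner_Integration.integral_diff[OF int[OF assms(3)] int[OF assms(4)]] eq by (simp add: right_diff_distrib)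
  moreover have nn: "0 \<le> f z * (T1 z - T2 z)" for z
    using r(2) f0[of z] by (cases "z \<in> ball x r") (auto simp: f_def intro!: mult_nonneg_nonneg less_imp_le)
  ultimately have "AE z in lborel. f z * (T1 z - T2 z) = 0"
    using integral_nonneg_eq_0_iff_AE[OF intD] by simp
  then obtain Z where Z: "{z. f z * (T1 z - T2 z) \<noteq> 0} \<subseteq> Z" "Z \<in> null_sets lborel"
    unfolding eventually_ae_filter by auto
  have "ball x r \<subseteq> {z. f z * (T1 z - T2 z) \<noteq> 0}"
  proof
    fix z assume z: "z \<in> ball x r"
    then have "0 < T1 z - T2 z" using r(2) ball_subset_cball[of x r] by blast
    moreover have "0 < f z" using z by (simp add: f_def)
    ultimately show "z \<in> {z. f z * (T1 z - T2 z) \<noteq> 0}" by simp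
  qed
  then have "ball x r \<subseteq> Z" using Z(1) by blast
  moreover have "negligible Z" using Z(2) by (simp add: negligible_iff_null_sets null_sets_completionI)
  ultimately have "negligible (ball x r)" using negligible_subset by blast
  then show False using open_not_negligible[of "ball x r"] r(1) by simp
qed

lemma cone_function_unique:
  fixes a :: "nat \<Rightarrow> 'a::euclidean_space"
  assumes "finite I" "span (a ` I) = UNIV"
    and "continuous_on (gcone a I) T1" "\<And>x. x \<notin> gcone a I \<Longrightarrow> T1 x = 0"
    and "continuous_on (gcone a I) T2" "\<And>x. x \<notin> gcone a I \<Longrightarrow> T2 x = 0"
    and "\<And>f. continuous_on UNIV f \<Longrightarrow> compact (closure {x. f x \<noteq> (0::real)}) \<Longrightarrow>
      (\<integral>x. f x * T1 x \<partial>lborel) = (\<integral>x. f x * T2 x \<partial>lborel)"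
  shows "T1 = T2"
proof
  fix x
  have int: "T1 z - T2 z = 0" if "z \<in> interior (gcone a I)" for z
    using cone_function_nonpos[OF assms(1-3,5,7) that]
      cone_function_nonpos[OF assms(1,2,5,3) assms(7)[symmetric] that] by simp
  have cl: "closure (interior (gcone a I)) = gcone a I"
    using convex_closure_interior[OF convex_gcone gcone_interior_nonempty] assms(1,2)
      closure_closed[OF closed_gcone[OF assms(1)]] by metis
  show "T1 x = T2 x"
  proof (cases "x \<in> gcone a I")
    case True
    have "T1 x - T2 x = 0"
      by (rule continuous_constant_on_closure[where S = "interior (gcone a I)" and f = "\<lambda>x. T1 x - T2 x"])
        (use int cl True assms(3,5) in \<open>auto intro: continuous_on_diff\<close>)
    then show ?thesis by simp
  qed (use assms(4,6) in auto)
qed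

lemma spline_unique:
  fixes a :: "nat \<Rightarrow> 'a::euclidean_space"
  assumes "finite I" "span (a ` I) = UNIV" "spline a I T1" "spline a I T2"
  shows "T1 = T2"
proof (rule cone_function_unique[OF assms(1,2)])
  fix f :: "'a \<Rightarrow> real" assume "continuous_on UNIV f"
  then have f: "f \<in> borel_measurable borel" by (rule borel_measurable_continuous_onI)
  show "(\<integral>x. f x * T1 x \<partial>lborel) = (\<integral>x. f x * T2 x \<partial>lborel)"
    unfolding spline_integral[OF assms(1,3) f, symmetric] spline_integral[OF assms(1,4) f, symmetric] ..
qed (use assms(3,4) in \<open>auto simp: spline_def\<close>)

section \<open>Derivatives along cocircuits\<close>

lemma dir_deriv_poly:
  fixes p :: "'a::euclidean_space \<Rightarrow> real"
  assumes "real_polynomial_function p"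
  shows "real_polynomial_function (dir_deriv v p)"
    and "((\<lambda>t. p (x + t *\<^sub>R v)) has_real_derivative dir_deriv v p x) (at 0)"
proof -
  obtain p' where p': "real_polynomial_function p'"
    "\<And>x. ((\<lambda>t. p (x + t *\<^sub>R v)) has_real_derivative p' x) (at 0)"
    using poly_dir_deriv[OF assms, of v] by blast
  then have "dir_deriv v p = p'" unfolding dir_deriv_def by (auto intro!: ext DERIV_imp_deriv)
  then show "real_polynomial_function (dir_deriv v p)"
    "((\<lambda>t. p (x + t *\<^sub>R v)) has_real_derivative dir_deriv v p x) (at 0)" using p' by auto
qed

lemma foldr_dir_deriv_poly:
  "real_polynomial_function p \<Longrightarrow> real_polynomial_function (foldr dir_deriv vs (p :: 'a::euclidean_space \<Rightarrow> real))"
  by (induction vs) (auto intro: dir_deriv_poly(1))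

lemma foldr_dir_deriv_sum:
  fixes q :: "'b \<Rightarrow> 'a::euclidean_space \<Rightarrow> real"
  assumes "finite S" "\<And>b. b \<in> S \<Longrightarrow> real_polynomial_function (q b)"
  shows "foldr dir_deriv vs (\<lambda>x. \<Sum>b\<in>S. q b x) = (\<lambda>x. \<Sum>b\<in>S. foldr dir_deriv vs (q b) x)"
proof (induction vs)
  case (Cons v vs)
  have "dir_deriv v (\<lambda>x. \<Sum>b\<in>S. foldr dir_deriv vs (q b) x) = (\<lambda>x. \<Sum>b\<in>S. dir_deriv v (foldr dir_deriv vs (q b)) x)"
    unfolding dir_deriv_def[of v "\<lambda>x. \<Sum>b\<in>S. foldr dir_deriv vs (q b) x"]
    by (intro ext DERIV_imp_deriv DERIV_sum dir_deriv_poly(2) foldr_dir_deriv_poly assms(2))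
  then show ?case using Cons by simp
qed simp

text \<open>Each derivative of a reflected function brings a factor -1. The constant is left open,
  since the lemma serves to transfer vanishing.\<close>

lemma foldr_dir_deriv_reflect:
  fixes q :: "'a::euclidean_space \<Rightarrow> real"
  assumes "real_polynomial_function q"
  shows "\<exists>k'. foldr dir_deriv vs (\<lambda>x. k * q (- x)) = (\<lambda>x. k' * foldr dir_deriv vs q (- x))"
proof (induction vs)
  case (Cons v vs)
  then obtain k' where k': "foldr dir_deriv vs (\<lambda>x. k * q (- x)) = (\<lambda>x. k' * foldr dir_deriv vs q (- x))" by blast
  let ?p = "foldr dir_deriv vs q"
  have "dir_deriv v (\<lambda>x. k' * ?p (- x)) x = (- k') * dir_deriv v ?p (- x)" for x
    unfolding dir_deriv_def[of v "\<lambda>x. k' * ?p (- x)"]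
  proof (rule DERIV_imp_deriv)
    have "((\<lambda>t. ?p (- x + t *\<^sub>R v)) has_real_derivative dir_deriv v ?p (- x)) (at (- 0))"
      using dir_deriv_poly(2)[OF foldr_dir_deriv_poly[OF assms], of vs "- x" v] by simp
    then have "((\<lambda>t. ?p (- x + (- t) *\<^sub>R v)) has_real_derivative - dir_deriv v ?p (- x)) (at 0)"
      by (rule DERIV_mirror[THEN iffD1])
    from DERIV_cmult[OF this, of k']
    show "((\<lambda>t. k' * ?p (- (x + t *\<^sub>R v))) has_real_derivative - k' * dir_deriv v ?p (- x)) (at 0)" by simp
  qed
  then show ?case using k' by (auto intro!: exI[of _ "- k'"])
qed auto

lemma foldr_dir_deriv_zero: "foldr dir_deriv vs (\<lambda>x. 0) = (\<lambda>x. 0)"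
  by (induction vs) (auto simp: dir_deriv_def)

text \<open>The spline is known to be constant only along positive multiples of \<open>v\<close>.
  For a polynomial this suffices, because an interval of zeros forces constancy on the whole
  line.\<close>

lemma dir_deriv_eq_0:
  fixes p :: "'a::euclidean_space \<Rightarrow> real"
  assumes "real_polynomial_function p" "\<forall>\<^sub>F s in at_right 0. p (y + s *\<^sub>R v) = p y"
  shows "dir_deriv v p y = 0"
proof -
  have poly: "real_polynomial_function (\<lambda>s::real. p (y + s *\<^sub>R v) - p y)"
    using poly_affine_line[OF assms(1)] by (intro real_polynomial_function_diff) auto
  obtain e where e: "0 < e" "\<And>s. 0 < s \<Longrightarrow> s < e \<Longrightarrow> p (y + s *\<^sub>R v) = p y"
    using assms(2) unfolding eventually_at_right_field by auto
  then have "{0<..<e} \<subseteq> {s. p (y + s *\<^sub>R v) - p y = 0}" by auto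
  then have "infinite {s. p (y + s *\<^sub>R v) - p y = 0}" using infinite_Ioo[OF e(1)] finite_subset by blast
  then have "p (y + s *\<^sub>R v) - p y = 0" for s by (rule real_poly_infinite_zeros[OF poly])
  then have "p (y + s *\<^sub>R v) = p y" for s by simp
  then show ?thesis by (simp add: dir_deriv_def)
qed

lemma eventually_along_line:
  fixes y v :: "'a::real_normed_vector"
  assumes "\<forall>\<^sub>F z in nhds y. P z"
  shows "\<forall>\<^sub>F s in nhds (0::real). P (y + s *\<^sub>R v)"
proof -
  have "isCont (\<lambda>s::real. y + s *\<^sub>R v) 0" by (intro continuous_intros)
  then have "((\<lambda>s::real. y + s *\<^sub>R v) \<longlongrightarrow> y) (nhds 0)"
    using tendsto_at_iff_tendsto_nhds[of "\<lambda>s::real. y + s *\<^sub>R v" 0] by (simp add: isCont_def)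
  then show ?thesis using assms by (simp add: filterlim_iff)
qed

text \<open>
  A derivative \<open>D\<^sub>k\<close> turns the spline of \<open>I\<close> into that of \<open>I - {k}\<close>; once the remaining vectors cease
  to span, the spline is locally constant in the direction removed last.
\<close>

lemma cocircuit_derivative_zero:
  fixes a :: "nat \<Rightarrow> 'a::euclidean_space"
  assumes "finite N" "pointed a N" "generic a N x"
    and "distinct js" "set js \<subseteq> I" "I \<subseteq> N" "span (a ` I) = UNIV" "span (a ` (I - set js)) \<noteq> UNIV"
    and "cone_spline a I T" "real_polynomial_function P" "\<forall>\<^sub>F y in nhds x. T y = P y"
  shows "foldr dir_deriv (map a js) P = (\<lambda>x. 0)"
  using assms(4-)
\<comment> \<open>\<open>foldr\<close> applies the last direction first, so the list is taken apart
  from its end. \<open>N\<close> and \<open>x\<close> stay fixed while \<open>I\<close> shrinks, so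
  that \<open>x\<close> remains generic for every smaller spanning family.\<close>
proof (induction js arbitrary: I T P rule: rev_induct)
  case Nil
  then show ?case by simp
next
  case (snoc k js)
  define J where "J = I - {k}"
  have J: "I = insert k J" "k \<notin> J" "finite J" "J \<subseteq> N"
    using snoc.prems assms(1) finite_subset[of I N] by (auto simp: J_def)
  have finI: "finite I" using J by simp
  have spI: "spline a I T" using snoc.prems by (simp add: cone_spline_def)
  have NU: "span (a ` N) = UNIV"
    using span_mono[OF image_mono[OF snoc.prems(3)], of a] snoc.prems(4) by auto
  \<comment> \<open>Equality near \<open>x\<close> is also equality near each \<open>y\<close> close
    to \<open>x\<close>, which is what a derivative at \<open>y\<close> requires.\<close>
  have evP: "\<forall>\<^sub>F y in nhds x. \<forall>\<^sub>F z in nhds y. T z = P z"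
    using snoc.prems(8) by (subst eventually_eventually)
  have evg: "\<forall>\<^sub>F y in nhds x. generic a N y" by (rule eventually_generic[OF assms(1) NU assms(3)])
  let ?P = "dir_deriv (a k) P"
  have polyP: "real_polynomial_function ?P" by (rule dir_deriv_poly(1)[OF snoc.prems(7)])
  have "foldr dir_deriv (map a js) ?P = (\<lambda>x. 0)"
  proof (cases "span (a ` J) = UNIV")
    case True
    obtain T' where T': "cone_spline a J T'"
      using cone_spline_exists[OF J(3) pointed_mono[OF assms(2) J(4) assms(1)] True] by blast
    have pk: "- a k \<notin> gcone a J"
      using assms(1,2) J(4) snoc.prems(2,3) gcone_mono[OF J(4) assms(1), of a] by (auto simp: pointed_def)
    have sp': "spline a J T'" using T' by (simp add: cone_spline_def)
    \<comment> \<open>By uniqueness the given spline is the ray integral of the smaller one, so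
      \<open>T'\<close> is its derivative along \<open>a k\<close> wherever \<open>T'\<close> is
      continuous.\<close>
    have TT': "T = ray_integral (a k) T'"
      using spline_unique[OF finI snoc.prems(4) spI] spline_insert(1)[OF J(3,2) pk sp'] J(1) by simp
    have c: "continuous_on (gcone a J) T'" "\<And>x. x \<notin> gcone a J \<Longrightarrow> T' x = 0"
      using sp' by (auto simp: spline_def)
    have "T' y = ?P y" if y: "generic a N y" "\<forall>\<^sub>F z in nhds y. T z = P z" for y
    proof -
      have "isCont T' y"
        by (rule generic_isCont[OF J(3) True generic_mono[OF y(1) J(4) True] c])
      then have "((\<lambda>s. T (y + s *\<^sub>R a k)) has_real_derivative T' y) (at 0)"
        unfolding TT' by (intro ray_integral_derivative[OF J(3,2) pk c(1)] c(2))
      then have "((\<lambda>s. P (y + s *\<^sub>R a k)) has_real_derivative T' y) (at 0)"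
        using eventually_along_line[OF y(2)] by (subst DERIV_cong_ev[OF refl _ refl, symmetric]) auto
      then show ?thesis using dir_deriv_poly(2)[OF snoc.prems(7)] DERIV_unique by blast
    qed
    then have ev: "\<forall>\<^sub>F y in nhds x. T' y = ?P y"
      by (intro eventually_mono[OF eventually_conj[OF evP evg]]) blast
    show ?thesis
    proof (rule snoc.IH[OF _ _ J(4) True _ T' polyP ev])
      have "I - set (js @ [k]) = J - set js" by (auto simp: J_def)
      then show "span (a ` (J - set js)) \<noteq> UNIV" using snoc.prems(5) by simp
    qed (use snoc.prems in \<open>auto simp: J_def\<close>)
  next
    case False
    have "?P y = 0" if y: "\<forall>\<^sub>F z in nhds y. T z = P z" for y
    proof (rule dir_deriv_eq_0[OF snoc.prems(7)])
      have Ty: "T y = P y" using y by (rule eventually_nhds_x_imp_x)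
      have line: "\<forall>\<^sub>F s in at_right 0. T (y + s *\<^sub>R a k) = P (y + s *\<^sub>R a k)"
        using eventually_along_line[OF y, of "a k"] by (simp add: eventually_at_filter eventually_mono)
      have pos: "\<forall>\<^sub>F s in at_right (0::real). 0 < s" by (simp add: eventually_at_right_less)
      show "\<forall>\<^sub>F s in at_right 0. P (y + s *\<^sub>R a k) = P y"
      proof (cases "y \<in> gcone a I")
        case True
        have "T (y + s *\<^sub>R a k) = T y" if "0 < s" for s
          using snoc.prems(6) False True that J(1) unfolding cone_spline_def J_def by auto
        then show ?thesis using line pos Ty by (auto elim: eventually_elim2)
      next
        case False
        then have "\<forall>\<^sub>F z in nhds y. z \<in> - gcone a I"
          using closed_gcone[OF finI, of a] by (intro eventually_nhds_in_open) auto
        from eventually_along_line[OF this, of "a k"]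
        have "\<forall>\<^sub>F s in at_right 0. y + s *\<^sub>R a k \<in> - gcone a I"
          by (simp add: eventually_at_filter eventually_mono)
        then have "\<forall>\<^sub>F s in at_right 0. T (y + s *\<^sub>R a k) = 0"
          by (rule eventually_mono) (use spI in \<open>simp add: spline_def\<close>)
        moreover have "T y = 0" using False spI by (simp add: spline_def)
        ultimately show ?thesis using line Ty by (auto elim: eventually_elim2)
      qed
    qed
    then have "\<forall>\<^sub>F y in nhds x. ?P y = 0" using evP by (auto elim: eventually_mono)
    then obtain U where "open U" "x \<in> U" "\<And>y. y \<in> U \<Longrightarrow> ?P y = 0" unfolding eventually_nhds by blast
    then have "?P = (\<lambda>_. 0)" using poly_zero_open[OF polyP] by blast
    then show ?thesis by (simp only: foldr_dir_deriv_zero)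
  qed
  then show ?case by simp
qed

lemma spline_nb_polynomials:
  fixes a :: "nat \<Rightarrow> 'a::euclidean_space"
  assumes "finite N" "pointed a N" "span (a ` N) = UNIV" "cone_spline a N T"
  obtains q where "\<And>b. b \<in> nb_bases a N \<Longrightarrow> real_polynomial_function (q b)"
    "\<And>x. generic a N x \<Longrightarrow> T x = (\<Sum>b\<in>nb_bases a N. if x \<in> gcone a b then q b x else 0)"
    "\<And>b s x. b \<in> nb_bases a N \<Longrightarrow> q b (s *\<^sub>R x) = s ^ (card N - DIM('a)) * q b x"
    "\<And>b js. b \<in> nb_bases a N \<Longrightarrow> distinct js \<Longrightarrow> set js \<subseteq> N \<Longrightarrow> span (a ` (N - set js)) \<noteq> UNIV \<Longrightarrow>
      foldr dir_deriv (map a js) (q b) = (\<lambda>_. 0)"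
proof -
  let ?d = "card N - DIM('a)"
  have nz: "a i \<noteq> 0" if "i \<in> N" for i using pointed_nonzero[OF assms(2) that] .
  note indep = nb_cones_independent[OF assms(1) nz]
  have fnb: "finite (nb_bases a N)" by (rule finite_nb_bases[OF assms(1)])
  obtain p where p: "\<And>b. b \<in> bases a N \<Longrightarrow> real_polynomial_function (p b)"
    "\<And>x. generic a N x \<Longrightarrow> T x = (\<Sum>b\<in>bases a N. if x \<in> gcone a b then p b x else 0)"
  proof -
    have "conic_comb polys a (bases a N) {x. generic a N x} T" using assms(4) by (simp add: cone_spline_def)
    then show ?thesis using that unfolding conic_comb_def mem_Collect_eq by blast
  qed
  have "conic_comb polys a (nb_bases a N) {x. generic a N x} (\<lambda>x. \<Sum>b\<in>bases a N. (if x \<in> gcone a b then 1 else 0) * p b x)"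
  proof (intro conic_comb_sum finite_bases[OF assms(1)])
    fix b assume "b \<in> bases a N"
    then show "conic_comb polys a (nb_bases a N) {x. generic a N x} (\<lambda>x. (if x \<in> gcone a b then 1 else 0) * p b x)"
      using p(1) by (intro conic_comb_mult[OF _ cone_conic_comb_nb[OF assms(1,2)]]) auto
  qed auto
  then have "conic_comb polys a (nb_bases a N) {x. generic a N x} T"
    by (rule conic_comb_cong) (use p(2) in \<open>auto intro!: sum.cong\<close>)
  then obtain q where q: "\<And>b. b \<in> nb_bases a N \<Longrightarrow> real_polynomial_function (q b)"
    "\<And>x. generic a N x \<Longrightarrow> T x = (\<Sum>b\<in>nb_bases a N. if x \<in> gcone a b then q b x else 0)"
    unfolding conic_comb_def by auto
  \<comment> \<open>The polynomial that equals \<open>T\<close> near the generic point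
    \<open>x\<close>; it may be evaluated anywhere, also outside the cones that select its
    summands.\<close>
  define P where "P x z = (\<Sum>b\<in>{b \<in> nb_bases a N. x \<in> gcone a b}. q b z)" for x z
  have polyP: "real_polynomial_function (P x)" for x
    unfolding P_def using q(1) fnb by (intro real_polynomial_function_sum) auto
  have P_if: "P x z = (\<Sum>b\<in>nb_bases a N. if x \<in> gcone a b then q b z else 0)" for x z
    unfolding P_def by (rule sum.inter_filter[OF fnb])
  have near: "\<forall>\<^sub>F z in nhds x. generic a N z \<and> (\<forall>b\<in>nb_bases a N. z \<in> gcone a b \<longleftrightarrow> x \<in> gcone a b)"
    if "generic a N x" for x
    using eventually_conj[OF eventually_generic[OF assms(1,3) that] eventually_same_cones[OF assms(1,3) that]]
    by (rule eventually_mono) (use nb_bases_subset in blast)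
  have TP: "T z = P x z" if "generic a N z" "\<forall>b\<in>nb_bases a N. z \<in> gcone a b \<longleftrightarrow> x \<in> gcone a b" for x z
    unfolding q(2)[OF that(1)] P_if using that(2) by (intro sum.cong) auto
  have hom_pos: "q b (s *\<^sub>R y) = s ^ ?d * q b y" if b: "b \<in> nb_bases a N" and s: "0 < s" for b s y
  proof -
    have "q b (s *\<^sub>R y) - s ^ ?d * q b y = 0"
    proof (rule indep[where v = "\<lambda>b. q b (s *\<^sub>R y) - s ^ ?d * q b y", OF _ _ b])
      fix x assume x: "generic a N x"
      have "P x (s *\<^sub>R z) - s ^ ?d * P x z = 0"
        if z: "generic a N z" "\<forall>b\<in>nb_bases a N. z \<in> gcone a b \<longleftrightarrow> x \<in> gcone a b" for z
      proof -
        \<comment> \<open>Cones and spans are invariant under positive scaling, so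
          \<open>T (s *\<^sub>R z)\<close> is given by the same polynomial \<open>P x\<close> as
          \<open>T z\<close>.\<close>
        have scale: "s *\<^sub>R z \<in> span (a ` J) \<longleftrightarrow> z \<in> span (a ` J)" for J
          using s span_scale[of "s *\<^sub>R z" "a ` J" "inverse s"] span_scale[of z "a ` J" s] by auto
        have "generic a N (s *\<^sub>R z)" using z(1) unfolding generic_def scale .
        moreover have "s *\<^sub>R z \<in> gcone a b \<longleftrightarrow> x \<in> gcone a b" if b: "b \<in> nb_bases a N" for b
        proof -
          have "finite b" using b by (simp add: nb_bases_def bases_def lin_indep_def)
          then show ?thesis
            using z(2) b s gcone_scale[of "s *\<^sub>R z" a b "inverse s"] gcone_scale[of z a b s] by auto
        qed
        ultimately have "T (s *\<^sub>R z) = P x (s *\<^sub>R z)" using TP by blast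
        moreover have "T z = P x z" using TP z by blast
        moreover have "T (s *\<^sub>R z) = s ^ ?d * T z" using assms(4) s by (simp add: cone_spline_def)
        ultimately show ?thesis by simp
      qed
      then have "\<forall>\<^sub>F z in nhds x. P x (s *\<^sub>R z) - s ^ ?d * P x z = 0"
        using near[OF x] by (auto elim: eventually_mono)
      then obtain U where U: "open U" "x \<in> U" "\<And>z. z \<in> U \<Longrightarrow> P x (s *\<^sub>R z) - s ^ ?d * P x z = 0"
        unfolding eventually_nhds by blast
      have "real_polynomial_function (\<lambda>z. P x (s *\<^sub>R z))"
        by (rule poly_linear_comp[OF polyP]) (simp add: linear_iff scaleR_add_right)
      then have "real_polynomial_function (\<lambda>z. P x (s *\<^sub>R z) - s ^ ?d * P x z)"
        using polyP by (intro real_polynomial_function_diff) auto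
      from fun_cong[OF poly_zero_open[OF this U], of y] have "P x (s *\<^sub>R y) - s ^ ?d * P x y = 0" .
      moreover have "(\<Sum>b\<in>nb_bases a N. if x \<in> gcone a b then q b (s *\<^sub>R y) - s ^ ?d * q b y else 0) =
          P x (s *\<^sub>R y) - s ^ ?d * P x y"
        unfolding P_if sum_distrib_left sum_subtractf[symmetric] by (intro sum.cong) auto
      ultimately show "(\<Sum>b\<in>nb_bases a N. if x \<in> gcone a b then q b (s *\<^sub>R y) - s ^ ?d * q b y else 0) = 0" by simp
    qed
    then show ?thesis by simp
  qed
  \<comment> \<open>Both sides are polynomials in \<open>s\<close> that agree for infinitely many
    \<open>s\<close>, so the identity extends to 0 and to negative factors.\<close>
  have hom: "q b (s *\<^sub>R y) = s ^ ?d * q b y" if b: "b \<in> nb_bases a N" for b s y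
  proof -
    have "real_polynomial_function (\<lambda>t::real. q b (0 + t *\<^sub>R y))" by (rule poly_affine_line[OF q(1)[OF b]])
    moreover have "real_polynomial_function (\<lambda>t::real. t ^ ?d * q b y)"
      by (intro real_polynomial_function.intros(2,4) real_polynomial_function_power real_polynomial_function.intros(1)) auto
    ultimately have poly: "real_polynomial_function (\<lambda>t::real. q b (t *\<^sub>R y) - t ^ ?d * q b y)"
      by (auto dest: real_polynomial_function_diff)
    have "{0<..<1} \<subseteq> {t::real. q b (t *\<^sub>R y) - t ^ ?d * q b y = 0}" using hom_pos[OF b] by auto
    then have "infinite {t::real. q b (t *\<^sub>R y) - t ^ ?d * q b y = 0}"
      by (rule infinite_super) (simp add: infinite_Ioo)
    from real_poly_infinite_zeros[OF poly this, of s] show ?thesis by simp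
  qed
  have ker: "foldr dir_deriv (map a js) (q b) = (\<lambda>_. 0)"
    if b: "b \<in> nb_bases a N" and js: "distinct js" "set js \<subseteq> N" "span (a ` (N - set js)) \<noteq> UNIV" for b js
  proof
    fix y
    let ?D = "foldr dir_deriv (map a js)"
    show "?D (q b) y = 0"
    proof (rule indep[where v = "\<lambda>b. ?D (q b) y", OF _ _ b])
      fix x assume x: "generic a N x"
      have "\<forall>\<^sub>F z in nhds x. T z = P x z" using near[OF x] TP by (auto elim: eventually_mono)
      from cocircuit_derivative_zero[OF assms(1,2) x js(1,2) subset_refl assms(3) js(3) assms(4) polyP this]
      have "?D (P x) y = 0" by simp
      also have "?D (P x) = (\<lambda>z. \<Sum>b\<in>{b \<in> nb_bases a N. x \<in> gcone a b}. ?D (q b) z)"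
        unfolding P_def using fnb q(1) by (intro foldr_dir_deriv_sum) auto
      also have "(\<Sum>b\<in>{b \<in> nb_bases a N. x \<in> gcone a b}. ?D (q b) y) =
          (\<Sum>b\<in>nb_bases a N. if x \<in> gcone a b then ?D (q b) y else 0)"
        by (rule sum.inter_filter[OF fnb])
      finally show "(\<Sum>b\<in>nb_bases a N. if x \<in> gcone a b then ?D (q b) y else 0) = 0" .
    qed
  qed
  show ?thesis using that[of q] q hom ker by blast
qed

section \<open>Regular points and big cells\<close>

definition regular :: "(nat \<Rightarrow> 'a::real_vector) \<Rightarrow> nat set \<Rightarrow> 'a set" where
  "regular a N = gcone a N - (\<Union>J\<in>{J. J \<subseteq> N \<and> span (a ` J) \<noteq> UNIV}. gcone a J)"

lemma open_regular:
  fixes a :: "nat \<Rightarrow> 'a::euclidean_space"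
  assumes "finite N" "span (a ` N) = UNIV"
  shows "open (regular a N)"
proof -
  let ?S = "\<Union>J\<in>{J. J \<subseteq> N \<and> span (a ` J) \<noteq> UNIV}. gcone a J"
  have "regular a N = interior (gcone a N) - ?S"
  proof (intro set_eqI iffI)
    fix x assume x: "x \<in> regular a N"
    have "x \<in> interior (gcone a N)"
    proof (rule ccontr)
      assume "x \<notin> interior (gcone a N)"
      then obtain J where "J \<subseteq> N" "span (a ` J) \<noteq> UNIV" "x \<in> gcone a J"
        using gcone_boundary[OF assms, of x] x by (auto simp: regular_def)
      then show False using x by (auto simp: regular_def)
    qed
    then show "x \<in> interior (gcone a N) - ?S" using x by (simp add: regular_def)
  next
    fix x assume "x \<in> interior (gcone a N) - ?S"
    then show "x \<in> regular a N" using interior_subset[of "gcone a N"] by (auto simp: regular_def)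
  qed
  moreover have "closed ?S"
    using assms(1) finite_subset by (intro closed_UN ballI closed_gcone) auto
  ultimately show ?thesis by (simp add: open_Diff)
qed

lemma regular_interior_basis:
  fixes a :: "nat \<Rightarrow> 'a::euclidean_space"
  assumes "b \<in> bases a N" "span (a ` N) = UNIV" "x \<in> regular a N" "x \<in> gcone a b"
  shows "x \<in> interior (gcone a b)"
proof (rule ccontr)
  assume "x \<notin> interior (gcone a b)"
  moreover have "finite b" "b \<subseteq> N" "span (a ` b) = UNIV"
    using assms by (auto simp: bases_def lin_indep_def)
  ultimately obtain J where "J \<subseteq> N" "span (a ` J) \<noteq> UNIV" "x \<in> gcone a J"
    using gcone_boundary[of b a x] assms(4) by blast
  then show False using assms(3) by (auto simp: regular_def)
qed

text \<open>Boundary points of a basis cone are singular, so among regular points the cone is both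
  open and closed, and a connected cell lies inside it or outside.\<close>

lemma cell_subset_gcone:
  fixes a :: "nat \<Rightarrow> 'a::euclidean_space"
  assumes "b \<in> bases a N" "span (a ` N) = UNIV" "\<cc> \<in> components (regular a N)" "x \<in> \<cc>" "x \<in> gcone a b"
  shows "\<cc> \<subseteq> gcone a b"
proof -
  have fb: "finite b" using assms by (auto simp: bases_def lin_indep_def)
  have sub: "\<cc> \<subseteq> regular a N" by (rule in_components_subset[OF assms(3)])
  have "\<cc> \<subseteq> interior (gcone a b) \<union> - gcone a b"
    using regular_interior_basis[OF assms(1,2)] sub by blast
  moreover have "interior (gcone a b) \<inter> - gcone a b \<inter> \<cc> = {}" using interior_subset by blast
  moreover have "interior (gcone a b) \<inter> \<cc> \<noteq> {}"
    using regular_interior_basis[OF assms(1,2)] assms(4,5) sub by blast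
  moreover have "open (- gcone a b)" using closed_gcone[OF fb, of a] by auto
  ultimately have "- gcone a b \<inter> \<cc> = {}"
    using connectedD[OF in_components_connected[OF assms(3)] open_interior, of "- gcone a b" "gcone a b"] by blast
  then show ?thesis by blast
qed

lemma generic_regular:
  fixes a :: "nat \<Rightarrow> 'a::euclidean_space"
  assumes "finite N" "span (a ` N) = UNIV" "generic a N x" "x \<in> gcone a N"
  shows "x \<in> regular a N"
proof -
  have "x \<notin> gcone a J" if "J \<subseteq> N" "span (a ` J) \<noteq> UNIV" for J
    using that assms gcone_subset_span[OF finite_subset[OF that(1) assms(1)], of a] by (auto simp: generic_def)
  then show ?thesis using assms(4) by (auto simp: regular_def)
qed

lemma generic_dense:
  fixes a :: "nat \<Rightarrow> 'a::euclidean_space"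
  assumes "finite N" "span (a ` N) = UNIV" "open U"
  shows "U \<subseteq> closure (U \<inter> {x. generic a N x})"
proof
  fix x assume x: "x \<in> U"
  define \<K> where "\<K> = (\<lambda>J. span (a ` J)) ` {J \<in> Pow N. span (a ` J) \<noteq> UNIV}"
  have fK: "finite \<K>" and sK: "\<And>K. K \<in> \<K> \<Longrightarrow> subspace K" and pK: "\<And>K. K \<in> \<K> \<Longrightarrow> \<not> UNIV \<subseteq> K"
    using assms(1) by (auto simp: \<K>_def)
  obtain w where w: "\<forall>K\<in>\<K>. w \<notin> K" using subspace_avoid[OF fK sK subspace_UNIV pK] by blast
  have "isCont (\<lambda>t::real. x + t *\<^sub>R w) 0" by (intro continuous_intros)
  then have lim: "((\<lambda>t::real. x + t *\<^sub>R w) \<longlongrightarrow> x) (at_right 0)"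
    by (auto simp: isCont_def intro: tendsto_within_subset)
  have "\<forall>\<^sub>F t in at_right 0. \<forall>K\<in>\<K>. x + t *\<^sub>R w \<notin> K"
    using w sK by (intro eventually_ball_finite fK ballI eventually_not_in_subspace) auto
  moreover have "\<forall>\<^sub>F t in at_right 0. x + t *\<^sub>R w \<in> U" by (rule topological_tendstoD[OF lim assms(3) x])
  ultimately have "\<forall>\<^sub>F t in at_right 0. x + t *\<^sub>R w \<in> closure (U \<inter> {x. generic a N x})"
  proof eventually_elim
    case (elim t)
    then have "generic a N (x + t *\<^sub>R w)" using assms(2) by (auto simp: generic_def \<K>_def)
    then have "x + t *\<^sub>R w \<in> U \<inter> {x. generic a N x}" using elim by simp
    then show ?case by (rule closure_subset[THEN subsetD])
  qed
  then show "x \<in> closure (U \<inter> {x. generic a N x})"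
    by (rule Lim_in_closed_set[OF closed_closure _ trivial_limit_at_right_real lim])
qed

text \<open>If \<open>- a i\<close> is \<open>c\<close> times a point \<open>x\<close> of the hull,
  the convex combination of \<open>a i\<close> and \<open>x\<close> with weights
  \<open>1 / (1 + c)\<close> and \<open>c / (1 + c)\<close> is 0.\<close>

lemma pointed_hull:
  fixes a :: "nat \<Rightarrow> 'a::euclidean_space"
  assumes "finite I" "0 \<notin> convex hull (a ` I)"
  shows "pointed a I"
  unfolding pointed_def
proof (intro ballI notI)
  fix i assume i: "i \<in> I" "- a i \<in> gcone a I"
  have ai: "a i \<in> convex hull (a ` I)" using i by (simp add: hull_inc)
  have "- a i \<in> insert 0 (\<Union>x\<in>convex hull (a ` I). \<Union>c\<in>{0..}. {c *\<^sub>R x})"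
    using i(2) unfolding gcone_eq_hull[OF assms(1)] convex_cone_hull_convex_hull .
  moreover have "a i \<noteq> 0" using ai assms(2) by metis
  ultimately obtain x c where xc: "x \<in> convex hull (a ` I)" "0 \<le> c" "- a i = c *\<^sub>R x" by auto
  have "(1 / (1 + c)) *\<^sub>R a i + (c / (1 + c)) *\<^sub>R x \<in> convex hull (a ` I)"
    using xc ai by (intro convexD[OF convex_convex_hull]) (auto simp: field_simps)
  moreover have "(1 / (1 + c)) *\<^sub>R a i + (c / (1 + c)) *\<^sub>R x = (1 / (1 + c)) *\<^sub>R (a i + c *\<^sub>R x)"
    by (simp add: scaleR_add_right)
  moreover have "a i + c *\<^sub>R x = 0" using xc(3) by (metis add.right_inverse)
  ultimately show False using assms(2) by simp
qed

section \<open>The spline of a list\<close>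

lemma nth_image_lessThan: "(!) X ` {..<length X} = set X"
  by (auto simp: set_conv_nth)

lemma cone_of_eq_hull: "cone_of A = convex_cone hull (set A)"
proof -
  have "cone_of A = gcone ((!) A) {..<length A}"
  proof (intro set_eqI iffI)
    fix x assume "x \<in> gcone ((!) A) {..<length A}"
    then obtain t where t: "x = (\<Sum>i<length A. t i *\<^sub>R A ! i)" "\<forall>i<length A. 0 \<le> t i"
      by (auto simp: gcone_def)
    \<comment> \<open>\<open>cone_of\<close> demands nonnegativity at all indices, also past the end
      of the list, hence the extension by 0.\<close>
    then show "x \<in> cone_of A"
      unfolding cone_of_def by (intro CollectI exI[of _ "\<lambda>i. if i < length A then t i else 0"]) auto
  qed (auto simp: cone_of_def gcone_def)
  then show ?thesis by (simp add: gcone_eq_hull nth_image_lessThan)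
qed

lemma set_nths_image: "J \<subseteq> {..<length X} \<Longrightarrow> set (nths X J) = (!) X ` J"
  by (auto simp: set_nths)

lemma cone_of_nths: "J \<subseteq> {..<length X} \<Longrightarrow> cone_of (nths X J) = gcone ((!) X) J"
  using finite_subset[of J "{..<length X}"] by (simp add: cone_of_eq_hull gcone_eq_hull set_nths_image)

lemma cone_of_eq_gcone: "cone_of X = gcone ((!) X) {..<length X}"
  using cone_of_nths[of "{..<length X}" X] by simp

lemma nths_eq_map: "nths X J = map ((!) X) (filter (\<lambda>i. i \<in> J) [0..<length X])"
proof -
  have "zip X [0..<length X] = map (\<lambda>i. (X ! i, i)) [0..<length X]"
    by (rule nth_equalityI) auto
  then show ?thesis by (simp add: nths_def filter_map o_def)
qed

lemma no_broken_bases_eq: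
  assumes "span (set X) = UNIV"
  shows "no_broken_bases X = nb_bases ((!) X) {..<length X}"
proof -
  have "extracted_basis X I \<longleftrightarrow> I \<in> bases ((!) X) {..<length X}" for I
    using assms finite_subset[of I "{..<length X}"]
    by (auto simp: extracted_basis_def bases_def lin_indep_iff nth_image_lessThan)
  moreover have "{i. breaks X I i} = {i \<in> {..<length X}. \<exists>k\<in>I. i \<le> k \<and> X ! i \<in> span ((!) X ` {j \<in> I. k \<le> j})}" for I
    by (auto simp: breaks_def)
  ultimately show ?thesis unfolding no_broken_bases_def nb_bases_def by simp
qed

lemma regular_points_eq: "regular_points X = regular ((!) X) {..<length X}"
proof -
  have "{J. J \<subseteq> {..<length X} \<and> span (set (nths X J)) \<noteq> UNIV} =
      {J. J \<subseteq> {..<length X} \<and> span ((!) X ` J) \<noteq> UNIV}"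
    by (intro Collect_cong conj_cong refl) (simp add: set_nths_image)
  then have "singular_points X = (\<Union>J\<in>{J. J \<subseteq> {..<length X} \<and> span ((!) X ` J) \<noteq> UNIV}. gcone ((!) X) J)"
    unfolding singular_points_def by (intro SUP_cong) (simp_all add: cone_of_nths)
  then show ?thesis unfolding regular_points_def regular_def cone_of_eq_gcone by simp
qed

text \<open>In the coordinates of \<open>b\<close> the parallelepiped is the unit cube, whose
  positive volume comes with \<open>nn_integral_comb_basis\<close>. Both existence and uniqueness
  cancel this volume.\<close>

lemma measure_parallelepiped_pos:
  fixes b :: "'a::euclidean_space list"
  assumes "distinct b" "independent (set b)" "span (set b) = UNIV"
  shows "0 < measure lborel (parallelepiped b)"
proof -
  let ?I = "{..<length b}"
  note im = nth_image_lessThan[of b]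
  have L: "lin_indep ((!) b) ?I"
    using assms(1,2) by (simp add: lin_indep_iff im inj_on_nth)
  have U: "span ((!) b ` ?I) = UNIV" using assms(3) im by simp
  have "parallelepiped b = {x. \<forall>i\<in>?I. 0 \<le> coord ((!) b) ?I x i \<and> coord ((!) b) ?I x i \<le> 1}" (is "_ = ?R")
  proof (intro set_eqI iffI)
    fix x assume "x \<in> parallelepiped b"
    then show "x \<in> ?R" using coord_unique[OF L] by (auto simp: parallelepiped_def)
  next
    fix x assume x: "x \<in> ?R"
    have "x = (\<Sum>i<length b. coord ((!) b) ?I x i *\<^sub>R b ! i)"
      using coord_sum[of ?I x "(!) b"] U by simp
    also have "\<dots> = (\<Sum>i<length b. (if i < length b then coord ((!) b) ?I x i else 0) *\<^sub>R b ! i)"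
      by (intro sum.cong) auto
    finally show "x \<in> parallelepiped b"
      unfolding parallelepiped_def using x
      by (intro CollectI exI[of _ "\<lambda>i. if i < length b then coord ((!) b) ?I x i else 0"]) auto
  qed
  then show ?thesis using nn_integral_comb_basis[OF L U] by metis
qed

lemma scale_lborel_integral:
  fixes f :: "'a::euclidean_space \<Rightarrow> real"
  assumes "0 < c" "f \<in> borel_measurable borel"
  shows "(\<integral>x. f x \<partial>scale_measure (ennreal c) lborel) = c * (\<integral>x. f x \<partial>lborel)"
proof -
  have "scale_measure (ennreal c) lborel = density (lborel :: 'a measure) (\<lambda>_. ennreal c)"
    by (rule measure_eqI) (simp_all add: emeasure_density_const)
  then show ?thesis using assms by (simp add: integral_density)
qed

text \<open>Integration against the scaled measure gains a factor \<open>c\<close>, so the density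
  loses it. Uniqueness of a density continuous on the cone resolves the \<open>THE\<close>.\<close>

lemma multivariate_spline_eq:
  fixes X :: "'a::euclidean_space list"
  assumes "0 < c" "spline ((!) X) {..<length X} T" "span ((!) X ` {..<length X}) = UNIV"
  shows "multivariate_spline (scale_measure (ennreal c) lborel) X = (\<lambda>x. T x / c)"
proof -
  let ?N = "{..<length X}" let ?M = "scale_measure (ennreal c) lborel :: 'a measure"
  have T: "continuous_on (gcone ((!) X) ?N) T" "\<And>x. x \<notin> gcone ((!) X) ?N \<Longrightarrow> T x = 0"
    using assms(2) by (auto simp: spline_def)
  have meas: "S \<in> borel_measurable borel" if "is_multivariate_spline ?M X S" for S
    by (rule measurable_cone_supported[of ?N "(!) X"])
      (use that in \<open>auto simp: is_multivariate_spline_def cone_of_eq_gcone\<close>)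
  have 1: "is_multivariate_spline ?M X (\<lambda>x. T x / c)"
    unfolding is_multivariate_spline_def cone_of_eq_gcone
  proof (intro conjI allI impI)
    show "continuous_on (gcone ((!) X) ?N) (\<lambda>x. T x / c)" using T assms(1) by (intro continuous_intros) auto
    fix f :: "'a \<Rightarrow> real" assume "continuous_on UNIV f \<and> compact (closure {x. f x \<noteq> 0})"
    then have f[measurable]: "f \<in> borel_measurable borel" by (auto intro: borel_measurable_continuous_onI)
    have [measurable]: "T \<in> borel_measurable borel" by (rule measurable_cone_supported[OF _ T]) simp
    have "(\<integral>x. f x * (T x / c) \<partial>?M) = c * (\<integral>x. f x * T x / c \<partial>lborel)"
      by (subst scale_lborel_integral[OF assms(1)]) auto
    also have "\<dots> = (\<integral>x. f x * T x \<partial>lborel)" using assms(1) by simp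
    also have "\<dots> = (LINT t : (?N \<rightarrow>\<^sub>E {0..}) | lprod ?N. f (\<Sum>i<length X. t i *\<^sub>R X ! i))"
      by (rule spline_integral[symmetric, OF _ assms(2) f]) simp
    finally show "(\<integral>x. f x * (T x / c) \<partial>?M) = (LINT t : (?N \<rightarrow>\<^sub>E {0..}) | lprod ?N. f (\<Sum>i<length X. t i *\<^sub>R X ! i))" .
  qed (use T in auto)
  have "S = S'" if S: "is_multivariate_spline ?M X S" and S': "is_multivariate_spline ?M X S'" for S S'
  proof (rule cone_function_unique[of ?N "(!) X"])
    fix f :: "'a \<Rightarrow> real" assume f: "continuous_on UNIV f" "compact (closure {x. f x \<noteq> 0})"
    then have [measurable]: "f \<in> borel_measurable borel" by (auto intro: borel_measurable_continuous_onI)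
    note [measurable] = meas[OF S] meas[OF S']
    have "(\<integral>x. f x * S x \<partial>?M) = (\<integral>x. f x * S' x \<partial>?M)"
      using S S' f by (simp add: is_multivariate_spline_def)
    then show "(\<integral>x. f x * S x \<partial>lborel) = (\<integral>x. f x * S' x \<partial>lborel)"
      using assms(1) by (simp add: scale_lborel_integral[OF assms(1)])
  qed (use S S' assms(3) in \<open>auto simp: is_multivariate_spline_def cone_of_eq_gcone\<close>)
  then show ?thesis unfolding multivariate_spline_def using 1 by (intro the_equality) auto
qed

theorem theorem3p6:
  fixes X :: "'a::euclidean_space list" and M :: "'a measure" and c :: real
  assumes "0 < c" and "M = scale_measure (ennreal c) lborel"
    and "0 \<notin> set X"
    and "span (set X) = UNIV"
    and "0 \<notin> convex hull (set X)"
  shows "\<exists>!p :: nat set \<Rightarrow> 'a \<Rightarrow> real.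
    p \<in> no_broken_bases X \<rightarrow>\<^sub>E {q \<in> D_space X. homogeneous_poly (length X - DIM('a)) q} \<and>
    (\<forall>\<cc>\<in>big_cells X. \<forall>x\<in>closure \<cc>.
       multivariate_spline M X x =
       (\<Sum>I | I \<in> no_broken_bases X \<and> \<cc> \<subseteq> cone_of (nths X I).
          inverse (abs_det M (nths X I)) * p I (- x)))"
proof -
  let ?N = "{..<length X}" and ?a = "(!) X" and ?NB = "no_broken_bases X" and ?d = "length X - DIM('a)"
  have fin: "finite ?N" by simp
  have U: "span (?a ` ?N) = UNIV" using assms(4) by (simp add: nth_image_lessThan)
  have pt: "pointed ?a ?N" by (rule pointed_hull) (use assms(5) in \<open>simp_all add: nth_image_lessThan\<close>)
  have NB: "?NB = nb_bases ?a ?N" by (rule no_broken_bases_eq[OF assms(4)])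
  have fNB: "finite ?NB" using NB finite_nb_bases[OF fin] by simp
  have NB_bases: "I \<in> bases ?a ?N" if "I \<in> ?NB" for I using that NB nb_bases_subset by blast
  have sub: "I \<subseteq> ?N" if "I \<in> ?NB" for I using NB_bases[OF that] by (simp add: bases_def)
  have cone: "cone_of (nths X I) = gcone ?a I" if "I \<in> ?NB" for I by (rule cone_of_nths[OF sub[OF that]])
  have cells: "big_cells X = components (regular ?a ?N)" by (simp add: big_cells_def regular_points_eq)
  have det: "abs_det M (nths X I) \<noteq> 0" if I: "I \<in> ?NB" for I
  proof -
    have L: "lin_indep ?a I" "span (?a ` I) = UNIV" using NB_bases[OF I] U by (auto simp: bases_def)
    have "distinct (nths X I)"
      using L(1) by (auto simp: nths_eq_map distinct_map lin_indep_iff intro: inj_on_subset)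
    moreover have "independent (set (nths X I))" "span (set (nths X I)) = UNIV"
      using L sub[OF I] by (auto simp: set_nths_image lin_indep_iff)
    ultimately have "0 < measure lborel (parallelepiped (nths X I))" by (rule measure_parallelepiped_pos)
    then show ?thesis using assms(1) by (simp add: abs_det_def assms(2))
  qed
  obtain T where T: "cone_spline ?a ?N T" using cone_spline_exists[OF fin pt U] by blast
  then have spT: "spline ?a ?N T" by (simp add: cone_spline_def)
  have MS: "multivariate_spline M X = (\<lambda>x. T x / c)"
    unfolding assms(2) by (rule multivariate_spline_eq[OF assms(1) spT U])
  have contT: "continuous_on (gcone ?a ?N) T" using spT by (simp add: spline_def)
  obtain q where q: "\<And>I. I \<in> ?NB \<Longrightarrow> real_polynomial_function (q I)"
    "\<And>x. generic ?a ?N x \<Longrightarrow> T x = (\<Sum>I\<in>?NB. if x \<in> gcone ?a I then q I x else 0)"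
    "\<And>I s x. I \<in> ?NB \<Longrightarrow> q I (s *\<^sub>R x) = s ^ ?d * q I x"
    "\<And>I js. I \<in> ?NB \<Longrightarrow> distinct js \<Longrightarrow> set js \<subseteq> ?N \<Longrightarrow> span (?a ` (?N - set js)) \<noteq> UNIV \<Longrightarrow>
      foldr dir_deriv (map ?a js) (q I) = (\<lambda>_. 0)"
    using spline_nb_polynomials[OF fin pt U T] unfolding NB card_lessThan by blast
  have cell_iff: "\<cc> \<subseteq> cone_of (nths X I) \<longleftrightarrow> x \<in> gcone ?a I"
    if "\<cc> \<in> big_cells X" "x \<in> \<cc>" "I \<in> ?NB" for \<cc> x I
    using cell_subset_gcone[OF NB_bases[OF that(3)] U] that cone[OF that(3)] unfolding cells by blast
  have cell_open: "open \<cc>" if "\<cc> \<in> big_cells X" for \<cc>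
    using open_components[OF open_regular[OF fin U]] that unfolding cells by blast
  \<comment> \<open>Chosen so that \<open>inverse (abs_det M (nths X I)) * p I (- x)\<close> is
    \<open>q I x / c\<close>, the division by \<open>c\<close> being that in \<open>MS\<close>. The
    restriction to \<open>?NB\<close> fixes the values at all other index sets, as the function
    space in the claim demands.\<close>
  define p where "p = (\<lambda>I\<in>?NB. \<lambda>x. (abs_det M (nths X I) / c) * q I (- x))"
  have poly_refl: "real_polynomial_function (\<lambda>x. k * f (- x))" if "real_polynomial_function f" for k and f :: "'a \<Rightarrow> real"
    using poly_linear_comp[OF that, of uminus]
    by (intro real_polynomial_function.intros(2,4)) (auto simp: linear_iff)
  let ?good = "\<lambda>p. \<forall>\<cc>\<in>big_cells X. \<forall>x\<in>closure \<cc>. multivariate_spline M X x =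
       (\<Sum>I | I \<in> ?NB \<and> \<cc> \<subseteq> cone_of (nths X I). inverse (abs_det M (nths X I)) * p I (- x))"
  have p_in: "p \<in> ?NB \<rightarrow>\<^sub>E {q \<in> D_space X. homogeneous_poly ?d q}"
  proof (intro PiE_I CollectI conjI)
    fix I assume I: "I \<in> ?NB"
    have pI: "p I = (\<lambda>x. (abs_det M (nths X I) / c) * q I (- x))" using I by (simp add: p_def)
    have poly: "real_polynomial_function (p I)" unfolding pI by (rule poly_refl[OF q(1)[OF I]])
    show "p I \<in> D_space X"
      unfolding D_space_def
    proof (intro CollectI conjI allI impI poly)
      fix J assume J: "cocircuit X J"
      \<comment> \<open>The elements of \<open>J\<close> in increasing order: the derivatives along
        \<open>nths X J\<close> become those along a distinct list of indices.\<close>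
      define js where "js = filter (\<lambda>i. i \<in> J) [0..<length X]"
      have js: "set js = J" "distinct js" using J by (auto simp: js_def cocircuit_def)
      have "span (?a ` (?N - set js)) \<noteq> UNIV"
        using J unfolding js(1) by (simp add: cocircuit_def set_nths_image)
      then have "foldr dir_deriv (map ?a js) (q I) = (\<lambda>_. 0)"
        using q(4)[OF I js(2)] J js(1) by (simp add: cocircuit_def)
      then show "foldr dir_deriv (nths X J) (p I) = (\<lambda>x. 0)"
        using foldr_dir_deriv_reflect[OF q(1)[OF I], of "map ?a js" "abs_det M (nths X I) / c"]
        unfolding pI nths_eq_map[of X J, folded js_def] by auto
    qed
    show "homogeneous_poly ?d (p I)"
      unfolding homogeneous_poly_def
    proof (intro conjI poly allI)
      fix t x show "p I (t *\<^sub>R x) = t ^ ?d * p I x"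
        using q(3)[OF I, of t "- x"] by (simp add: pI)
    qed
  qed (simp add: p_def)
  have p_good: "?good p"
  proof (intro ballI)
    fix \<cc> x assume c: "\<cc> \<in> big_cells X" and x: "x \<in> closure \<cc>"
    \<comment> \<open>\<open>T\<close> and the polynomial \<open>?F\<close> agree at the generic
      points of the cell, which are dense in its closure; both are continuous there, since the
      closure stays in the closed cone of \<open>X\<close>.\<close>
    let ?F = "\<lambda>z. \<Sum>I | I \<in> ?NB \<and> \<cc> \<subseteq> cone_of (nths X I). q I z"
    let ?G = "\<cc> \<inter> {z. generic ?a ?N z}"
    have "closure \<cc> \<subseteq> gcone ?a ?N"
      using c closed_gcone[OF fin] in_components_subset[of \<cc> "regular ?a ?N"]
      by (intro closure_minimal) (auto simp: cells regular_def)
    moreover have clG: "closure ?G = closure \<cc>"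
      using generic_dense[OF fin U cell_open[OF c]] by (intro antisym closure_mono closure_minimal) auto
    ultimately have "continuous_on (closure ?G) (\<lambda>z. T z - ?F z)"
      using q(1) by (intro continuous_on_diff continuous_on_sum continuous_on_subset[OF contT]
          continuous_at_imp_continuous_on ballI continuous_real_polymonial_function) auto
    then have "T x - ?F x = 0"
    proof (rule continuous_constant_on_closure)
      fix z assume z: "z \<in> ?G"
      have "T z = (\<Sum>I\<in>?NB. if z \<in> gcone ?a I then q I z else 0)" using q(2) z by blast
      also have "\<dots> = (\<Sum>I\<in>{I \<in> ?NB. z \<in> gcone ?a I}. q I z)" by (rule sum.inter_filter[OF fNB, symmetric])
      also have "{I \<in> ?NB. z \<in> gcone ?a I} = {I. I \<in> ?NB \<and> \<cc> \<subseteq> cone_of (nths X I)}"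
        using cell_iff[OF c] z by blast
      finally show "T z - ?F z = 0" by simp
    qed (use x clG in simp)
    then have "multivariate_spline M X x = ?F x / c" by (simp add: MS)
    also have "\<dots> = (\<Sum>I | I \<in> ?NB \<and> \<cc> \<subseteq> cone_of (nths X I). inverse (abs_det M (nths X I)) * p I (- x))"
      unfolding sum_divide_distrib using det by (intro sum.cong) (auto simp: p_def)
    finally show "multivariate_spline M X x =
       (\<Sum>I | I \<in> ?NB \<and> \<cc> \<subseteq> cone_of (nths X I). inverse (abs_det M (nths X I)) * p I (- x))" .
  qed
  have unique: "p1 = p2"
    if p1: "p1 \<in> ?NB \<rightarrow>\<^sub>E {q \<in> D_space X. homogeneous_poly ?d q}" "?good p1"
      and p2: "p2 \<in> ?NB \<rightarrow>\<^sub>E {q \<in> D_space X. homogeneous_poly ?d q}" "?good p2" for p1 p2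
  proof (rule PiE_ext[OF p1(1) p2(1)])
    fix I0 assume I0: "I0 \<in> ?NB"
    \<comment> \<open>The summands of the difference of the two formulas. Their sum over the basis
      cones containing a cell vanishes on that open cell, hence identically; at a fixed
      \<open>y\<close> the numbers \<open>w I y\<close> thus satisfy the hypothesis of
      \<open>nb_cones_independent\<close>.\<close>
    define w where "w I x = inverse (abs_det M (nths X I)) * p1 I (- x) - inverse (abs_det M (nths X I)) * p2 I (- x)" for I x
    have polyw: "real_polynomial_function (w I)" if "I \<in> ?NB" for I
    proof -
      have "real_polynomial_function (p1 I)" "real_polynomial_function (p2 I)"
        using p1(1) p2(1) that by (auto simp: D_space_def)
      then show ?thesis unfolding w_def[abs_def] by (intro real_polynomial_function_diff poly_refl)
    qed
    have w0: "w I0 y = 0" for y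
    proof (rule nb_cones_independent[OF fin pointed_nonzero[OF pt], where v = "\<lambda>I. w I y"])
      show "I0 \<in> nb_bases ?a ?N" using I0 NB by simp
      fix x assume x: "generic ?a ?N x"
      have "(\<Sum>I\<in>?NB. if x \<in> gcone ?a I then w I y else 0) = 0"
      proof (cases "x \<in> gcone ?a ?N")
        case True
        then have "x \<in> regular ?a ?N" by (rule generic_regular[OF fin U x])
        then obtain \<cc> where c: "\<cc> \<in> big_cells X" "x \<in> \<cc>"
          using Union_components[of "regular ?a ?N"] unfolding cells by blast
        let ?S = "{I. I \<in> ?NB \<and> \<cc> \<subseteq> cone_of (nths X I)}"
        have "real_polynomial_function (\<lambda>z. \<Sum>I\<in>?S. w I z)"
          using fNB polyw by (intro real_polynomial_function_sum) auto
        moreover have "(\<Sum>I\<in>?S. w I z) = 0" if "z \<in> \<cc>" for z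
        proof -
          have "z \<in> closure \<cc>" using that closure_subset by blast
          from p1(2)[rule_format, OF c(1) this] p2(2)[rule_format, OF c(1) this]
          show ?thesis unfolding w_def sum_subtractf by simp
        qed
        ultimately have "(\<lambda>z. \<Sum>I\<in>?S. w I z) = (\<lambda>_. 0)"
          by (intro poly_zero_open[OF _ cell_open[OF c(1)] c(2)])
        then have "(\<Sum>I\<in>?S. w I y) = 0" by (rule fun_cong)
        moreover have "?S = {I \<in> ?NB. x \<in> gcone ?a I}" using cell_iff[OF c] by blast
        ultimately show ?thesis by (simp add: sum.inter_filter[OF fNB])
      next
        case False
        then have "x \<notin> gcone ?a I" if "I \<in> ?NB" for I using gcone_mono[OF sub[OF that] fin] by blast
        then show ?thesis by (intro sum.neutral) auto
      qed
      then show "(\<Sum>I\<in>nb_bases ?a ?N. if x \<in> gcone ?a I then w I y else 0) = 0" using NB by simp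
    qed
    show "p1 I0 = p2 I0"
    proof
      fix y show "p1 I0 y = p2 I0 y" using w0[of "- y"] det[OF I0] by (simp add: w_def)
    qed
  qed
  show ?thesis
  proof (rule ex1I[of _ p])
    fix p' assume "p' \<in> ?NB \<rightarrow>\<^sub>E {q \<in> D_space X. homogeneous_poly ?d q} \<and> ?good p'"
    then show "p' = p" by (elim conjE) (rule unique[OF _ _ p_in p_good])
  qed (rule conjI[OF p_in p_good])
qed

end
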